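(* Let $G,H$ be countable, discrete groups and assume that $H$ is sofic. Then: (i) if $G$ is sofic, then so is $G\wr H$; (ii) if $G$ is hyperlinear, then so is $G\wr H$; (iii) for any field $\mathbb{F}$, if $G$ is linear sofic over $\mathbb{F}$, then so is $G\wr H$; (iv) if $G$ is weakly sofic, then so is $G\wr H$.
   Context: The (restricted, regular) wreath product is $G\wr H=\left(\bigoplus_{H}G\right)\rtimes H$, where $h\in H$ acts on $\bigoplus_H G$ by $\alpha_h\big((g_x)_{x\in H}\big)=(g_{h^{-1}x})_{x\in H}$. A metric $d$ on a group $K$ is bi-invariant if $d(axb,ayb)=d(x,y)$ for all $a,b,x,y\in K$. Let $K$ be a group with a bi-invariant metric $d$, let $\theta\colon G\to K$ be a function, and let $F\subseteq G$. For $\varepsilon>0$, $\theta$ is $(F,\varepsilon,d)$-multiplicative if $\theta(1)=1$ and $\max_{g,h\in F}d(\theta(gh),\theta(g)\theta(h))<\varepsilon$. For a function $c\colon G\setminus\{1\}\to(0,\infty)$, $\theta$ is $(F,c,d)$-injective if $d(\theta(g),1)\geq c(g)$ for all $g\in F\setminus\{1\}$. Let $\mathcal{C}$ be a class of pairs $(K,d)$, with $K$ a group and $d$ a bi-invariant metric on $K$ (the same group may occur with several metrics). A group $G$ is $\mathcal{C}$-approximable if there is a function $c\colon G\setminus\{1\}\to(0,\infty)$ such that for every finite $F\subseteq G$ and every $\varepsilon>0$ there are $(K,d)\in\mathcal{C}$ and a function $\theta\colon G\to K$ that is $(F,\varepsilon,d)$-multiplicative and $(F,c,d)$-injective. Sofic: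 for a finite set $A$, let $d_{\mathrm{Hamm}}(\pi,\tau)=\frac{1}{|A|}|\{a\in A:\pi(a)\neq\tau(a)\}|$ on $\mathrm{Sym}(A)$ and $\ell_{\mathrm{Hamm}}(\pi)=d_{\mathrm{Hamm}}(\pi,1)$. A countable discrete group $G$ is sofic if for every finite $F\subseteq G$ and $\varepsilon>0$ there are a finite set $A$ and a function $\sigma\colon G\to\mathrm{Sym}(A)$ that is $(F,\varepsilon,d_{\mathrm{Hamm}})$-multiplicative and satisfies $\min_{g\in F\setminus\{1\}}\ell_{\mathrm{Hamm}}(\sigma(g))>1-\varepsilon$. (Equivalently, $G$ is $\mathcal{C}$-approximable for $\mathcal{C}$ the class of finite symmetric groups with the normalized Hamming distance.) Hyperlinear: $\mathcal{C}$-approximable, where $\mathcal{C}$ is the class of unitary groups $\mathcal{U}(n)$, $n\ge 1$, with the normalized Hilbert-Schmidt metric $d_{\mathrm{HS}}(U,V)=\|U-V\|_2$, where $\|A\|_2=\mathrm{tr}(A^*A)^{1/2}$ and $\mathrm{tr}(A)=\frac1n\sum_{j=1}^n A_{jj}$ for $A\in M_n(\mathbb{C})$. Linear sofic over a field $\mathbb{F}$: $\mathcal{C}$-approximable, where $\mathcal{C}$ is the class of general linear groups $\mathrm{GL}_n(\mathbb{F})$, $n\ge1$, with the metric $d_{\mathrm{rk}}(A,B)=\frac1n\mathrm{Rank}(A-B)$. Weakly sofic: $\mathcal{C}$-approximable, where $\mathcal{C}$ is the class of all pairs $(K,d)$ with $K$ a finite group and $d$ any bi-invariant metric on $K$. 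*)

theory Defs
  imports
    "HOL-Algebra.Product_Groups"
    "HOL-Algebra.Bij"
    "HOL-Library.Countable_Set"
    "HOL-Analysis.Abstract_Metric_Spaces"
    "Jordan_Normal_Form.DL_Rank"
    "Jordan_Normal_Form.Schur_Decomposition"
begin

section \<open>Wreath products\<close>

definition semidirect_product ::
  "('a, 'm) monoid_scheme \<Rightarrow> ('b, 'n) monoid_scheme \<Rightarrow> ('b \<Rightarrow> 'a \<Rightarrow> 'a) \<Rightarrow> ('a \<times> 'b) monoid" where
  "semidirect_product N H \<alpha> =
     \<lparr>carrier = carrier N \<times> carrier H,
      monoid.mult = (\<lambda>(n, h) (n', h'). (n \<otimes>\<^bsub>N\<^esub> \<alpha> h n', h \<otimes>\<^bsub>H\<^esub> h')),
      one = (\<one>\<^bsub>N\<^esub>, \<one>\<^bsub>H\<^esub>)\<rparr>"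

definition shift_action :: "('b, 'n) monoid_scheme \<Rightarrow> 'b \<Rightarrow> ('b \<Rightarrow> 'a) \<Rightarrow> 'b \<Rightarrow> 'a" where
  "shift_action H h g = (\<lambda>x\<in>carrier H. g (inv\<^bsub>H\<^esub> h \<otimes>\<^bsub>H\<^esub> x))"

definition wreath_product ::
  "('a, 'm) monoid_scheme \<Rightarrow> ('b, 'n) monoid_scheme \<Rightarrow> (('b \<Rightarrow> 'a) \<times> 'b) monoid" where
  "wreath_product G H =
     semidirect_product (sum_group (carrier H) (\<lambda>_. G)) H (shift_action H)"

lemma group_wreath_product:
  assumes "group G" and "group H"
  shows "group (wreath_product G H)"
proof -
  interpret G: group G by fact
  interpret H: group H by fact
  define S where "S = sum_group (carrier H) (\<lambda>_. G)"
  interpret S: group S unfolding S_def by (simp add: assms)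
  have car: "carrier S =
      {f \<in> carrier H \<rightarrow>\<^sub>E carrier G. finite {x \<in> carrier H. f x \<noteq> \<one>\<^bsub>G\<^esub>}}"
    unfolding S_def by (simp add: assms carrier_sum_group)
  have multS: "f \<otimes>\<^bsub>S\<^esub> g = (\<lambda>x\<in>carrier H. f x \<otimes>\<^bsub>G\<^esub> g x)" for f g
    unfolding S_def by simp
  have oneS: "\<one>\<^bsub>S\<^esub> = (\<lambda>x\<in>carrier H. \<one>\<^bsub>G\<^esub>)"
    unfolding S_def by simp
  have closed: "shift_action H h f \<in> carrier S" if h: "h \<in> carrier H" and f: "f \<in> carrier S" for h f
  proof -
    have "{x \<in> carrier H. f (inv\<^bsub>H\<^esub> h \<otimes>\<^bsub>H\<^esub> x) \<noteq> \<one>\<^bsub>G\<^esub>}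
        \<subseteq> (\<lambda>y. h \<otimes>\<^bsub>H\<^esub> y) ` {y \<in> carrier H. f y \<noteq> \<one>\<^bsub>G\<^esub>}"
    proof
      fix x assume x: "x \<in> {x \<in> carrier H. f (inv\<^bsub>H\<^esub> h \<otimes>\<^bsub>H\<^esub> x) \<noteq> \<one>\<^bsub>G\<^esub>}"
      then have "x = h \<otimes>\<^bsub>H\<^esub> (inv\<^bsub>H\<^esub> h \<otimes>\<^bsub>H\<^esub> x)"
        using h by (simp add: H.m_assoc [symmetric])
      with x h show "x \<in> (\<lambda>y. h \<otimes>\<^bsub>H\<^esub> y) ` {y \<in> carrier H. f y \<noteq> \<one>\<^bsub>G\<^esub>}" by blast
    qed
    then have "finite {x \<in> carrier H. f (inv\<^bsub>H\<^esub> h \<otimes>\<^bsub>H\<^esub> x) \<noteq> \<one>\<^bsub>G\<^esub>}"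
      using f by (auto simp: car intro: finite_subset)
    with h f show ?thesis
      by (auto simp: car shift_action_def PiE_iff cong: conj_cong)
  qed
  have hom: "shift_action H h (f \<otimes>\<^bsub>S\<^esub> g) = shift_action H h f \<otimes>\<^bsub>S\<^esub> shift_action H h g"
    if "h \<in> carrier H" for h f g
    using that by (auto simp: multS shift_action_def)
  have comp: "shift_action H (h \<otimes>\<^bsub>H\<^esub> k) f = shift_action H h (shift_action H k f)"
    if "h \<in> carrier H" "k \<in> carrier H" for h k f
    using that by (auto simp: shift_action_def H.inv_mult_group H.m_assoc intro!: restrict_ext)
  have unit: "shift_action H \<one>\<^bsub>H\<^esub> f = f" if "f \<in> carrier S" for f
    using that by (auto simp: shift_action_def car PiE_iff extensional_def)
  have unit': "shift_action H h \<one>\<^bsub>S\<^esub> = \<one>\<^bsub>S\<^esub>" if "h \<in> carrier H" for h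
    using that by (auto simp: shift_action_def oneS)
  have "group (semidirect_product S H (shift_action H))"
  proof (rule groupI, goal_cases)
    case (5 x)
    then obtain f h where x: "x = (f, h)" "f \<in> carrier S" "h \<in> carrier H"
      by (auto simp: semidirect_product_def)
    show ?case
    proof (rule bexI [of _ "(shift_action H (inv\<^bsub>H\<^esub> h) (inv\<^bsub>S\<^esub> f), inv\<^bsub>H\<^esub> h)"])
      have "shift_action H (inv\<^bsub>H\<^esub> h) (inv\<^bsub>S\<^esub> f) \<otimes>\<^bsub>S\<^esub> shift_action H (inv\<^bsub>H\<^esub> h) f = \<one>\<^bsub>S\<^esub>"
        using x by (simp add: hom [symmetric] unit')
      then show "(shift_action H (inv\<^bsub>H\<^esub> h) (inv\<^bsub>S\<^esub> f), inv\<^bsub>H\<^esub> h)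
            \<otimes>\<^bsub>semidirect_product S H (shift_action H)\<^esub> x
          = \<one>\<^bsub>semidirect_product S H (shift_action H)\<^esub>"
        using x by (simp add: semidirect_product_def)
    qed (use x closed in \<open>auto simp: semidirect_product_def\<close>)
  qed (auto simp: semidirect_product_def closed hom comp unit S.m_assoc H.m_assoc)
  then show ?thesis
    by (simp add: wreath_product_def S_def)
qed

section \<open>Approximation by groups with bi-invariant metrics\<close>

definition bi_invariant_metric :: "('k, 'm) monoid_scheme \<Rightarrow> ('k \<Rightarrow> 'k \<Rightarrow> real) \<Rightarrow> bool" where
  "bi_invariant_metric K d \<longleftrightarrow> Metric_space (carrier K) d \<and>
     (\<forall>a\<in>carrier K. \<forall>b\<in>carrier K. \<forall>x\<in>carrier K. \<forall>y\<in>carrier K.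
        d (a \<otimes>\<^bsub>K\<^esub> x \<otimes>\<^bsub>K\<^esub> b) (a \<otimes>\<^bsub>K\<^esub> y \<otimes>\<^bsub>K\<^esub> b) = d x y)"

definition multiplicative_map ::
  "('a, 'm) monoid_scheme \<Rightarrow> ('k, 'n) monoid_scheme \<Rightarrow> 'a set \<Rightarrow> real \<Rightarrow> ('k \<Rightarrow> 'k \<Rightarrow> real)
     \<Rightarrow> ('a \<Rightarrow> 'k) \<Rightarrow> bool" where
  "multiplicative_map G K F \<epsilon> d \<theta> \<longleftrightarrow>
     \<theta> \<one>\<^bsub>G\<^esub> = \<one>\<^bsub>K\<^esub> \<and> (\<forall>g\<in>F. \<forall>h\<in>F. d (\<theta> (g \<otimes>\<^bsub>G\<^esub> h)) (\<theta> g \<otimes>\<^bsub>K\<^esub> \<theta> h) < \<epsilon>)"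

definition injective_map ::
  "('a, 'm) monoid_scheme \<Rightarrow> ('k, 'n) monoid_scheme \<Rightarrow> 'a set \<Rightarrow> ('a \<Rightarrow> real) \<Rightarrow> ('k \<Rightarrow> 'k \<Rightarrow> real)
     \<Rightarrow> ('a \<Rightarrow> 'k) \<Rightarrow> bool" where
  "injective_map G K F c d \<theta> \<longleftrightarrow> (\<forall>g\<in>F - {\<one>\<^bsub>G\<^esub>}. d (\<theta> g) \<one>\<^bsub>K\<^esub> \<ge> c g)"

definition approximable ::
  "('k monoid \<times> ('k \<Rightarrow> 'k \<Rightarrow> real)) set \<Rightarrow> ('a, 'm) monoid_scheme \<Rightarrow> bool" where
  "approximable \<C> G \<longleftrightarrow> group G \<and>
     (\<exists>c. (\<forall>g\<in>carrier G - {\<one>\<^bsub>G\<^esub>}. 0 < c g) \<and>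
        (\<forall>F \<epsilon>. F \<subseteq> carrier G \<and> finite F \<and> 0 < \<epsilon> \<longrightarrow>
          (\<exists>(K, d)\<in>\<C>. \<exists>\<theta>\<in>carrier G \<rightarrow> carrier K.
             multiplicative_map G K F \<epsilon> d \<theta> \<and> injective_map G K F c d \<theta>)))"

section \<open>Sofic groups\<close>

definition hamming_dist :: "'x set \<Rightarrow> ('x \<Rightarrow> 'x) \<Rightarrow> ('x \<Rightarrow> 'x) \<Rightarrow> real" where
  "hamming_dist A \<pi> \<tau> = real (card {a\<in>A. \<pi> a \<noteq> \<tau> a}) / real (card A)"

definition hamming_length :: "'x set \<Rightarrow> ('x \<Rightarrow> 'x) \<Rightarrow> real" where
  "hamming_length A \<pi> = hamming_dist A \<pi> \<one>\<^bsub>BijGroup A\<^esub>"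

text \<open>
  Up to a bijection, which preserves the symmetric group and its Hamming distance, every finite
  set is a set of natural numbers. It has to be nonempty for the normalisation to make sense.
\<close>

definition sofic :: "('a, 'm) monoid_scheme \<Rightarrow> bool" where
  "sofic G \<longleftrightarrow> group G \<and> countable (carrier G) \<and>
     (\<forall>F \<epsilon>. F \<subseteq> carrier G \<and> finite F \<and> 0 < \<epsilon> \<longrightarrow>
       (\<exists>(A :: nat set) \<sigma>. finite A \<and> A \<noteq> {} \<and> \<sigma> \<in> carrier G \<rightarrow> carrier (BijGroup A) \<and>
          multiplicative_map G (BijGroup A) F \<epsilon> (hamming_dist A) \<sigma> \<and>
          (\<forall>g\<in>F - {\<one>\<^bsub>G\<^esub>}. hamming_length A (\<sigma> g) > 1 - \<epsilon>)))"

section \<open>Hyperlinear groups\<close>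

definition unitary_group :: "nat \<Rightarrow> complex mat monoid" where
  "unitary_group n =
     \<lparr>carrier = {U \<in> carrier_mat n n. mat_adjoint U * U = 1\<^sub>m n \<and> U * mat_adjoint U = 1\<^sub>m n},
      monoid.mult = (*), one = 1\<^sub>m n\<rparr>"

definition normalized_trace :: "nat \<Rightarrow> complex mat \<Rightarrow> complex" where
  "normalized_trace n A = (1 / of_nat n) * (\<Sum>j<n. A $$ (j, j))"

text \<open>The trace of \<open>A\<^sup>* A\<close> is a nonnegative real number, so taking its real part loses nothing.\<close>

definition hs_norm :: "nat \<Rightarrow> complex mat \<Rightarrow> real" where
  "hs_norm n A = sqrt (Re (normalized_trace n (mat_adjoint A * A)))"

definition hs_dist :: "nat \<Rightarrow> complex mat \<Rightarrow> complex mat \<Rightarrow> real" where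
  "hs_dist n U V = hs_norm n (U - V)"

definition hyperlinear :: "('a, 'm) monoid_scheme \<Rightarrow> bool" where
  "hyperlinear G \<longleftrightarrow> approximable {(unitary_group n, hs_dist n) | n. n \<ge> 1} G"

section \<open>Linear sofic groups\<close>

definition general_linear_group :: "'f::field itself \<Rightarrow> nat \<Rightarrow> 'f mat monoid" where
  "general_linear_group F n = units_of (ring_mat F n ())"

definition rank_dist :: "nat \<Rightarrow> 'f::field mat \<Rightarrow> 'f mat \<Rightarrow> real" where
  "rank_dist n A B = real (vec_space.rank n (A - B)) / real n"

definition linear_sofic :: "'f::field itself \<Rightarrow> ('a, 'm) monoid_scheme \<Rightarrow> bool" where
  "linear_sofic F G \<longleftrightarrow> approximable {(general_linear_group F n, rank_dist n) | n. n \<ge> 1} G"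

section \<open>Weakly sofic groups\<close>

text \<open>Up to isomorphism, every finite group has a set of natural numbers as its carrier.\<close>

definition weakly_sofic :: "('a, 'm) monoid_scheme \<Rightarrow> bool" where
  "weakly_sofic G \<longleftrightarrow>
     approximable {(K :: nat monoid, d). group K \<and> finite (carrier K) \<and> bi_invariant_metric K d} G"

end

theory Submission
  imports Defs
begin

text \<open>
  Let \<open>\<theta> : G \<rightarrow> K\<close> be an approximation of \<open>G\<close> and \<open>\<sigma> : H \<rightarrow> Sym(A)\<close> a sofic model of \<open>H\<close>. A lamp
  configuration \<open>f\<close> lives on \<open>H\<close>, and has to be drawn on \<open>A\<close>. Each point \<open>b\<close> of \<open>A\<close> offers a chart
  \<open>v \<mapsto> \<sigma>(v\<inverse>) b\<close>, which is injective on a given finite subset of \<open>H\<close> for most \<open>b\<close>. Put \<open>\<theta>(f(v))\<close>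
  at the place \<open>\<sigma>(v\<inverse>) b\<close> and \<open>1\<close> elsewhere; this is an element \<open>\<kappa>(f, b)\<close> of \<open>K\<^sup>A\<close>. For most \<open>b\<close>
  we have \<open>\<sigma>((hw)\<inverse>) (\<sigma>(h) b) = \<sigma>(w\<inverse>) b\<close>: the chart at \<open>\<sigma>(h) b\<close> shows \<open>hw\<close> where the chart at
  \<open>b\<close> shows \<open>w\<close>. Moving the base point by \<open>\<sigma>(h)\<close> thus shifts configurations by \<open>h\<close>, and
  \<open>(f, h) \<mapsto> (b \<mapsto> \<kappa>(f, \<sigma>(h) b), \<sigma>(h))\<close> is an almost multiplicative map into the permutational
  wreath product of \<open>K\<^sup>A\<close> with \<open>Sym(A)\<close>: the two sides of the equation for products have the same
  permutation and nearly the same lamps at most points \<open>b\<close> (\<open>lamps_almost_mult\<close>).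

  It remains to map this wreath product back into the given class of groups, so that an error at a
  few points \<open>b\<close> costs little, while a single coordinate of \<open>K\<^sup>A\<close> stays visible with a constant
  that depends neither on \<open>A\<close> nor on the finite set to be approximated. Two operations do this:
  a tensor product, isometric in each variable, which takes care of \<open>K\<^sup>A\<close>, and block monomial
  matrices, which take care of the permutations. Isometry in each variable implies that the errors in
  the coordinates add up at most, and only boundedly many coordinates carry an error. But a tensor
  product can hide a coordinate, as \<open>(-1) \<otimes> (-1) = 1\<close> shows. So \<open>k \<in> K\<^sup>A\<close> is first sent to the direct
  sum, over all subsets \<open>S\<close> of \<open>A\<close>, of the tensor products of the \<open>k(y)\<close> with \<open>y \<in> S\<close>. The tensor
  products for \<open>S\<close> and for its symmetric difference with \<open>{y}\<close> are at distance exactly \<open>d(k(y), 1)\<close>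
  from each other, so one of them is at least half as far from \<open>1\<close> (\<open>tensor_amplify\<close>).

  The locale \<open>wreath_closed\<close> collects what a class of groups needs for this argument, and
  \<open>approximable_wreath_product\<close> is the result. Its instances are the symmetric groups (product
  action on \<open>A \<times> B\<close> and imprimitive action on copies of \<open>A\<close>), the unitary and the general linear
  groups (Kronecker products and block monomial matrices), and the finite groups with bi-invariant
  metrics (direct products with the maximum metric, and the permutational wreath product itself with a
  metric that averages over the points). For the symmetric groups this yields a lower bound on lengths
  by some positive constant, and diagonal powers raise it above \<open>1 - \<epsilon>\<close>
  (\<open>sofic_iff_approximable\<close>).
\<close>

section \<open>Permutational wreath products\<close>

text \<open>
  The pair \<open>(k, p)\<close> acts like a monomial matrix: it takes block \<open>b\<close> to block \<open>p b\<close> by way of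
  \<open>k b\<close>. Base coordinates are thus indexed by the source of the permutation, which is why a product
  evaluates the first factor at \<open>p' b\<close>.
\<close>

definition perm_wreath ::
  "('k, 'z) monoid_scheme \<Rightarrow> 'i set \<Rightarrow> (('i \<Rightarrow> 'k) \<times> ('i \<Rightarrow> 'i)) monoid" where
  "perm_wreath K B =
     \<lparr>carrier = (B \<rightarrow>\<^sub>E carrier K) \<times> Bij B,
      monoid.mult = (\<lambda>(k, p) (k', p'). (\<lambda>b\<in>B. k (p' b) \<otimes>\<^bsub>K\<^esub> k' b, compose B p p')),
      one = (\<lambda>b\<in>B. \<one>\<^bsub>K\<^esub>, \<lambda>b\<in>B. b)\<rparr>"

lemma carrier_perm_wreath: "carrier (perm_wreath K B) = (B \<rightarrow>\<^sub>E carrier K) \<times> Bij B"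
  by (simp add: perm_wreath_def)

lemma mult_perm_wreath:
  "(k, p) \<otimes>\<^bsub>perm_wreath K B\<^esub> (k', p') = (\<lambda>b\<in>B. k (p' b) \<otimes>\<^bsub>K\<^esub> k' b, compose B p p')"
  by (simp add: perm_wreath_def)

lemma one_perm_wreath: "\<one>\<^bsub>perm_wreath K B\<^esub> = (\<lambda>b\<in>B. \<one>\<^bsub>K\<^esub>, \<lambda>b\<in>B. b)"
  by (simp add: perm_wreath_def)

lemma Bij_in: "p \<in> Bij B \<Longrightarrow> b \<in> B \<Longrightarrow> p b \<in> B"
  using Bij_imp_funcset by fastforce

lemma Bij_inj: "p \<in> Bij A \<Longrightarrow> x \<in> A \<Longrightarrow> y \<in> A \<Longrightarrow> p x = p y \<Longrightarrow> x = y"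
  by (auto simp: Bij_def bij_betw_def dest: inj_onD)

lemma Bij_ext: "p \<in> Bij B \<Longrightarrow> q \<in> Bij B \<Longrightarrow> (\<And>b. b \<in> B \<Longrightarrow> p b = q b) \<Longrightarrow> p = q"
  by (meson Bij_imp_extensional extensionalityI)

lemma group_perm_wreath:
  assumes "group K"
  shows "group (perm_wreath K B)"
proof -
  interpret K: group K by fact
  show ?thesis
  proof (rule groupI, goal_cases)
    case (1 x y)
    then show ?case
      by (auto simp: perm_wreath_def compose_Bij PiE_iff Bij_in)
  next
    case 2
    then show ?case by (auto simp: perm_wreath_def id_Bij)
  next
    case (3 x y z)
    obtain k p k' p' k'' p'' where xyz: "x = (k, p)" "y = (k', p')" "z = (k'', p'')"
      by (metis surj_pair)
    with 3 have c: "k \<in> B \<rightarrow>\<^sub>E carrier K" "k' \<in> B \<rightarrow>\<^sub>E carrier K" "k'' \<in> B \<rightarrow>\<^sub>E carrier K"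
      "p \<in> Bij B" "p' \<in> Bij B" "p'' \<in> Bij B"
      by (auto simp: carrier_perm_wreath)
    have "(\<lambda>b\<in>B. (\<lambda>b\<in>B. k (p' b) \<otimes>\<^bsub>K\<^esub> k' b) (p'' b) \<otimes>\<^bsub>K\<^esub> k'' b)
        = (\<lambda>b\<in>B. k (compose B p' p'' b) \<otimes>\<^bsub>K\<^esub> (\<lambda>b\<in>B. k' (p'' b) \<otimes>\<^bsub>K\<^esub> k'' b) b)"
      using c by (intro restrict_ext) (auto simp: Bij_in compose_def K.m_assoc PiE_iff)
    moreover have "compose B (compose B p p') p'' = compose B p (compose B p' p'')"
      using c by (intro compose_assoc[symmetric] Bij_imp_funcset)
    ultimately show ?case by (simp add: xyz mult_perm_wreath)
  next
    case (4 x)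
    then obtain k p where x: "x = (k, p)" "k \<in> B \<rightarrow>\<^sub>E carrier K" "p \<in> Bij B"
      by (auto simp: carrier_perm_wreath)
    have "(\<lambda>b\<in>B. (\<lambda>b\<in>B. \<one>\<^bsub>K\<^esub>) (p b) \<otimes>\<^bsub>K\<^esub> k b) = k"
      using x by (intro extensionalityI[of _ B]) (auto simp: Bij_in PiE_iff)
    moreover have "compose B (\<lambda>b\<in>B. b) p = p"
      using x by (intro Bij_ext[of _ B] compose_Bij id_Bij) (auto simp: compose_eq Bij_in)
    ultimately show ?case by (simp add: x mult_perm_wreath one_perm_wreath)
  next
    case (5 x)
    then obtain k p where x: "x = (k, p)" "k \<in> B \<rightarrow>\<^sub>E carrier K" "p \<in> Bij B"
      by (auto simp: carrier_perm_wreath)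
    define q where "q = (\<lambda>b\<in>B. inv_into B p b)"
    have q: "q \<in> Bij B" using x restrict_inv_into_Bij q_def by auto
    have qp: "compose B q p = (\<lambda>b\<in>B. b)" unfolding q_def using x Bij_compose_restrict_eq by blast
    then have qp': "q (p b) = b" if "b \<in> B" for b
      by (metis compose_eq restrict_apply' that)
    show ?case
    proof (rule bexI[of _ "(\<lambda>b\<in>B. inv\<^bsub>K\<^esub> (k (q b)), q)"])
      show "(\<lambda>b\<in>B. inv\<^bsub>K\<^esub> (k (q b)), q) \<otimes>\<^bsub>perm_wreath K B\<^esub> x = \<one>\<^bsub>perm_wreath K B\<^esub>"
        using x q by (auto simp: mult_perm_wreath one_perm_wreath qp qp' Bij_in PiE_iff intro!: restrict_ext)
      show "(\<lambda>b\<in>B. inv\<^bsub>K\<^esub> (k (q b)), q) \<in> carrier (perm_wreath K B)"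
        using x q by (auto simp: carrier_perm_wreath Bij_in PiE_iff)
    qed
  qed
qed

section \<open>Wreath-closed classes\<close>

definition pseudometric_on :: "'k set \<Rightarrow> ('k \<Rightarrow> 'k \<Rightarrow> real) \<Rightarrow> bool" where
  "pseudometric_on X d \<longleftrightarrow> (\<forall>x\<in>X. d x x = 0) \<and> (\<forall>x\<in>X. \<forall>y\<in>X. d x y = d y x) \<and>
     (\<forall>x\<in>X. \<forall>y\<in>X. \<forall>z\<in>X. d x z \<le> d x y + d y z)"

text \<open>
  The model is the Kronecker product of matrices, for a metric that is normalised by the size of the
  matrices.
\<close>

definition tensor_hom ::
  "('k monoid \<times> ('k \<Rightarrow> 'k \<Rightarrow> real)) \<Rightarrow> ('k monoid \<times> ('k \<Rightarrow> 'k \<Rightarrow> real)) \<Rightarrow>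
   ('k monoid \<times> ('k \<Rightarrow> 'k \<Rightarrow> real)) \<Rightarrow> ('k \<times> 'k \<Rightarrow> 'k) \<Rightarrow> bool" where
  "tensor_hom = (\<lambda>(K1, d1) (K2, d2) (L, d) T. T \<in> hom (K1 \<times>\<times> K2) L \<and>
     (\<forall>a\<in>carrier K1. \<forall>a'\<in>carrier K1. \<forall>b\<in>carrier K2. d (T (a, b)) (T (a', b)) = d1 a a') \<and>
     (\<forall>a\<in>carrier K1. \<forall>b\<in>carrier K2. \<forall>b'\<in>carrier K2. d (T (a, b)) (T (a, b')) = d2 b b'))"

text \<open>
  The model is the inclusion of block monomial matrices into all matrices. Of the three estimates, the
  first says that errors in few blocks, or small errors in all blocks, cost little; the square root
  is forced by the Hilbert-Schmidt metric, whose square is an average over the blocks. The other two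
  say that a permutation which moves many blocks is far from the identity, and so is a block diagonal
  matrix with many blocks far from the identity; the factor \<open>3\<close> in the second estimate comes from
  the rank metric.
\<close>

definition monomial_hom ::
  "nat \<Rightarrow> ('k monoid \<times> ('k \<Rightarrow> 'k \<Rightarrow> real)) \<Rightarrow> ('k monoid \<times> ('k \<Rightarrow> 'k \<Rightarrow> real)) \<Rightarrow>
   ((nat \<Rightarrow> 'k) \<times> (nat \<Rightarrow> nat) \<Rightarrow> 'k) \<Rightarrow> bool" where
  "monomial_hom m = (\<lambda>(K, d) (M, D) \<Psi>. \<Psi> \<in> hom (perm_wreath K {..<m}) M \<and>
     (\<forall>\<delta> k p k' p'. 0 \<le> \<delta> \<and> \<delta> \<le> 1 \<and>
        (k, p) \<in> carrier (perm_wreath K {..<m}) \<and> (k', p') \<in> carrier (perm_wreath K {..<m}) \<and>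
        real (card {b\<in>{..<m}. p b \<noteq> p' b \<or> \<delta> < d (k b) (k' b)}) \<le> \<delta> * real m \<longrightarrow>
        D (\<Psi> (k, p)) (\<Psi> (k', p')) \<le> 3 * sqrt \<delta>) \<and>
     (\<forall>k p. (k, p) \<in> carrier (perm_wreath K {..<m}) \<longrightarrow>
        real (card {b\<in>{..<m}. p b \<noteq> b}) / (3 * real m) \<le> D (\<Psi> (k, p)) \<one>\<^bsub>M\<^esub>) \<and>
     (\<forall>k t. k \<in> {..<m} \<rightarrow>\<^sub>E carrier K \<and> 0 \<le> t \<and> t \<le> 1 \<longrightarrow>
        t * (real (card {b\<in>{..<m}. t \<le> d (k b) \<one>\<^bsub>K\<^esub>}) / real m)
          \<le> D (\<Psi> (k, \<lambda>b\<in>{..<m}. b)) \<one>\<^bsub>M\<^esub>))"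

locale wreath_closed =
  fixes \<C> :: "('k monoid \<times> ('k \<Rightarrow> 'k \<Rightarrow> real)) set"
  assumes group: "(K, d) \<in> \<C> \<Longrightarrow> group K"
    and pseudometric: "(K, d) \<in> \<C> \<Longrightarrow> pseudometric_on (carrier K) d"
    and tensor: "(K1, d1) \<in> \<C> \<Longrightarrow> (K2, d2) \<in> \<C> \<Longrightarrow>
      \<exists>L d T. (L, d) \<in> \<C> \<and> tensor_hom (K1, d1) (K2, d2) (L, d) T"
    and monomial: "(K, d) \<in> \<C> \<Longrightarrow> 0 < m \<Longrightarrow>
      \<exists>M D \<Psi>. (M, D) \<in> \<C> \<and> monomial_hom m (K, d) (M, D) \<Psi>"
begin

lemma dist_refl: "(K, d) \<in> \<C> \<Longrightarrow> x \<in> carrier K \<Longrightarrow> d x x = 0"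
  using pseudometric unfolding pseudometric_on_def by blast

lemma dist_sym: "(K, d) \<in> \<C> \<Longrightarrow> x \<in> carrier K \<Longrightarrow> y \<in> carrier K \<Longrightarrow> d x y = d y x"
  using pseudometric unfolding pseudometric_on_def by blast

lemma dist_triangle: "(K, d) \<in> \<C> \<Longrightarrow> x \<in> carrier K \<Longrightarrow> y \<in> carrier K \<Longrightarrow> z \<in> carrier K
    \<Longrightarrow> d x z \<le> d x y + d y z"
  using pseudometric unfolding pseudometric_on_def by blast

lemma dist_nonneg: "(K, d) \<in> \<C> \<Longrightarrow> x \<in> carrier K \<Longrightarrow> y \<in> carrier K \<Longrightarrow> 0 \<le> d x y"
  using dist_triangle[of K d x y x] dist_sym[of K d x y] dist_refl[of K d x] by simp

text \<open>
  Iterating the tensor product over the coordinates keeps the isometry in each variable, which is the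
  only information on distances that the construction carries along.
\<close>

lemma tensor_power:
  fixes A :: "nat set"
  assumes K: "(K, d) \<in> \<C>" and A: "finite A" "A \<noteq> {}"
  shows "\<exists>L D T. (L, D) \<in> \<C> \<and> T \<in> hom (product_group A (\<lambda>_. K)) L \<and>
    (\<forall>k\<in>A \<rightarrow>\<^sub>E carrier K. \<forall>k'\<in>A \<rightarrow>\<^sub>E carrier K. \<forall>y\<in>A. (\<forall>x\<in>A - {y}. k x = k' x) \<longrightarrow>
       D (T k) (T k') = d (k y) (k' y))"
  using A
proof (induction A rule: finite_ne_induct)
  case (singleton a)
  have "(\<lambda>k. k a) \<in> hom (product_group {a} (\<lambda>_. K)) K"
    by (auto simp: hom_def PiE_iff)
  then have "(K, d) \<in> \<C> \<and> (\<lambda>k. k a) \<in> hom (product_group {a} (\<lambda>_. K)) K \<and>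
      (\<forall>k\<in>{a} \<rightarrow>\<^sub>E carrier K. \<forall>k'\<in>{a} \<rightarrow>\<^sub>E carrier K. \<forall>y\<in>{a}.
         (\<forall>x\<in>{a} - {y}. k x = k' x) \<longrightarrow> d (k a) (k' a) = d (k y) (k' y))"
    using K by simp
  then show ?case
    by (rule_tac exI[of _ K], rule_tac exI[of _ d], rule_tac exI[of _ "\<lambda>k. k a"])
next
  case (insert a A)
  then obtain L D T where L: "(L, D) \<in> \<C>" and T: "T \<in> hom (product_group A (\<lambda>_. K)) L"
    and iso: "\<forall>k\<in>A \<rightarrow>\<^sub>E carrier K. \<forall>k'\<in>A \<rightarrow>\<^sub>E carrier K. \<forall>y\<in>A. (\<forall>x\<in>A - {y}. k x = k' x) \<longrightarrow>
       D (T k) (T k') = d (k y) (k' y)"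
    by (elim exE conjE)
  obtain L' D' T' where L': "(L', D') \<in> \<C>" and T': "T' \<in> hom (K \<times>\<times> L) L'"
    and iso1: "\<forall>u\<in>carrier K. \<forall>u'\<in>carrier K. \<forall>b\<in>carrier L. D' (T' (u, b)) (T' (u', b)) = d u u'"
    and iso2: "\<forall>u\<in>carrier K. \<forall>b\<in>carrier L. \<forall>b'\<in>carrier L. D' (T' (u, b)) (T' (u, b')) = D b b'"
    using tensor[OF K L] unfolding tensor_hom_def prod.case by (elim exE conjE)
  define U where "U k = T' (k a, T (restrict k A))" for k
  have r: "restrict k A \<in> A \<rightarrow>\<^sub>E carrier K" "k a \<in> carrier K"
    if "k \<in> insert a A \<rightarrow>\<^sub>E carrier K" for k
    using that by auto
  have Tc: "T k \<in> carrier L" if "k \<in> A \<rightarrow>\<^sub>E carrier K" for k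
    using T that by (auto simp: hom_def)
  have "U \<in> hom (product_group (insert a A) (\<lambda>_. K)) L'"
  proof (rule homI)
    fix k assume k: "k \<in> carrier (product_group (insert a A) (\<lambda>_. K))"
    then have "(k a, T (restrict k A)) \<in> carrier (K \<times>\<times> L)"
      using r[of k] Tc by auto
    then show "U k \<in> carrier L'" unfolding U_def using T' by (auto simp: hom_def)
  next
    fix k k' assume "k \<in> carrier (product_group (insert a A) (\<lambda>_. K))"
      "k' \<in> carrier (product_group (insert a A) (\<lambda>_. K))"
    then have k: "k \<in> insert a A \<rightarrow>\<^sub>E carrier K" "k' \<in> insert a A \<rightarrow>\<^sub>E carrier K" by auto
    note r1 = r[OF k(1)] and r2 = r[OF k(2)]
    have e0: "restrict (k \<otimes>\<^bsub>product_group (insert a A) (\<lambda>_. K)\<^esub> k') A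
        = restrict k A \<otimes>\<^bsub>product_group A (\<lambda>_. K)\<^esub> restrict k' A"
      by auto
    have e: "T (restrict (k \<otimes>\<^bsub>product_group (insert a A) (\<lambda>_. K)\<^esub> k') A)
        = T (restrict k A) \<otimes>\<^bsub>L\<^esub> T (restrict k' A)"
      unfolding e0 by (rule hom_mult[OF T]) (use r1 r2 in simp_all)
    have "U (k \<otimes>\<^bsub>product_group (insert a A) (\<lambda>_. K)\<^esub> k')
      = T' ((k a, T (restrict k A)) \<otimes>\<^bsub>K \<times>\<times> L\<^esub> (k' a, T (restrict k' A)))"
      unfolding U_def e by simp
    also have "\<dots> = U k \<otimes>\<^bsub>L'\<^esub> U k'"
      unfolding U_def by (rule hom_mult[OF T']) (use r1 r2 Tc[OF r1(1)] Tc[OF r2(1)] in simp_all)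
    finally show "U (k \<otimes>\<^bsub>product_group (insert a A) (\<lambda>_. K)\<^esub> k') = U k \<otimes>\<^bsub>L'\<^esub> U k'" .
  qed
  moreover have "D' (U k) (U k') = d (k y) (k' y)"
    if k: "k \<in> insert a A \<rightarrow>\<^sub>E carrier K" "k' \<in> insert a A \<rightarrow>\<^sub>E carrier K"
      and y: "y \<in> insert a A" and eq: "\<forall>x\<in>insert a A - {y}. k x = k' x" for k k' y
  proof (cases "y = a")
    case True
    then have "restrict k A = restrict k' A"
      using eq \<open>a \<notin> A\<close> by (intro restrict_ext) auto
    then show ?thesis unfolding U_def using iso1 r k Tc True by simp
  next
    case False
    then have "k a = k' a" using eq by auto
    moreover have "D (T (restrict k A)) (T (restrict k' A)) = d (restrict k A y) (restrict k' A y)"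
      by (rule iso[rule_format]) (use r k y eq False in auto)
    ultimately show ?thesis unfolding U_def using iso2 r k Tc False y by auto
  qed
  ultimately show ?case using L' by blast
qed

text \<open>
  Exchange the coordinates of \<open>k\<close> for those of \<open>k'\<close> one at a time, and use the triangle inequality.
\<close>

lemma tensor_power_dist_le_sum:
  assumes K: "(K, d) \<in> \<C>" and L: "(L, D) \<in> \<C>" and A: "finite A"
    and T: "T \<in> hom (product_group A (\<lambda>_. K)) L"
    and iso: "\<And>k k' y. k \<in> A \<rightarrow>\<^sub>E carrier K \<Longrightarrow> k' \<in> A \<rightarrow>\<^sub>E carrier K \<Longrightarrow> y \<in> A \<Longrightarrow>
       (\<forall>x\<in>A - {y}. k x = k' x) \<Longrightarrow> D (T k) (T k') = d (k y) (k' y)"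
    and k: "k \<in> A \<rightarrow>\<^sub>E carrier K" "k' \<in> A \<rightarrow>\<^sub>E carrier K"
  shows "D (T k) (T k') \<le> (\<Sum>y\<in>A. d (k y) (k' y))"
proof -
  have Tc: "T k \<in> carrier L" if "k \<in> A \<rightarrow>\<^sub>E carrier K" for k
    using T that by (auto simp: hom_def)
  define mix where "mix S = (\<lambda>y\<in>A. if y \<in> S then k' y else k y)" for S
  have mix: "mix S \<in> A \<rightarrow>\<^sub>E carrier K" for S using k by (auto simp: mix_def)
  have "D (T k) (T (mix S)) \<le> (\<Sum>y\<in>S. d (k y) (k' y))" if "finite S" "S \<subseteq> A" for S
    using that
  proof (induction S)
    case empty
    have "mix {} = k" using k by (auto simp: mix_def PiE_iff extensional_def)
    then show ?case using dist_refl[OF L Tc[OF k(1)]] by simp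
  next
    case (insert y S)
    have "D (T (mix S)) (T (mix (insert y S))) = d (mix S y) (mix (insert y S) y)"
      using insert by (intro iso mix) (auto simp: mix_def)
    also have "\<dots> = d (k y) (k' y)" using insert by (auto simp: mix_def)
    finally show ?case
      using insert dist_triangle[OF L Tc[OF k(1)] Tc[OF mix[of S]] Tc[OF mix[of "insert y S"]]] by auto
  qed
  moreover have "mix A = k'" using k by (auto simp: mix_def PiE_iff extensional_def)
  ultimately show ?thesis using A by (metis order_refl)
qed


text \<open>
  A tensor product can be trivial although its factors are not. The direct sum over all subsets of
  \<open>A\<close>, realised as a block diagonal matrix, repairs this: pair each subset \<open>S\<close> with its symmetric
  difference with \<open>{y}\<close>. The two tensor products differ in the coordinate \<open>y\<close> only, so they are at
  distance \<open>d (k y) 1\<close>, and one of the two is at distance at least half of that from \<open>1\<close>. At least half of the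
  blocks therefore see \<open>k y\<close>, whatever the size of \<open>A\<close>.
\<close>

lemma tensor_amplify:
  fixes A :: "nat set"
  assumes K: "(K, d) \<in> \<C>" and A: "finite A" "A \<noteq> {}"
  shows "\<exists>L D T. (L, D) \<in> \<C> \<and> T \<in> hom (product_group A (\<lambda>_. K)) L \<and>
    (\<forall>k\<in>A \<rightarrow>\<^sub>E carrier K. \<forall>k'\<in>A \<rightarrow>\<^sub>E carrier K. \<forall>\<delta>. 0 \<le> \<delta> \<and> \<delta> \<le> 1 \<and> (\<Sum>y\<in>A. d (k y) (k' y)) \<le> \<delta>
       \<longrightarrow> D (T k) (T k') \<le> 3 * sqrt \<delta>) \<and>
    (\<forall>k\<in>A \<rightarrow>\<^sub>E carrier K. \<forall>y\<in>A. \<forall>t. 0 \<le> t \<and> t \<le> 1 \<and> t \<le> d (k y) \<one>\<^bsub>K\<^esub> \<longrightarrow> t / 4 \<le> D (T k) \<one>\<^bsub>L\<^esub>)"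
proof -
  obtain L D T where L: "(L, D) \<in> \<C>" and T: "T \<in> hom (product_group A (\<lambda>_. K)) L"
    and iso: "\<forall>k\<in>A \<rightarrow>\<^sub>E carrier K. \<forall>k'\<in>A \<rightarrow>\<^sub>E carrier K. \<forall>y\<in>A. (\<forall>x\<in>A - {y}. k x = k' x) \<longrightarrow>
       D (T k) (T k') = d (k y) (k' y)"
    using tensor_power[OF assms] by (elim exE conjE)
  interpret K: group K using K by (rule group)
  interpret L: group L using L by (rule group)
  have Tc: "T k \<in> carrier L" if "k \<in> A \<rightarrow>\<^sub>E carrier K" for k
    using T that by (auto simp: hom_def)
  define m :: nat where "m = card (Pow A)"
  have "m > 0" unfolding m_def using A by (auto simp: card_gt_0_iff)
  obtain e where e: "bij_betw e {..<m} (Pow A)"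
    using ex_bij_betw_nat_finite[of "Pow A"] A unfolding m_def atLeast0LessThan by auto
  obtain M E \<Psi> where M: "(M, E) \<in> \<C>" and mon: "monomial_hom m (L, D) (M, E) \<Psi>"
    using monomial[OF L \<open>m > 0\<close>] by blast
  interpret M: group M using M by (rule group)
  have \<Psi>: "\<Psi> \<in> hom (perm_wreath L {..<m}) M"
    and up: "\<And>\<delta> k p k' p'. 0 \<le> \<delta> \<Longrightarrow> \<delta> \<le> 1 \<Longrightarrow>
        (k, p) \<in> carrier (perm_wreath L {..<m}) \<Longrightarrow> (k', p') \<in> carrier (perm_wreath L {..<m}) \<Longrightarrow>
        real (card {b\<in>{..<m}. p b \<noteq> p' b \<or> \<delta> < D (k b) (k' b)}) \<le> \<delta> * real m \<Longrightarrow>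
        E (\<Psi> (k, p)) (\<Psi> (k', p')) \<le> 3 * sqrt \<delta>"
    and low: "\<And>k t. k \<in> {..<m} \<rightarrow>\<^sub>E carrier L \<Longrightarrow> 0 \<le> t \<Longrightarrow> t \<le> 1 \<Longrightarrow>
        t * (real (card {b\<in>{..<m}. t \<le> D (k b) \<one>\<^bsub>L\<^esub>}) / real m)
          \<le> E (\<Psi> (k, \<lambda>b\<in>{..<m}. b)) \<one>\<^bsub>M\<^esub>"
    using mon unfolding monomial_hom_def prod.case by (elim conjE, blast)+
  define cut where "cut k i = (\<lambda>y\<in>A. if y \<in> e i then k y else \<one>\<^bsub>K\<^esub>)" for k :: "nat \<Rightarrow> 'k" and i
  have cut: "cut k i \<in> A \<rightarrow>\<^sub>E carrier K" if "k \<in> A \<rightarrow>\<^sub>E carrier K" for k i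
    using that by (auto simp: cut_def)
  define W where "W k = (\<lambda>i\<in>{..<m}. T (cut k i), \<lambda>i\<in>{..<m}. i)" for k
  have W: "W k \<in> carrier (perm_wreath L {..<m})" if "k \<in> A \<rightarrow>\<^sub>E carrier K" for k
    using that Tc cut by (auto simp: W_def carrier_perm_wreath id_Bij)
  have hom: "\<Psi> \<circ> W \<in> hom (product_group A (\<lambda>_. K)) M"
  proof (rule homI)
    fix k assume "k \<in> carrier (product_group A (\<lambda>_. K))"
    then show "(\<Psi> \<circ> W) k \<in> carrier M" using W \<Psi> by (auto simp: hom_def)
  next
    fix k k' assume "k \<in> carrier (product_group A (\<lambda>_. K))" "k' \<in> carrier (product_group A (\<lambda>_. K))"
    then have k: "k \<in> A \<rightarrow>\<^sub>E carrier K" "k' \<in> A \<rightarrow>\<^sub>E carrier K" by auto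
    have "T (cut (k \<otimes>\<^bsub>product_group A (\<lambda>_. K)\<^esub> k') i) = T (cut k i) \<otimes>\<^bsub>L\<^esub> T (cut k' i)" for i
    proof -
      have "cut (k \<otimes>\<^bsub>product_group A (\<lambda>_. K)\<^esub> k') i = cut k i \<otimes>\<^bsub>product_group A (\<lambda>_. K)\<^esub> cut k' i"
        using k by (auto simp: cut_def)
      then show ?thesis
        using hom_mult[OF T, unfolded carrier_product_group, OF cut[OF k(1), of i] cut[OF k(2), of i]]
        by (simp only:)
    qed
    then have "W (k \<otimes>\<^bsub>product_group A (\<lambda>_. K)\<^esub> k') = W k \<otimes>\<^bsub>perm_wreath L {..<m}\<^esub> W k'"
      unfolding W_def mult_perm_wreath by (auto simp: compose_def intro!: restrict_ext)
    then show "(\<Psi> \<circ> W) (k \<otimes>\<^bsub>product_group A (\<lambda>_. K)\<^esub> k') = (\<Psi> \<circ> W) k \<otimes>\<^bsub>M\<^esub> (\<Psi> \<circ> W) k'"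
      using hom_mult[OF \<Psi> W[OF k(1)] W[OF k(2)]] by (simp only: o_apply)
  qed
  have upper: "E ((\<Psi> \<circ> W) k) ((\<Psi> \<circ> W) k') \<le> 3 * sqrt \<delta>"
    if k: "k \<in> A \<rightarrow>\<^sub>E carrier K" "k' \<in> A \<rightarrow>\<^sub>E carrier K"
      and \<delta>: "0 \<le> \<delta>" "\<delta> \<le> 1" "(\<Sum>y\<in>A. d (k y) (k' y)) \<le> \<delta>" for k k' \<delta>
  proof -
    have "D (T (cut k i)) (T (cut k' i)) \<le> \<delta>" for i
    proof -
      have kc: "k y \<in> carrier K" "k' y \<in> carrier K" if "y \<in> A" for y
        using k that by auto
      have "D (T (cut k i)) (T (cut k' i)) \<le> (\<Sum>y\<in>A. d (cut k i y) (cut k' i y))"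
        by (rule tensor_power_dist_le_sum[OF K L A(1) T iso[rule_format] cut cut]) (use k in auto)
      also have "\<dots> \<le> (\<Sum>y\<in>A. d (k y) (k' y))"
        using dist_refl[OF K K.one_closed] dist_nonneg[OF K kc]
        by (intro sum_mono) (auto simp: cut_def)
      finally show ?thesis using \<delta> by simp
    qed
    then have z: "{b \<in> {..<m}. (\<lambda>i\<in>{..<m}. i) b \<noteq> (\<lambda>i\<in>{..<m}. i) b \<or>
        \<delta> < D ((\<lambda>i\<in>{..<m}. T (cut k i)) b) ((\<lambda>i\<in>{..<m}. T (cut k' i)) b)} = {}"
      by (auto simp: not_less)
    show ?thesis
      unfolding o_apply W_def
      by (rule up[OF \<delta>(1,2) W[OF k(1), unfolded W_def] W[OF k(2), unfolded W_def]])
        (unfold z, use \<delta> in simp)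
  qed
  have lower: "t / 4 \<le> E ((\<Psi> \<circ> W) k) \<one>\<^bsub>M\<^esub>"
    if k: "k \<in> A \<rightarrow>\<^sub>E carrier K" and y: "y \<in> A" and t: "0 \<le> t" "t \<le> 1" "t \<le> d (k y) \<one>\<^bsub>K\<^esub>" for k y t
  proof -
    define good where "good = {i\<in>{..<m}. t / 2 \<le> D (T (cut k i)) \<one>\<^bsub>L\<^esub>}"
    \<comment> \<open>On the indices of the blocks, \<open>j\<close> is the involution that changes a subset in \<open>y\<close>.\<close>
    define flip where "flip S = (if y \<in> S then S - {y} else insert y S)" for S
    have flip_flip: "flip (flip S) = S" for S unfolding flip_def by auto
    define j where "j i = inv_into {..<m} e (flip (e i))" for i
    have ei: "e i \<in> Pow A" "flip (e i) \<in> Pow A" if "i < m" for i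
    proof -
      show "e i \<in> Pow A" using that e by (auto dest: bij_betwE)
      then show "flip (e i) \<in> Pow A" using y by (auto simp: flip_def)
    qed
    have ej: "e (j i) = flip (e i)" "j i < m" if "i < m" for i
      using ei[OF that] e bij_betw_inv_into_right[OF e, of "flip (e i)"] bij_betw_imp_surj_on[OF e]
        inv_into_into[of "flip (e i)" e "{..<m}"]
      unfolding j_def by auto
    have jj: "j (j i) = i" if "i < m" for i
      using ej[OF that] ej(1)[OF ej(2)[OF that]] flip_flip e that
      by (metis bij_betw_inv_into_left j_def lessThan_iff)
    have "i \<in> good \<or> j i \<in> good" if i: "i < m" for i
    proof -
      have "D (T (cut k i)) (T (cut k (j i))) = d (cut k i y) (cut k (j i) y)"
        using iso[rule_format, OF cut[OF k] cut[OF k] y, of i "j i"] ej[OF i]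
        by (auto simp: cut_def flip_def)
      also have "\<dots> = d (k y) \<one>\<^bsub>K\<^esub>"
        using ej[OF i] y dist_sym[OF K PiE_mem[OF k y] K.one_closed] by (auto simp: cut_def flip_def)
      finally have "t \<le> D (T (cut k i)) (T (cut k (j i)))" using t by simp
      also have "\<dots> \<le> D (T (cut k i)) \<one>\<^bsub>L\<^esub> + D (T (cut k (j i))) \<one>\<^bsub>L\<^esub>"
        using dist_triangle[OF L Tc[OF cut[OF k, of i]] L.one_closed Tc[OF cut[OF k, of "j i"]]]
          dist_sym[OF L L.one_closed Tc[OF cut[OF k, of "j i"]]] by simp
      finally show ?thesis using ej i unfolding good_def by auto
    qed
    then have "{..<m} \<subseteq> good \<union> j ` good" using jj by (force simp: image_iff)
    moreover have fg: "finite good" by (simp add: good_def)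
    ultimately have "m \<le> card (good \<union> j ` good)"
      by (metis card_lessThan card_mono finite_UnI finite_imageI)
    also have "\<dots> \<le> card good + card good"
      using card_Un_le[of good "j ` good"] card_image_le[OF fg, of j] by linarith
    finally have half: "1/2 \<le> real (card good) / real m"
      using \<open>m > 0\<close> by (simp add: field_simps)
    have "good = {b \<in> {..<m}. t / 2 \<le> D ((\<lambda>i\<in>{..<m}. T (cut k i)) b) \<one>\<^bsub>L\<^esub>}"
      unfolding good_def by auto
    then have "t/2 * (real (card good) / real m) \<le> E (\<Psi> (W k)) \<one>\<^bsub>M\<^esub>"
      using low[of "\<lambda>i\<in>{..<m}. T (cut k i)" "t/2"] t W[OF k]
      unfolding W_def carrier_perm_wreath by simp
    moreover have "t/2 * (1/2) \<le> t/2 * (real (card good) / real m)"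
      using half t by (intro mult_left_mono) auto
    ultimately show ?thesis by simp
  qed
  show ?thesis
    by (rule exI[of _ M], rule exI[of _ E], rule exI[of _ "\<Psi> \<circ> W"])
      (use M hom upper lower in blast)
qed

end

section \<open>Sofic models\<close>

lemma BijGroup_mult_apply:
  "p \<in> Bij A \<Longrightarrow> q \<in> Bij A \<Longrightarrow> a \<in> A \<Longrightarrow> (p \<otimes>\<^bsub>BijGroup A\<^esub> q) a = p (q a)"
  by (simp add: BijGroup_def compose_eq)

text \<open>
  Estimates in the Hamming distance become statements about most points: at a point of \<open>X\<close>, the model
  is multiplicative and free as far as the finite set \<open>D\<close> can tell. Each of the finitely many
  conditions fails on a small proportion of the points, so a union bound suffices. The model is also
  moved to an initial segment of the natural numbers, which will number the blocks of matrices.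
\<close>

lemma sofic_model:
  assumes H: "sofic H" and D: "D \<subseteq> carrier H" "finite D" and \<eta>: "0 < \<eta>"
  shows "\<exists>m \<sigma> X. 0 < m \<and> (\<forall>h\<in>carrier H. \<sigma> h \<in> Bij {..<m}) \<and>
    \<sigma> \<one>\<^bsub>H\<^esub> = (\<lambda>x\<in>{..<m}. x) \<and> X \<subseteq> {..<m} \<and> real (card ({..<m} - X)) \<le> \<eta> * real m \<and>
    (\<forall>x\<in>X. (\<forall>g\<in>D. \<forall>h\<in>D. \<sigma> (g \<otimes>\<^bsub>H\<^esub> h) x = \<sigma> g (\<sigma> h x)) \<and>
            (\<forall>g\<in>D - {\<one>\<^bsub>H\<^esub>}. \<sigma> g x \<noteq> x))"
proof -
  interpret H: group H using H by (simp add: sofic_def)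
  \<comment> \<open>The number of conditions in the union bound.\<close>
  define N where "N = card (D \<times> D) + card D + 1"
  define \<epsilon> where "\<epsilon> = \<eta> / real N"
  have "N > 0" "\<epsilon> > 0" using \<eta> by (auto simp: N_def \<epsilon>_def)
  obtain A :: "nat set" and \<sigma> where A: "finite A" "A \<noteq> {}"
    and \<sigma>: "\<sigma> \<in> carrier H \<rightarrow> carrier (BijGroup A)"
    and mult: "multiplicative_map H (BijGroup A) D \<epsilon> (hamming_dist A) \<sigma>"
    and len: "\<forall>g\<in>D - {\<one>\<^bsub>H\<^esub>}. hamming_length A (\<sigma> g) > 1 - \<epsilon>"
    using H D \<open>\<epsilon> > 0\<close> unfolding sofic_def by meson
  define m where "m = card A"
  have m: "m > 0" using A by (simp add: m_def card_gt_0_iff)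
  obtain e where e: "bij_betw e {..<m} A"
    using ex_bij_betw_nat_finite[OF A(1)] unfolding m_def atLeast0LessThan by auto
  define i where "i = inv_into {..<m} e"
  have i: "bij_betw i A {..<m}" unfolding i_def using e by (rule bij_betw_inv_into)
  have ei: "e (i a) = a" "i a < m" if "a \<in> A" for a
    using that e i unfolding i_def by (auto simp: bij_betw_inv_into_right dest: bij_betwE)
  have ie: "i (e x) = x" "e x \<in> A" if "x < m" for x
    using that e unfolding i_def by (auto simp: bij_betw_inv_into_left dest: bij_betwE)
  have \<sigma>B: "\<sigma> h \<in> Bij A" if "h \<in> carrier H" for h
    using \<sigma> that by (auto simp: BijGroup_def)
  define \<tau> where "\<tau> h = (\<lambda>x\<in>{..<m}. i (\<sigma> h (e x)))" for h
  have \<tau>B: "\<tau> h \<in> Bij {..<m}" if h: "h \<in> carrier H" for h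
  proof -
    have "bij_betw (i \<circ> (\<sigma> h \<circ> e)) {..<m} {..<m}"
      using \<sigma>B[OF h] e i unfolding Bij_def by (intro bij_betw_trans) auto
    then have "bij_betw (\<tau> h) {..<m} {..<m}"
      by (rule bij_betw_cong[THEN iffD1, rotated]) (simp add: \<tau>_def)
    then show ?thesis by (auto simp: Bij_def \<tau>_def)
  qed
  have \<tau>1: "\<tau> \<one>\<^bsub>H\<^esub> = (\<lambda>x\<in>{..<m}. x)"
    using mult ie unfolding multiplicative_map_def \<tau>_def
    by (intro restrict_ext) (simp add: BijGroup_def)
  define P where "P gh = {a\<in>A. \<sigma> (fst gh \<otimes>\<^bsub>H\<^esub> snd gh) a \<noteq> (\<sigma> (fst gh) \<otimes>\<^bsub>BijGroup A\<^esub> \<sigma> (snd gh)) a}" for gh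
  define Q where "Q g = {a\<in>A. \<sigma> g a = a}" for g
  define Z where "Z = (\<Union>gh\<in>D \<times> D. P gh) \<union> (\<Union>g\<in>D - {\<one>\<^bsub>H\<^esub>}. Q g)"
  have P: "real (card (P gh)) \<le> \<epsilon> * m" if gh: "gh \<in> D \<times> D" for gh
  proof -
    have "hamming_dist A (\<sigma> (fst gh \<otimes>\<^bsub>H\<^esub> snd gh)) (\<sigma> (fst gh) \<otimes>\<^bsub>BijGroup A\<^esub> \<sigma> (snd gh)) < \<epsilon>"
      using mult gh unfolding multiplicative_map_def by auto
    then show ?thesis
      using m unfolding hamming_dist_def P_def m_def by (simp add: field_simps)
  qed
  have Q: "real (card (Q g)) \<le> \<epsilon> * m" if g: "g \<in> D - {\<one>\<^bsub>H\<^esub>}" for g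
  proof -
    have eq: "{a\<in>A. \<sigma> g a \<noteq> \<one>\<^bsub>BijGroup A\<^esub> a} = A - Q g"
      by (auto simp: Q_def BijGroup_def)
    have sub: "Q g \<subseteq> A" by (auto simp: Q_def)
    have "1 - \<epsilon> < real (card (A - Q g)) / real m"
      using len[rule_format, OF g] unfolding hamming_length_def hamming_dist_def m_def
      by (simp add: eq)
    moreover have "real (card (A - Q g)) = m - real (card (Q g))"
      unfolding m_def using sub A(1)
      by (simp add: card_Diff_subset finite_subset[OF sub] of_nat_diff card_mono)
    ultimately show ?thesis using m by (simp add: field_simps)
  qed
  have ZA: "Z \<subseteq> A" by (auto simp: Z_def P_def Q_def)
  have "real (card Z) \<le> real (card (\<Union>gh\<in>D \<times> D. P gh)) + real (card (\<Union>g\<in>D - {\<one>\<^bsub>H\<^esub>}. Q g))"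
    unfolding Z_def by (metis card_Un_le of_nat_add of_nat_le_iff)
  also have "\<dots> \<le> (\<Sum>gh\<in>D \<times> D. real (card (P gh))) + (\<Sum>g\<in>D - {\<one>\<^bsub>H\<^esub>}. real (card (Q g)))"
    using card_UN_le[of "D \<times> D" P] card_UN_le[of "D - {\<one>\<^bsub>H\<^esub>}" Q] D(2)
    by (intro add_mono) (auto simp flip: of_nat_sum)
  also have "\<dots> \<le> (\<Sum>gh\<in>D \<times> D. \<epsilon> * m) + (\<Sum>g\<in>D - {\<one>\<^bsub>H\<^esub>}. \<epsilon> * m)"
    using P Q by (intro add_mono sum_mono) auto
  also have "\<dots> \<le> real (card (D \<times> D)) * (\<epsilon> * m) + real (card D) * (\<epsilon> * m)"
    using D(2) \<open>\<epsilon> > 0\<close> by (auto intro!: mult_right_mono card_mono)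
  also have "\<dots> \<le> real N * (\<epsilon> * m)"
    using \<open>\<epsilon> > 0\<close> unfolding N_def by (simp add: distrib_right)
  also have "\<dots> = \<eta> * m" using \<open>N > 0\<close> by (simp add: \<epsilon>_def)
  finally have cZ: "real (card Z) \<le> \<eta> * m" .
  define X where "X = i ` (A - Z)"
  have Xm: "X \<subseteq> {..<m}" using ei by (auto simp: X_def)
  have cX: "real (card ({..<m} - X)) \<le> \<eta> * m"
  proof -
    have "{..<m} - X \<subseteq> i ` Z"
    proof
      fix x assume x: "x \<in> {..<m} - X"
      then have "e x \<in> Z" using ie[of x] unfolding X_def by force
      then show "x \<in> i ` Z" using ie[of x] x by force
    qed
    then have "card ({..<m} - X) \<le> card Z"
      using ZA A(1) by (metis finite_subset surj_card_le)
    then show ?thesis using cZ by linarith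
  qed
  have gX: "(\<forall>g\<in>D. \<forall>h\<in>D. \<tau> (g \<otimes>\<^bsub>H\<^esub> h) x = \<tau> g (\<tau> h x)) \<and> (\<forall>g\<in>D - {\<one>\<^bsub>H\<^esub>}. \<tau> g x \<noteq> x)"
    if x: "x \<in> X" for x
  proof -
    obtain a where a: "a \<in> A" "a \<notin> Z" "x = i a" using x by (auto simp: X_def)
    have 1: "\<tau> g (i b) = i (\<sigma> g b)" if "b \<in> A" for g b
      using that ei by (simp add: \<tau>_def)
    have "\<tau> (g \<otimes>\<^bsub>H\<^esub> h) x = \<tau> g (\<tau> h x)" if g: "g \<in> D" "h \<in> D" for g h
    proof -
      have gc: "g \<in> carrier H" "h \<in> carrier H" using g D by auto
      have "a \<notin> P (g, h)" using a(2) g unfolding Z_def by auto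
      then have "\<sigma> (g \<otimes>\<^bsub>H\<^esub> h) a = \<sigma> g (\<sigma> h a)"
        using a(1) BijGroup_mult_apply[OF \<sigma>B[OF gc(1)] \<sigma>B[OF gc(2)] a(1)] by (simp add: P_def)
      moreover have "\<sigma> h a \<in> A" using \<sigma>B[OF gc(2)] a(1) Bij_in by fast
      ultimately show ?thesis using 1 a by simp
    qed
    moreover have "\<tau> g x \<noteq> x" if g: "g \<in> D - {\<one>\<^bsub>H\<^esub>}" for g
    proof -
      have gc: "g \<in> carrier H" using g D by auto
      have "a \<notin> Q g" using a(2) g unfolding Z_def by auto
      then have "\<sigma> g a \<noteq> a" using a(1) by (simp add: Q_def)
      moreover have "\<sigma> g a \<in> A" using \<sigma>B[OF gc] a(1) Bij_in by fast
      ultimately show ?thesis using 1[OF a(1)] a by (metis ei(1))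
    qed
    ultimately show ?thesis by blast
  qed
  show ?thesis
    by (rule exI[of _ m], rule exI[of _ \<tau>], rule exI[of _ X]) (use m \<tau>B \<tau>1 Xm cX gX in blast)
qed

section \<open>Elements of the wreath product\<close>

lemma carrier_wreath_product:
  assumes "group G"
  shows "carrier (wreath_product G H) =
    {f \<in> carrier H \<rightarrow>\<^sub>E carrier G. finite {x \<in> carrier H. f x \<noteq> \<one>\<^bsub>G\<^esub>}} \<times> carrier H"
  by (simp add: wreath_product_def semidirect_product_def carrier_sum_group assms)

lemma mult_wreath_product:
  assumes "h \<in> carrier H"
  shows "(f, h) \<otimes>\<^bsub>wreath_product G H\<^esub> (f', h') =
    (\<lambda>x\<in>carrier H. f x \<otimes>\<^bsub>G\<^esub> f' (inv\<^bsub>H\<^esub> h \<otimes>\<^bsub>H\<^esub> x), h \<otimes>\<^bsub>H\<^esub> h')"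
  by (auto simp: wreath_product_def semidirect_product_def shift_action_def intro!: restrict_ext)

lemma one_wreath_product:
  "\<one>\<^bsub>wreath_product G H\<^esub> = (\<lambda>x\<in>carrier H. \<one>\<^bsub>G\<^esub>, \<one>\<^bsub>H\<^esub>)"
  by (simp add: wreath_product_def semidirect_product_def)

section \<open>Transporting lamps to a sofic model\<close>

text \<open>
  The lamps of \<open>f\<close> as seen from \<open>b\<close>: the chart \<open>v \<mapsto> \<sigma> (v\<inverse>) b\<close> carries the values of \<open>\<theta> \<circ> f\<close> on
  \<open>E\<close> to places in the model. The inverse makes the charts follow the action: for the left
  translations of \<open>H\<close> itself, the chart at \<open>b\<close> is \<open>v \<mapsto> v\<inverse> b\<close>, and the chart at \<open>h b\<close> shows
  \<open>h v\<close> at the place where the chart at \<open>b\<close> shows \<open>v\<close>.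
\<close>

definition lamps ::
  "('b, 'n) monoid_scheme \<Rightarrow> ('k, 'm) monoid_scheme \<Rightarrow> 'b set \<Rightarrow> ('b \<Rightarrow> nat \<Rightarrow> nat) \<Rightarrow> ('a \<Rightarrow> 'k)
     \<Rightarrow> ('b \<Rightarrow> 'a) \<Rightarrow> nat \<Rightarrow> nat \<Rightarrow> 'k" where
  "lamps H K E \<sigma> \<theta> f b y =
     (if \<exists>v\<in>E. \<sigma> (inv\<^bsub>H\<^esub> v) b = y then \<theta> (f (SOME v. v \<in> E \<and> \<sigma> (inv\<^bsub>H\<^esub> v) b = y)) else \<one>\<^bsub>K\<^esub>)"

lemma lamps_at:
  assumes "inj_on (\<lambda>v. \<sigma> (inv\<^bsub>H\<^esub> v) b) E" and "v \<in> E"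
  shows "lamps H K E \<sigma> \<theta> f b (\<sigma> (inv\<^bsub>H\<^esub> v) b) = \<theta> (f v)"
proof -
  have "(SOME w. w \<in> E \<and> \<sigma> (inv\<^bsub>H\<^esub> w) b = \<sigma> (inv\<^bsub>H\<^esub> v) b) = v"
    using assms by (intro some_equality) (auto dest: inj_onD)
  then show ?thesis using assms(2) by (auto simp: lamps_def)
qed

lemma lamps_off:
  assumes "\<And>v. v \<in> E \<Longrightarrow> \<sigma> (inv\<^bsub>H\<^esub> v) b = y \<Longrightarrow> \<theta> (f v) = \<one>\<^bsub>K\<^esub>"
  shows "lamps H K E \<sigma> \<theta> f b y = \<one>\<^bsub>K\<^esub>"
proof (cases "\<exists>v\<in>E. \<sigma> (inv\<^bsub>H\<^esub> v) b = y")
  case True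
  then have "\<exists>v. v \<in> E \<and> \<sigma> (inv\<^bsub>H\<^esub> v) b = y" by blast
  from someI_ex[OF this] assms True show ?thesis by (simp add: lamps_def)
qed (simp add: lamps_def)

lemma lamps_closed:
  assumes "group K" "\<theta> \<in> carrier G \<rightarrow> carrier K" "f \<in> carrier H \<rightarrow>\<^sub>E carrier G" "E \<subseteq> carrier H"
  shows "lamps H K E \<sigma> \<theta> f b y \<in> carrier K"
proof (cases "\<exists>v\<in>E. \<sigma> (inv\<^bsub>H\<^esub> v) b = y")
  case True
  then have "\<exists>v. v \<in> E \<and> \<sigma> (inv\<^bsub>H\<^esub> v) b = y" by blast
  from someI_ex[OF this] True assms show ?thesis by (auto simp: lamps_def)
next
  case False
  interpret group K by fact
  from False show ?thesis by (simp add: lamps_def)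
qed

text \<open>
  Here \<open>c\<close> is a base point, \<open>b\<close> its translate by \<open>h\<close>, and \<open>f''\<close> the product of \<open>f\<close> with the shift
  of \<open>f'\<close> by \<open>h\<close>. By the assumption on the charts, a lamp of \<open>f'\<close> that is seen from \<open>c\<close> as \<open>w\<close> is
  seen from \<open>b\<close> as \<open>h w\<close>, and injectivity excludes any other coincidence. Places outside the chart
  at \<open>b\<close> carry no lamp at all, and each of the at most \<open>card E\<close> places inside contributes one error
  of \<open>\<theta>\<close>.
\<close>

lemma (in wreath_closed) lamps_almost_mult:
  assumes K: "(K, d) \<in> \<C>" and G: "group G" and H: "group H"
    and \<theta>: "\<theta> \<in> carrier G \<rightarrow> carrier K" "\<theta> \<one>\<^bsub>G\<^esub> = \<one>\<^bsub>K\<^esub>"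
    and mult: "\<And>u u'. u \<in> U \<Longrightarrow> u' \<in> U \<Longrightarrow> d (\<theta> (u \<otimes>\<^bsub>G\<^esub> u')) (\<theta> u \<otimes>\<^bsub>K\<^esub> \<theta> u') \<le> \<delta>"
    and f: "f \<in> carrier H \<rightarrow>\<^sub>E carrier G" "f' \<in> carrier H \<rightarrow>\<^sub>E carrier G"
    and fU: "f ` carrier H \<subseteq> U" "f' ` carrier H \<subseteq> U"
    and h: "h \<in> carrier H"
    and E: "E \<subseteq> carrier H" "finite E" "S \<subseteq> E" "\<And>w. w \<in> S \<Longrightarrow> h \<otimes>\<^bsub>H\<^esub> w \<in> E"
    and S: "\<And>v. v \<in> carrier H - S \<Longrightarrow> f v = \<one>\<^bsub>G\<^esub>" "\<And>v. v \<in> carrier H - S \<Longrightarrow> f' v = \<one>\<^bsub>G\<^esub>"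
    and inj: "inj_on (\<lambda>v. \<sigma> (inv\<^bsub>H\<^esub> v) b) E" "inj_on (\<lambda>v. \<sigma> (inv\<^bsub>H\<^esub> v) c) E"
    and chart: "\<And>w. w \<in> S \<Longrightarrow> \<sigma> (inv\<^bsub>H\<^esub> (h \<otimes>\<^bsub>H\<^esub> w)) b = \<sigma> (inv\<^bsub>H\<^esub> w) c"
    and A: "finite A" and \<delta>: "0 \<le> \<delta>"
  defines "f'' \<equiv> (\<lambda>x\<in>carrier H. f x \<otimes>\<^bsub>G\<^esub> f' (inv\<^bsub>H\<^esub> h \<otimes>\<^bsub>H\<^esub> x))"
  shows "(\<Sum>y\<in>A. d (lamps H K E \<sigma> \<theta> f b y \<otimes>\<^bsub>K\<^esub> lamps H K E \<sigma> \<theta> f' c y) (lamps H K E \<sigma> \<theta> f'' b y))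
    \<le> real (card E) * \<delta>"
proof -
  interpret K: group K using K by (rule group)
  interpret G: group G by fact
  interpret H: group H by fact
  have f'': "f'' \<in> carrier H \<rightarrow>\<^sub>E carrier G" using f h by (auto simp: f''_def)
  have hv: "h \<otimes>\<^bsub>H\<^esub> (inv\<^bsub>H\<^esub> h \<otimes>\<^bsub>H\<^esub> v) = v" "inv\<^bsub>H\<^esub> h \<otimes>\<^bsub>H\<^esub> v \<in> carrier H" if "v \<in> carrier H" for v
    using h that by (auto simp flip: H.m_assoc)
  have hw: "inv\<^bsub>H\<^esub> h \<otimes>\<^bsub>H\<^esub> (h \<otimes>\<^bsub>H\<^esub> v) = v" if "v \<in> carrier H" for v
    using h that by (auto simp flip: H.m_assoc)
  define Y where "Y = (\<lambda>v. \<sigma> (inv\<^bsub>H\<^esub> v) b) ` E"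
  let ?t = "\<lambda>y. d (lamps H K E \<sigma> \<theta> f b y \<otimes>\<^bsub>K\<^esub> lamps H K E \<sigma> \<theta> f' c y) (lamps H K E \<sigma> \<theta> f'' b y)"
  have off: "?t y = 0" if y: "y \<notin> Y" for y
  proof -
    have 1: "lamps H K E \<sigma> \<theta> g b y = \<one>\<^bsub>K\<^esub>" for g
      using y by (auto simp: Y_def lamps_def)
    have "lamps H K E \<sigma> \<theta> f' c y = \<one>\<^bsub>K\<^esub>"
    proof (rule lamps_off)
      fix w assume w: "w \<in> E" "\<sigma> (inv\<^bsub>H\<^esub> w) c = y"
      have "w \<notin> S"
      proof
        assume "w \<in> S"
        then have "\<sigma> (inv\<^bsub>H\<^esub> (h \<otimes>\<^bsub>H\<^esub> w)) b = y" using chart w by simp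
        then show False using y E(4)[OF \<open>w \<in> S\<close>] by (auto simp: Y_def)
      qed
      then show "\<theta> (f' w) = \<one>\<^bsub>K\<^esub>" using S(2)[of w] w E \<theta> by auto
    qed
    with 1 show ?thesis using dist_refl[OF K K.one_closed] by simp
  qed
  have on: "?t y \<le> \<delta>" if y: "y \<in> Y" for y
  proof -
    obtain v where v: "v \<in> E" "y = \<sigma> (inv\<^bsub>H\<^esub> v) b" using y by (auto simp: Y_def)
    have vc: "v \<in> carrier H" using v E by auto
    define w where "w = inv\<^bsub>H\<^esub> h \<otimes>\<^bsub>H\<^esub> v"
    have w: "w \<in> carrier H" "h \<otimes>\<^bsub>H\<^esub> w = v" using hv[OF vc] by (auto simp: w_def)
    have "lamps H K E \<sigma> \<theta> f' c y = \<theta> (f' w)"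
    proof (cases "w \<in> S")
      case True
      then have "y = \<sigma> (inv\<^bsub>H\<^esub> w) c" using chart[OF True] w v by simp
      then show ?thesis using lamps_at[where \<sigma> = \<sigma> and H = H, OF inj(2), of w] True E(3) by auto
    next
      case False
      then have "\<theta> (f' w) = \<one>\<^bsub>K\<^esub>" using S(2)[of w] w \<theta> by simp
      moreover have "lamps H K E \<sigma> \<theta> f' c y = \<one>\<^bsub>K\<^esub>"
      proof (rule lamps_off)
        fix u assume u: "u \<in> E" "\<sigma> (inv\<^bsub>H\<^esub> u) c = y"
        have "u \<notin> S"
        proof
          assume uS: "u \<in> S"
          then have "\<sigma> (inv\<^bsub>H\<^esub> (h \<otimes>\<^bsub>H\<^esub> u)) b = \<sigma> (inv\<^bsub>H\<^esub> v) b" using chart u v by simp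
          then have "h \<otimes>\<^bsub>H\<^esub> u = v" using inj_onD[OF inj(1)] E(4)[OF uS] v by blast
          then have "u = w" using hw[of u] u E(1) unfolding w_def by auto
          then show False using uS False by simp
        qed
        then show "\<theta> (f' u) = \<one>\<^bsub>K\<^esub>" using S(2)[of u] u E \<theta> by auto
      qed
      ultimately show ?thesis by simp
    qed
    moreover have "lamps H K E \<sigma> \<theta> g b y = \<theta> (g v)" for g
      unfolding v(2) by (rule lamps_at[where \<sigma> = \<sigma> and H = H, OF inj(1) v(1)])
    moreover have "f'' v = f v \<otimes>\<^bsub>G\<^esub> f' w" using vc by (simp add: f''_def w_def)
    moreover have "\<theta> (f v) \<in> carrier K" "\<theta> (f' w) \<in> carrier K" "\<theta> (f v \<otimes>\<^bsub>G\<^esub> f' w) \<in> carrier K"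
      using \<theta> f vc w by (auto simp: PiE_iff Pi_iff)
    ultimately show ?thesis
      using mult[of "f v" "f' w"] fU vc w dist_sym[OF K, of "\<theta> (f v) \<otimes>\<^bsub>K\<^esub> \<theta> (f' w)"] by auto
  qed
  have "(\<Sum>y\<in>A. ?t y) = (\<Sum>y\<in>A \<inter> Y. ?t y)"
    using A off by (intro sum.mono_neutral_right) auto
  also have "\<dots> \<le> (\<Sum>y\<in>A \<inter> Y. \<delta>)" using on by (intro sum_mono) auto
  also have "\<dots> = real (card (A \<inter> Y)) * \<delta>" by simp
  also have "\<dots> \<le> real (card E) * \<delta>"
  proof -
    have "card (A \<inter> Y) \<le> card Y" using E by (intro card_mono) (auto simp: Y_def)
    also have "\<dots> \<le> card E" unfolding Y_def using E by (intro card_image_le) auto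
    finally show ?thesis using \<delta> by (intro mult_right_mono) auto
  qed
  finally show ?thesis .
qed


lemma sqrt_modulus:
  fixes \<epsilon> :: real
  assumes "0 < \<epsilon>"
  shows "\<exists>\<delta>. 0 < \<delta> \<and> \<delta> \<le> 1 \<and> 3 * sqrt \<delta> < \<epsilon>"
proof (intro exI conjI)
  let ?\<delta> = "min 1 ((\<epsilon> / 4)\<^sup>2)"
  show "0 < ?\<delta>" "?\<delta> \<le> 1" using assms by auto
  have "sqrt ?\<delta> \<le> sqrt ((\<epsilon> / 4)\<^sup>2)" by (intro real_sqrt_le_mono) auto
  also have "\<dots> = \<epsilon> / 4" using assms by simp
  finally show "3 * sqrt ?\<delta> < \<epsilon>" using assms by simp
qed

text \<open>
  The approximation of \<open>(f, h)\<close> is the block monomial matrix with permutation \<open>\<sigma> h\<close> and with the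
  amplified tensor product of the lamps of \<open>f\<close>, seen from \<open>\<sigma> h a\<close>, as the block in column \<open>a\<close>.
\<close>

theorem (in wreath_closed) approximable_wreath_product:
  fixes G :: "('a, 'm) monoid_scheme" and H :: "('b, 'n) monoid_scheme"
  assumes H: "sofic H" and G: "approximable \<C> G"
  shows "approximable \<C> (wreath_product G H)"
proof -
  have gG: "group G" using G by (simp add: approximable_def)
  have gH: "group H" using H by (simp add: sofic_def)
  interpret G: group G by fact
  interpret H: group H by fact
  interpret W: group "wreath_product G H" by (intro group_wreath_product gG gH)
  let ?W = "wreath_product G H"
  obtain c0 where c0: "\<forall>g\<in>carrier G - {\<one>\<^bsub>G\<^esub>}. 0 < c0 g"
    and approx: "\<forall>F \<epsilon>. F \<subseteq> carrier G \<and> finite F \<and> 0 < \<epsilon> \<longrightarrow>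
       (\<exists>(K, d)\<in>\<C>. \<exists>\<theta>\<in>carrier G \<rightarrow> carrier K. multiplicative_map G K F \<epsilon> d \<theta> \<and> injective_map G K F c0 d \<theta>)"
    using G unfolding approximable_def by (elim conjE exE)
  define c where "c g = min 1 (c0 g)" for g
  have c: "0 < c g" "c g \<le> 1" if "g \<in> carrier G - {\<one>\<^bsub>G\<^esub>}" for g
    using c0 that by (auto simp: c_def)
  define pos where "pos f = (SOME v. v \<in> carrier H \<and> f v \<noteq> \<one>\<^bsub>G\<^esub>)" for f :: "'b \<Rightarrow> 'a"
  \<comment> \<open>At least half of the points will be good. The estimate for moved points loses a factor \<open>3\<close>, whence
    \<open>1 / 6\<close>; the amplified tensor product loses a factor \<open>4\<close>, whence \<open>1 / 8\<close>.\<close>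
  define C where "C p = (if snd p \<noteq> \<one>\<^bsub>H\<^esub> then 1 / 6 else c (fst p (pos (fst p))) / 8)" for p
  have pos: "pos f \<in> carrier H" "f (pos f) \<in> carrier G - {\<one>\<^bsub>G\<^esub>}"
    if "(f, \<one>\<^bsub>H\<^esub>) \<in> carrier ?W - {\<one>\<^bsub>?W\<^esub>}" for f
  proof -
    have f: "f \<in> carrier H \<rightarrow>\<^sub>E carrier G" "f \<noteq> (\<lambda>x\<in>carrier H. \<one>\<^bsub>G\<^esub>)"
      using that by (auto simp: carrier_wreath_product gG one_wreath_product)
    have "\<exists>v. v \<in> carrier H \<and> f v \<noteq> \<one>\<^bsub>G\<^esub>"
    proof (rule ccontr)
      assume "\<not> ?thesis"
      then have "f = (\<lambda>x\<in>carrier H. \<one>\<^bsub>G\<^esub>)"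
        using f(1) by (intro extensionalityI[of _ "carrier H"]) (auto simp: PiE_iff)
      with f(2) show False by simp
    qed
    from someI_ex[OF this] show "pos f \<in> carrier H" "f (pos f) \<in> carrier G - {\<one>\<^bsub>G\<^esub>}"
      using f unfolding pos_def by auto
  qed
  have Cpos: "0 < C p" if "p \<in> carrier ?W - {\<one>\<^bsub>?W\<^esub>}" for p
  proof (cases "snd p = \<one>\<^bsub>H\<^esub>")
    case True
    then have "(fst p, \<one>\<^bsub>H\<^esub>) \<in> carrier ?W - {\<one>\<^bsub>?W\<^esub>}" using that by (metis prod.collapse)
    from c(1)[OF pos(2)[OF this]] True show ?thesis by (simp add: C_def)
  qed (simp add: C_def)
  have main: "\<exists>(M, D)\<in>\<C>. \<exists>\<Theta>\<in>carrier ?W \<rightarrow> carrier M. multiplicative_map ?W M F \<epsilon> D \<Theta> \<and> injective_map ?W M F C D \<Theta>"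
    if F: "F \<subseteq> carrier ?W" "finite F" and \<epsilon>: "0 < \<epsilon>" for F \<epsilon>
  proof -
    obtain \<delta>1 where \<delta>1: "0 < \<delta>1" "\<delta>1 \<le> 1" "3 * sqrt \<delta>1 < \<epsilon>" using sqrt_modulus[OF \<epsilon>] by blast
    obtain \<delta>2 where \<delta>2: "0 < \<delta>2" "\<delta>2 \<le> 1" "3 * sqrt \<delta>2 < \<delta>1" using sqrt_modulus[OF \<delta>1(1)] by blast
    \<comment> \<open>Each product involves three base points, all of which have to be good.\<close>
    define \<eta> where "\<eta> = \<delta>1 / 6"
    have \<eta>: "0 < \<eta>" "3 * \<eta> \<le> \<delta>1" "\<eta> \<le> 1 / 2" using \<delta>1 by (auto simp: \<eta>_def)
    define supp where "supp f = {v\<in>carrier H. f v \<noteq> \<one>\<^bsub>G\<^esub>}" for f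
    have Fc: "f \<in> carrier H \<rightarrow>\<^sub>E carrier G" "finite (supp f)" "h \<in> carrier H" if "(f, h) \<in> carrier ?W" for f h
      using that by (auto simp: carrier_wreath_product gG supp_def)
    define S where "S = (\<Union>p\<in>F. supp (fst p))"
    have S: "finite S" "S \<subseteq> carrier H"
      using F Fc unfolding S_def by (auto simp: supp_def)
    define Hs where "Hs = snd ` F"
    have Hs: "finite Hs" "Hs \<subseteq> carrier H" using F Fc unfolding Hs_def by auto
    \<comment> \<open>A lamp that one base point sees in \<open>S\<close> is seen in a translate of \<open>S\<close> from the next.\<close>
    define E where "E = S \<union> (\<lambda>(h, w). h \<otimes>\<^bsub>H\<^esub> w) ` (Hs \<times> S)"
    have E: "finite E" "E \<subseteq> carrier H" "S \<subseteq> E"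
      using S Hs unfolding E_def by auto
    \<comment> \<open>Freeness of the products \<open>w v\<inverse>\<close> makes charts injective, multiplicativity on \<open>Hs\<close> and on the
      inverses of \<open>E\<close> compares the charts of neighbouring base points.\<close>
    define Dm where "Dm = Hs \<union> E \<union> (\<lambda>v. inv\<^bsub>H\<^esub> v) ` E \<union> (\<lambda>(w, v). w \<otimes>\<^bsub>H\<^esub> inv\<^bsub>H\<^esub> v) ` (E \<times> E)"
    have Dm: "Dm \<subseteq> carrier H" "finite Dm"
      using Hs E unfolding Dm_def by auto
    define U where "U = insert \<one>\<^bsub>G\<^esub> (\<Union>p\<in>F. fst p ` supp (fst p))"
    have Fp: "fst p \<in> carrier H \<rightarrow>\<^sub>E carrier G" "finite (supp (fst p))" if "p \<in> F" for p
      using Fc[of "fst p" "snd p"] F that by auto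
    have U: "U \<subseteq> carrier G" "finite U"
      using F Fp PiE_mem[OF Fp(1)] unfolding U_def by (auto simp: supp_def)
    have fU: "f ` carrier H \<subseteq> U" if "(f, h) \<in> F" for f h
      using that unfolding U_def supp_def by force
    define \<delta>3 where "\<delta>3 = \<delta>2 / (real (card E) + 1)"
    have \<delta>3: "0 < \<delta>3" using \<delta>2 by (auto simp: \<delta>3_def)
    have "real (card E) * \<delta>2 \<le> (real (card E) + 1) * \<delta>2" using \<delta>2 by (intro mult_right_mono) auto
    then have \<delta>32: "real (card E) * \<delta>3 \<le> \<delta>2"
      by (simp add: \<delta>3_def field_simps)
    obtain K d \<theta> where K: "(K, d) \<in> \<C>" and \<theta>: "\<theta> \<in> carrier G \<rightarrow> carrier K"
      and \<theta>m: "multiplicative_map G K U \<delta>3 d \<theta>" and \<theta>i: "injective_map G K U c0 d \<theta>"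
      using approx[rule_format, OF conjI[OF U(1) conjI[OF U(2) \<delta>3]]] by auto
    have \<theta>1: "\<theta> \<one>\<^bsub>G\<^esub> = \<one>\<^bsub>K\<^esub>"
      and \<theta>mult: "\<And>u u'. u \<in> U \<Longrightarrow> u' \<in> U \<Longrightarrow> d (\<theta> (u \<otimes>\<^bsub>G\<^esub> u')) (\<theta> u \<otimes>\<^bsub>K\<^esub> \<theta> u') \<le> \<delta>3"
      using \<theta>m by (auto simp: multiplicative_map_def less_imp_le)
    interpret K: group K using K by (rule group)
    obtain m \<sigma> X where m: "0 < m" and \<sigma>: "\<forall>h\<in>carrier H. \<sigma> h \<in> Bij {..<m}"
      and \<sigma>1: "\<sigma> \<one>\<^bsub>H\<^esub> = (\<lambda>x\<in>{..<m}. x)" and X: "X \<subseteq> {..<m}" "real (card ({..<m} - X)) \<le> \<eta> * real m"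
      and good: "\<forall>x\<in>X. (\<forall>g\<in>Dm. \<forall>h\<in>Dm. \<sigma> (g \<otimes>\<^bsub>H\<^esub> h) x = \<sigma> g (\<sigma> h x)) \<and>
            (\<forall>g\<in>Dm - {\<one>\<^bsub>H\<^esub>}. \<sigma> g x \<noteq> x)"
      using sofic_model[OF H Dm \<eta>(1)] by (elim exE conjE)
    have \<sigma>in: "\<sigma> h a < m" if "h \<in> carrier H" "a < m" for h a
      using \<sigma> that Bij_in[of "\<sigma> h" "{..<m}" a] by auto
    define A where "A = {..<m}"
    have A: "finite A" "A \<noteq> {}" using m by (auto simp: A_def)
    obtain L D T where L: "(L, D) \<in> \<C>" and T: "T \<in> hom (product_group A (\<lambda>_. K)) L"
      and Tup: "\<forall>k\<in>A \<rightarrow>\<^sub>E carrier K. \<forall>k'\<in>A \<rightarrow>\<^sub>E carrier K. \<forall>\<delta>. 0 \<le> \<delta> \<and> \<delta> \<le> 1 \<and> (\<Sum>y\<in>A. d (k y) (k' y)) \<le> \<delta>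
       \<longrightarrow> D (T k) (T k') \<le> 3 * sqrt \<delta>"
      and Tlow: "\<forall>k\<in>A \<rightarrow>\<^sub>E carrier K. \<forall>y\<in>A. \<forall>t. 0 \<le> t \<and> t \<le> 1 \<and> t \<le> d (k y) \<one>\<^bsub>K\<^esub> \<longrightarrow> t / 4 \<le> D (T k) \<one>\<^bsub>L\<^esub>"
      using tensor_amplify[OF K A] by (elim exE conjE)
    interpret L: group L using L by (rule group)
    obtain M B \<Psi> where M: "(M, B) \<in> \<C>" and mon: "monomial_hom m (L, D) (M, B) \<Psi>"
      using monomial[OF L m] by blast
    interpret M: group M using M by (rule group)
    have \<Psi>: "\<Psi> \<in> hom (perm_wreath L {..<m}) M"
      and up: "\<And>\<delta> k p k' p'. 0 \<le> \<delta> \<Longrightarrow> \<delta> \<le> 1 \<Longrightarrow>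
        (k, p) \<in> carrier (perm_wreath L {..<m}) \<Longrightarrow> (k', p') \<in> carrier (perm_wreath L {..<m}) \<Longrightarrow>
        real (card {b\<in>{..<m}. p b \<noteq> p' b \<or> \<delta> < D (k b) (k' b)}) \<le> \<delta> * real m \<Longrightarrow>
        B (\<Psi> (k, p)) (\<Psi> (k', p')) \<le> 3 * sqrt \<delta>"
      and low1: "\<And>k p. (k, p) \<in> carrier (perm_wreath L {..<m}) \<Longrightarrow>
        real (card {b\<in>{..<m}. p b \<noteq> b}) / (3 * real m) \<le> B (\<Psi> (k, p)) \<one>\<^bsub>M\<^esub>"
      and low2: "\<And>k t. k \<in> {..<m} \<rightarrow>\<^sub>E carrier L \<Longrightarrow> 0 \<le> t \<Longrightarrow> t \<le> 1 \<Longrightarrow>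
        t * (real (card {b\<in>{..<m}. t \<le> D (k b) \<one>\<^bsub>L\<^esub>}) / real m)
          \<le> B (\<Psi> (k, \<lambda>b\<in>{..<m}. b)) \<one>\<^bsub>M\<^esub>"
      using mon unfolding monomial_hom_def prod.case by (elim conjE, blast)+
    interpret PW: group "perm_wreath L {..<m}" by (intro group_perm_wreath L.group_axioms)
    interpret PA: group "product_group A (\<lambda>_. K)" by (simp add: K.group_axioms)
    have T1: "T \<one>\<^bsub>product_group A (\<lambda>_. K)\<^esub> = \<one>\<^bsub>L\<^esub>"
      using T PA.group_axioms L.group_axioms by (rule hom_one)
    have \<Psi>1: "\<Psi> \<one>\<^bsub>perm_wreath L {..<m}\<^esub> = \<one>\<^bsub>M\<^esub>"
      using \<Psi> PW.group_axioms M.group_axioms by (rule hom_one)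
    define \<kappa> where "\<kappa> f b = (\<lambda>y\<in>A. lamps H K E \<sigma> \<theta> f b y)" for f b
    have \<kappa>: "\<kappa> f b \<in> A \<rightarrow>\<^sub>E carrier K" if "f \<in> carrier H \<rightarrow>\<^sub>E carrier G" for f b
      using lamps_closed[OF K.group_axioms \<theta> that E(2)] by (auto simp: \<kappa>_def)
    have Tc: "T k \<in> carrier L" if "k \<in> A \<rightarrow>\<^sub>E carrier K" for k
      using T that by (auto simp: hom_def)
    define V where "V f h = (\<lambda>a\<in>{..<m}. T (\<kappa> f (\<sigma> h a)), \<sigma> h)" for f h
    have V: "V f h \<in> carrier (perm_wreath L {..<m})" if "f \<in> carrier H \<rightarrow>\<^sub>E carrier G" "h \<in> carrier H" for f h
      using Tc[OF \<kappa>[OF that(1)]] that \<sigma> by (auto simp: V_def carrier_perm_wreath)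
    define \<Theta> where "\<Theta> p = \<Psi> (V (fst p) (snd p))" for p
    have \<Theta>: "\<Theta> \<in> carrier ?W \<rightarrow> carrier M"
      using V Fc \<Psi> by (auto simp: \<Theta>_def hom_def Pi_iff)
    have \<Theta>1: "\<Theta> \<one>\<^bsub>?W\<^esub> = \<one>\<^bsub>M\<^esub>"
    proof -
      have "\<kappa> (\<lambda>x\<in>carrier H. \<one>\<^bsub>G\<^esub>) b = \<one>\<^bsub>product_group A (\<lambda>_. K)\<^esub>" for b
        unfolding \<kappa>_def one_product_group
        using E \<theta>1 by (intro restrict_ext lamps_off) auto
      then have "V (\<lambda>x\<in>carrier H. \<one>\<^bsub>G\<^esub>) \<one>\<^bsub>H\<^esub> = \<one>\<^bsub>perm_wreath L {..<m}\<^esub>"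
        unfolding V_def one_perm_wreath by (simp only: T1 \<sigma>1)
      then show ?thesis using \<Psi>1 by (simp add: \<Theta>_def one_wreath_product)
    qed
    have inj: "inj_on (\<lambda>v. \<sigma> (inv\<^bsub>H\<^esub> v) x) E" if x: "x \<in> X" for x
    proof (rule inj_onI, rule ccontr)
      fix v w assume vw: "v \<in> E" "w \<in> E" "\<sigma> (inv\<^bsub>H\<^esub> v) x = \<sigma> (inv\<^bsub>H\<^esub> w) x" "v \<noteq> w"
      have vwc: "v \<in> carrier H" "w \<in> carrier H" using vw E by auto
      have mem: "w \<in> Dm" "inv\<^bsub>H\<^esub> v \<in> Dm" "inv\<^bsub>H\<^esub> w \<in> Dm" "w \<otimes>\<^bsub>H\<^esub> inv\<^bsub>H\<^esub> v \<in> Dm"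
        using vw unfolding Dm_def by auto
      have "\<sigma> (w \<otimes>\<^bsub>H\<^esub> inv\<^bsub>H\<^esub> v) x = \<sigma> (w \<otimes>\<^bsub>H\<^esub> inv\<^bsub>H\<^esub> w) x"
        using good x mem vw(3) by simp
      also have "\<dots> = x" using vwc X x \<sigma>1 by auto
      finally have "w \<otimes>\<^bsub>H\<^esub> inv\<^bsub>H\<^esub> v = \<one>\<^bsub>H\<^esub>" using good x mem by blast
      then have "w = v" using vwc by (metis H.inv_closed H.inv_equality H.inv_inv)
      then show False using vw by simp
    qed
    have mult: "B (\<Theta> (p \<otimes>\<^bsub>?W\<^esub> p')) (\<Theta> p \<otimes>\<^bsub>M\<^esub> \<Theta> p') < \<epsilon>" if p: "p \<in> F" "p' \<in> F" for p p'
    proof -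
      obtain f h f' h' where pp: "p = (f, h)" "p' = (f', h')" by (metis surj_pair)
      have ph: "(f, h) \<in> carrier ?W" "(f', h') \<in> carrier ?W" using p pp F by auto
      note fh = Fc[OF ph(1)] Fc[OF ph(2)]
      define f'' where "f'' = (\<lambda>x\<in>carrier H. f x \<otimes>\<^bsub>G\<^esub> f' (inv\<^bsub>H\<^esub> h \<otimes>\<^bsub>H\<^esub> x))"
      have prod: "p \<otimes>\<^bsub>?W\<^esub> p' = (f'', h \<otimes>\<^bsub>H\<^esub> h')"
        unfolding pp f''_def by (rule mult_wreath_product[OF fh(3)])
      have f'': "f'' \<in> carrier H \<rightarrow>\<^sub>E carrier G" using fh by (auto simp: f''_def)
      have hh: "h \<in> Hs" "h' \<in> Hs" using p pp unfolding Hs_def by force+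
      have hD: "h \<in> Dm" "h' \<in> Dm" using hh by (auto simp: Dm_def)
      define k where "k = (\<lambda>a\<in>{..<m}. T (\<kappa> f (\<sigma> h (\<sigma> h' a))) \<otimes>\<^bsub>L\<^esub> T (\<kappa> f' (\<sigma> h' a)))"
      have VV: "V f h \<otimes>\<^bsub>perm_wreath L {..<m}\<^esub> V f' h' = (k, compose {..<m} (\<sigma> h) (\<sigma> h'))"
        unfolding V_def mult_perm_wreath k_def using fh \<sigma>in
        by (auto intro!: restrict_ext)
      have kV: "(k, compose {..<m} (\<sigma> h) (\<sigma> h')) \<in> carrier (perm_wreath L {..<m})"
        unfolding VV[symmetric] using V fh by (intro PW.m_closed) auto
      have kV'': "(\<lambda>a\<in>{..<m}. T (\<kappa> f'' (\<sigma> (h \<otimes>\<^bsub>H\<^esub> h') a)), \<sigma> (h \<otimes>\<^bsub>H\<^esub> h')) \<in> carrier (perm_wreath L {..<m})"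
        using V[OF f''] fh unfolding V_def by auto
      define bad where "bad = {..<m} - X"
      define Bad where "Bad = bad \<union> {a\<in>{..<m}. \<sigma> h' a \<in> bad} \<union> {a\<in>{..<m}. \<sigma> h (\<sigma> h' a) \<in> bad}"
      have close: "(\<lambda>a\<in>{..<m}. T (\<kappa> f'' (\<sigma> (h \<otimes>\<^bsub>H\<^esub> h') a))) a = T (\<kappa> f'' (\<sigma> h (\<sigma> h' a)))
          \<and> \<sigma> (h \<otimes>\<^bsub>H\<^esub> h') a = compose {..<m} (\<sigma> h) (\<sigma> h') a
          \<and> D (T (\<kappa> f'' (\<sigma> h (\<sigma> h' a)))) (k a) \<le> \<delta>1" if a: "a < m" "a \<notin> Bad" for a
      proof -
        define u where "u = \<sigma> h' a"
        define b where "b = \<sigma> h u"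
        have um: "u < m" "b < m" using \<sigma>in fh a by (auto simp: u_def b_def)
        have gd: "a \<in> X" "u \<in> X" "b \<in> X" using a um by (auto simp: Bad_def bad_def u_def b_def)
        have eq: "\<sigma> (h \<otimes>\<^bsub>H\<^esub> h') a = b" using good gd hD by (auto simp: u_def b_def)
        have chart: "\<sigma> (inv\<^bsub>H\<^esub> (h \<otimes>\<^bsub>H\<^esub> w)) b = \<sigma> (inv\<^bsub>H\<^esub> w) u" if w: "w \<in> S" for w
        proof -
          have wc: "w \<in> carrier H" using w S by auto
          have "h \<otimes>\<^bsub>H\<^esub> w \<in> E" using w hh unfolding E_def by auto
          then have "inv\<^bsub>H\<^esub> (h \<otimes>\<^bsub>H\<^esub> w) \<in> Dm" unfolding Dm_def by auto
          then have "\<sigma> (inv\<^bsub>H\<^esub> (h \<otimes>\<^bsub>H\<^esub> w) \<otimes>\<^bsub>H\<^esub> h) u = \<sigma> (inv\<^bsub>H\<^esub> (h \<otimes>\<^bsub>H\<^esub> w)) b"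
            using good gd hD unfolding b_def by blast
          moreover have "inv\<^bsub>H\<^esub> (h \<otimes>\<^bsub>H\<^esub> w) \<otimes>\<^bsub>H\<^esub> h = inv\<^bsub>H\<^esub> w"
            using wc fh by (simp add: H.inv_mult_group H.m_assoc)
          ultimately show ?thesis by simp
        qed
        have "(\<Sum>y\<in>A. d (lamps H K E \<sigma> \<theta> f b y \<otimes>\<^bsub>K\<^esub> lamps H K E \<sigma> \<theta> f' u y) (lamps H K E \<sigma> \<theta> f'' b y))
            \<le> real (card E) * \<delta>3"
          unfolding f''_def
        proof (rule lamps_almost_mult[OF K gG gH \<theta> \<theta>1 \<theta>mult fh(1) fh(4), where U = U and S = S])
          show "f ` carrier H \<subseteq> U" "f' ` carrier H \<subseteq> U" using fU p pp by auto
          show "h \<otimes>\<^bsub>H\<^esub> w \<in> E" if "w \<in> S" for w using that hh unfolding E_def by auto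
          show "f v = \<one>\<^bsub>G\<^esub>" "f' v = \<one>\<^bsub>G\<^esub>" if "v \<in> carrier H - S" for v
            using that p pp unfolding S_def supp_def by force+
        qed (use E fh inj gd chart A \<delta>3 in auto)
        also have "\<dots> \<le> \<delta>2" by (rule \<delta>32)
        finally have "(\<Sum>y\<in>A. d ((\<kappa> f b \<otimes>\<^bsub>product_group A (\<lambda>_. K)\<^esub> \<kappa> f' u) y) (\<kappa> f'' b y)) \<le> \<delta>2"
          by (simp add: \<kappa>_def)
        moreover have \<kappa>\<kappa>: "\<kappa> f b \<otimes>\<^bsub>product_group A (\<lambda>_. K)\<^esub> \<kappa> f' u \<in> A \<rightarrow>\<^sub>E carrier K"
          using PA.m_closed[of "\<kappa> f b" "\<kappa> f' u"] \<kappa>[OF fh(1)] \<kappa>[OF fh(4)] by (simp only: carrier_product_group)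
        ultimately have "D (T (\<kappa> f b \<otimes>\<^bsub>product_group A (\<lambda>_. K)\<^esub> \<kappa> f' u)) (T (\<kappa> f'' b)) \<le> 3 * sqrt \<delta>2"
          using Tup[rule_format, OF \<kappa>\<kappa> \<kappa>[OF f''], of \<delta>2 b] \<delta>2 by (auto simp del: mult_product_group)
        moreover have "T (\<kappa> f b \<otimes>\<^bsub>product_group A (\<lambda>_. K)\<^esub> \<kappa> f' u) = k a"
          using hom_mult[OF T, unfolded carrier_product_group, OF \<kappa>[OF fh(1), of b] \<kappa>[OF fh(4), of u]] a
          unfolding k_def u_def b_def by simp
        ultimately have "D (k a) (T (\<kappa> f'' b)) \<le> \<delta>1" using \<delta>2 by simp
        moreover have "k a \<in> carrier L" using kV a by (auto simp: carrier_perm_wreath)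
        ultimately have "D (T (\<kappa> f'' b)) (k a) \<le> \<delta>1"
          using dist_sym[OF L, of "k a"] Tc[OF \<kappa>[OF f'', of b]] by simp
        then show ?thesis using eq a by (simp add: u_def b_def compose_eq)
      qed
      have cbad: "card {a\<in>{..<m}. q a \<in> bad} \<le> card bad" if q: "inj_on q {..<m}" for q
        using q by (intro card_inj_on_le[of q]) (auto intro: inj_on_subset simp: bad_def)
      have ih: "inj_on (\<sigma> h') {..<m}" "inj_on (\<lambda>a. \<sigma> h (\<sigma> h' a)) {..<m}"
      proof -
        have "bij_betw (\<sigma> h) {..<m} {..<m}" "bij_betw (\<sigma> h') {..<m} {..<m}"
          using \<sigma> fh by (auto simp: Bij_def)
        then show "inj_on (\<sigma> h') {..<m}" "inj_on (\<lambda>a. \<sigma> h (\<sigma> h' a)) {..<m}"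
          using bij_betw_trans[of "\<sigma> h'" "{..<m}" "{..<m}" "\<sigma> h" "{..<m}"]
          by (auto simp: bij_betw_def o_def)
      qed
      have "card Bad \<le> card bad + card bad + card bad"
        unfolding Bad_def
        using card_Un_le[of "bad \<union> {a\<in>{..<m}. \<sigma> h' a \<in> bad}" "{a\<in>{..<m}. \<sigma> h (\<sigma> h' a) \<in> bad}"]
          card_Un_le[of bad "{a\<in>{..<m}. \<sigma> h' a \<in> bad}"] cbad[OF ih(1)] cbad[OF ih(2)]
        by linarith
      then have "real (card Bad) \<le> 3 * real (card bad)" by linarith
      also have "\<dots> \<le> 3 * (\<eta> * m)" using X by (simp add: bad_def)
      also have "\<dots> \<le> \<delta>1 * m" using \<eta>(2) by (simp add: mult_right_mono flip: mult.assoc)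
      finally have cB: "real (card Bad) \<le> \<delta>1 * m" .
      have finB: "finite Bad" by (auto simp: Bad_def bad_def)
      have "{a\<in>{..<m}. \<sigma> (h \<otimes>\<^bsub>H\<^esub> h') a \<noteq> compose {..<m} (\<sigma> h) (\<sigma> h') a \<or>
          \<delta>1 < D ((\<lambda>a\<in>{..<m}. T (\<kappa> f'' (\<sigma> (h \<otimes>\<^bsub>H\<^esub> h') a))) a) (k a)} \<subseteq> Bad"
      proof
        fix a assume a: "a \<in> {a\<in>{..<m}. \<sigma> (h \<otimes>\<^bsub>H\<^esub> h') a \<noteq> compose {..<m} (\<sigma> h) (\<sigma> h') a \<or>
          \<delta>1 < D ((\<lambda>a\<in>{..<m}. T (\<kappa> f'' (\<sigma> (h \<otimes>\<^bsub>H\<^esub> h') a))) a) (k a)}"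
        show "a \<in> Bad"
        proof (rule ccontr)
          assume "a \<notin> Bad"
          with a close[of a] show False by auto
        qed
      qed
      then have "real (card {a\<in>{..<m}. \<sigma> (h \<otimes>\<^bsub>H\<^esub> h') a \<noteq> compose {..<m} (\<sigma> h) (\<sigma> h') a \<or>
          \<delta>1 < D ((\<lambda>a\<in>{..<m}. T (\<kappa> f'' (\<sigma> (h \<otimes>\<^bsub>H\<^esub> h') a))) a) (k a)}) \<le> \<delta>1 * m"
        using cB card_mono[OF finB] by (meson of_nat_mono order_trans)
      from up[OF less_imp_le[OF \<delta>1(1)] \<delta>1(2) kV'' kV this]
      have "B (\<Psi> (V f'' (h \<otimes>\<^bsub>H\<^esub> h'))) (\<Psi> (V f h \<otimes>\<^bsub>perm_wreath L {..<m}\<^esub> V f' h')) \<le> 3 * sqrt \<delta>1"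
        unfolding VV by (simp only: V_def)
      moreover have "\<Psi> (V f h \<otimes>\<^bsub>perm_wreath L {..<m}\<^esub> V f' h') = \<Theta> p \<otimes>\<^bsub>M\<^esub> \<Theta> p'"
        unfolding \<Theta>_def pp fst_conv snd_conv by (rule hom_mult[OF \<Psi>]) (use V fh in auto)
      ultimately show ?thesis using \<delta>1(3) unfolding prod by (simp add: \<Theta>_def)
    qed
    have inject: "C p \<le> B (\<Theta> p) \<one>\<^bsub>M\<^esub>" if p: "p \<in> F - {\<one>\<^bsub>?W\<^esub>}" for p
    proof -
      obtain f h where pp: "p = (f, h)" by (metis surj_pair)
      have ph: "(f, h) \<in> carrier ?W" using p pp F by auto
      note fh = Fc[OF ph]
      have cX: "1 / 2 * real m \<le> real (card X)"
      proof -
        have "real (card ({..<m} - X)) = m - real (card X)"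
          using X card_mono[OF _ X(1)] by (simp add: card_Diff_subset finite_subset[OF X(1)] of_nat_diff)
        moreover have "\<eta> * real m \<le> 1 / 2 * real m" using \<eta> by (intro mult_right_mono) auto
        ultimately show ?thesis using X(2) by linarith
      qed
      have finite_card: "card X \<le> card {b\<in>{..<m}. P b}" if "\<And>x. x \<in> X \<Longrightarrow> P x" for P
        using that X by (intro card_mono) auto
      show ?thesis
      proof (cases "h = \<one>\<^bsub>H\<^esub>")
        case False
        have "h \<in> Dm" using p pp unfolding Dm_def Hs_def by force
        then have "card X \<le> card {b\<in>{..<m}. \<sigma> h b \<noteq> b}"
          using good False by (intro finite_card) auto
        then have "1 / 2 * real m \<le> real (card {b\<in>{..<m}. \<sigma> h b \<noteq> b})" using cX by linarith
        then have "1 / 6 \<le> real (card {b\<in>{..<m}. \<sigma> h b \<noteq> b}) / (3 * real m)"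
          using m by (simp add: field_simps)
        also have "\<dots> \<le> B (\<Theta> p) \<one>\<^bsub>M\<^esub>"
          using low1[OF V[OF fh(1,3), unfolded V_def]] unfolding \<Theta>_def pp V_def by simp
        finally show ?thesis using False by (simp add: C_def pp)
      next
        case True
        define v where "v = pos f"
        have "(f, \<one>\<^bsub>H\<^esub>) \<in> carrier ?W - {\<one>\<^bsub>?W\<^esub>}" using p pp True ph by auto
        from pos[OF this] have v: "v \<in> carrier H" "f v \<in> carrier G - {\<one>\<^bsub>G\<^esub>}" by (simp_all add: v_def)
        have "v \<in> S" using v p pp unfolding S_def supp_def by force
        then have vE: "v \<in> E" using E by auto
        define t where "t = c (f v)"
        have t: "0 < t" "t \<le> 1" using c[OF v(2)] by (auto simp: t_def)
        have "f v \<in> U" using fU[of f h] p pp v by auto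
        then have td: "t \<le> d (\<theta> (f v)) \<one>\<^bsub>K\<^esub>"
          using \<theta>i v min.coboundedI2 unfolding injective_map_def t_def c_def by blast
        have low: "t / 4 \<le> D (T (\<kappa> f x)) \<one>\<^bsub>L\<^esub>" if x: "x \<in> X" for x
        proof -
          define y where "y = \<sigma> (inv\<^bsub>H\<^esub> v) x"
          have y: "y \<in> A" using \<sigma>in[of "inv\<^bsub>H\<^esub> v" x] v x X by (auto simp: y_def A_def)
          have "\<kappa> f x y = \<theta> (f v)"
            using y lamps_at[where \<sigma> = \<sigma> and H = H, OF inj[OF x] vE] by (simp add: \<kappa>_def y_def)
          then show ?thesis using Tlow \<kappa>[OF fh(1), of x] y t td by auto
        qed
        define k where "k = (\<lambda>a\<in>{..<m}. T (\<kappa> f a))"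
        have kE: "k \<in> {..<m} \<rightarrow>\<^sub>E carrier L"
          unfolding k_def restrict_PiE_iff using Tc[OF \<kappa>[OF fh(1)]] by blast
        have "V f h = (k, \<lambda>b\<in>{..<m}. b)"
          unfolding V_def True \<sigma>1 k_def by (auto intro!: restrict_ext)
        then have \<Theta>p: "\<Theta> p = \<Psi> (k, \<lambda>b\<in>{..<m}. b)" by (simp add: \<Theta>_def pp)
        have "card X \<le> card {b\<in>{..<m}. t / 4 \<le> D (k b) \<one>\<^bsub>L\<^esub>}"
          using low X by (intro finite_card) (auto simp: k_def)
        then have "1 / 2 * real m \<le> real (card {b\<in>{..<m}. t / 4 \<le> D (k b) \<one>\<^bsub>L\<^esub>})" using cX by linarith
        then have "1 / 2 \<le> real (card {b\<in>{..<m}. t / 4 \<le> D (k b) \<one>\<^bsub>L\<^esub>}) / real m"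
          using m by (simp add: field_simps)
        then have "t / 4 * (1 / 2) \<le> t / 4 * (real (card {b\<in>{..<m}. t / 4 \<le> D (k b) \<one>\<^bsub>L\<^esub>}) / real m)"
          using t by (intro mult_left_mono) auto
        also have "\<dots> \<le> B (\<Theta> p) \<one>\<^bsub>M\<^esub>"
          unfolding \<Theta>p using t kE by (intro low2) auto
        finally show ?thesis using True by (simp add: C_def pp t_def v_def)
      qed
    qed
    have "multiplicative_map ?W M F \<epsilon> B \<Theta>" "injective_map ?W M F C B \<Theta>"
      using \<Theta>1 mult inject unfolding multiplicative_map_def injective_map_def by blast+
    then show ?thesis using M \<Theta> by blast
  qed
  show ?thesis
    unfolding approximable_def using W.group_axioms Cpos main by blast
qed

section \<open>Metrics that average over blocks\<close>

lemma le_two_sqrt_average: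
  fixes e :: "nat \<Rightarrow> real"
  assumes m: "0 < m" and e: "\<And>b. b < m \<Longrightarrow> 0 \<le> e b \<and> e b \<le> 1" and x: "x \<le> (\<Sum>b<m. e b) / m"
  shows "x \<le> 2 * sqrt ((\<Sum>b<m. e b) / m)"
proof -
  define a where "a = (\<Sum>b<m. e b) / m"
  have "(\<Sum>b<m. e b) \<le> (\<Sum>b<m. 1)" using e by (intro sum_mono) auto
  moreover have "0 \<le> (\<Sum>b<m. e b)" using e by (intro sum_nonneg) auto
  ultimately have a: "0 \<le> a" "a \<le> 1" using m by (simp_all add: a_def)
  have "sqrt a * sqrt a \<le> sqrt a * 1" using a by (intro mult_left_mono) auto
  then have "a \<le> 2 * sqrt a" using a by simp
  then show ?thesis using x by (simp add: a_def)
qed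

text \<open>
  For metrics that are comparable to an average over the blocks. The average of the truncated
  distances is at most twice \<open>\<delta>\<close> if at most the proportion \<open>\<delta>\<close> of the blocks is off by more than
  \<open>\<delta>\<close>; by Markov's inequality it is at least \<open>t\<close> times the proportion of the blocks at distance
  \<open>t\<close> or more.
\<close>

lemma monomial_hom_of_average_bounds:
  assumes m: "0 < m" and \<Psi>: "\<Psi> \<in> hom (perm_wreath K {..<m}) M"
    and up: "\<And>k p k' p'. (k, p) \<in> carrier (perm_wreath K {..<m}) \<Longrightarrow> (k', p') \<in> carrier (perm_wreath K {..<m}) \<Longrightarrow>
      D (\<Psi> (k, p)) (\<Psi> (k', p')) \<le> 2 * sqrt ((\<Sum>b<m. if p b = p' b then min 1 (d (k b) (k' b)) else 1) / real m)"
    and moved: "\<And>k p. (k, p) \<in> carrier (perm_wreath K {..<m}) \<Longrightarrow>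
      real (card {b\<in>{..<m}. p b \<noteq> b}) / (3 * real m) \<le> D (\<Psi> (k, p)) \<one>\<^bsub>M\<^esub>"
    and diag: "\<And>k. k \<in> {..<m} \<rightarrow>\<^sub>E carrier K \<Longrightarrow>
      (\<Sum>b<m. min 1 (d (k b) \<one>\<^bsub>K\<^esub>)) / real m \<le> D (\<Psi> (k, \<lambda>b\<in>{..<m}. b)) \<one>\<^bsub>M\<^esub>"
    and nonneg: "\<And>x. x \<in> carrier K \<Longrightarrow> 0 \<le> d x \<one>\<^bsub>K\<^esub>"
  shows "monomial_hom m (K, d) (M, D) \<Psi>"
  unfolding monomial_hom_def prod.case
proof (intro conjI allI impI; (elim conjE)?)
  let ?PW = "perm_wreath K {..<m}"
  fix \<delta> k p k' p'
  assume \<delta>: "0 \<le> \<delta>" "\<delta> \<le> (1::real)" and kp: "(k, p) \<in> carrier ?PW" "(k', p') \<in> carrier ?PW"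
    and bad: "real (card {b\<in>{..<m}. p b \<noteq> p' b \<or> \<delta> < d (k b) (k' b)}) \<le> \<delta> * real m"
  define N where "N = {b\<in>{..<m}. p b \<noteq> p' b \<or> \<delta> < d (k b) (k' b)}"
  have "(\<Sum>b<m. if p b = p' b then min 1 (d (k b) (k' b)) else 1) \<le> (\<Sum>b<m. (if b \<in> N then 1 else 0) + \<delta>)"
    using \<delta> by (intro sum_mono) (auto simp: N_def)
  also have "\<dots> = real (card N) + \<delta> * m"
    by (simp add: sum.distrib sum.If_cases N_def Int_def)
  also have "\<dots> \<le> 2 * \<delta> * m" using bad by (simp add: N_def)
  finally have "(\<Sum>b<m. if p b = p' b then min 1 (d (k b) (k' b)) else 1) / real m \<le> 2 * \<delta>"
    using m by (simp add: field_simps)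
  then have "2 * sqrt ((\<Sum>b<m. if p b = p' b then min 1 (d (k b) (k' b)) else 1) / real m) \<le> 2 * sqrt (2 * \<delta>)"
    by simp
  also have "\<dots> = sqrt (8 * \<delta>)" using real_sqrt_mult[of 4 "2 * \<delta>"] by simp
  also have "\<dots> \<le> sqrt (9 * \<delta>)" using \<delta> by (intro real_sqrt_le_mono) auto
  also have "\<dots> = 3 * sqrt \<delta>" by (simp add: real_sqrt_mult)
  finally show "D (\<Psi> (k, p)) (\<Psi> (k', p')) \<le> 3 * sqrt \<delta>" using up[OF kp] by linarith
next
  fix k p assume "(k, p) \<in> carrier (perm_wreath K {..<m})"
  then show "real (card {b\<in>{..<m}. p b \<noteq> b}) / (3 * real m) \<le> D (\<Psi> (k, p)) \<one>\<^bsub>M\<^esub>" by (rule moved)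
next
  fix k and t :: real
  assume k: "k \<in> {..<m} \<rightarrow>\<^sub>E carrier K" and t: "0 \<le> t" "t \<le> 1"
  have "t * real (card {b\<in>{..<m}. t \<le> d (k b) \<one>\<^bsub>K\<^esub>}) = (\<Sum>b<m. if t \<le> d (k b) \<one>\<^bsub>K\<^esub> then t else 0)"
    by (simp add: sum.If_cases Int_def)
  also have "\<dots> \<le> (\<Sum>b<m. min 1 (d (k b) \<one>\<^bsub>K\<^esub>))"
    using t nonneg PiE_mem[OF k] by (intro sum_mono) auto
  finally have "t * (real (card {b\<in>{..<m}. t \<le> d (k b) \<one>\<^bsub>K\<^esub>}) / real m) \<le> (\<Sum>b<m. min 1 (d (k b) \<one>\<^bsub>K\<^esub>)) / real m"
    unfolding times_divide_eq_right by (intro divide_right_mono) auto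
  then show "t * (real (card {b\<in>{..<m}. t \<le> d (k b) \<one>\<^bsub>K\<^esub>}) / real m)
      \<le> D (\<Psi> (k, \<lambda>b\<in>{..<m}. b)) \<one>\<^bsub>M\<^esub>"
    using diag[OF k] by linarith
qed (rule \<Psi>)

lemma monomial_hom_average:
  assumes K: "group K" and M: "group M" and m: "0 < m" and \<Psi>: "\<Psi> \<in> hom (perm_wreath K {..<m}) M"
    and avg: "\<And>k p k' p'. (k, p) \<in> carrier (perm_wreath K {..<m}) \<Longrightarrow> (k', p') \<in> carrier (perm_wreath K {..<m}) \<Longrightarrow>
      D (\<Psi> (k, p)) (\<Psi> (k', p')) = (\<Sum>b<m. if p b = p' b then min 1 (d (k b) (k' b)) else 1) / real m"
    and nonneg: "\<And>x y. 0 \<le> d x y"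
  shows "monomial_hom m (K, d) (M, D) \<Psi>"
proof (rule monomial_hom_of_average_bounds[OF m \<Psi>])
  let ?PW = "perm_wreath K {..<m}"
  have PW: "group ?PW" by (rule group_perm_wreath[OF K])
  have one: "(\<lambda>b\<in>{..<m}. \<one>\<^bsub>K\<^esub>, \<lambda>b\<in>{..<m}. b) \<in> carrier ?PW"
    using monoid.one_closed[OF group.is_monoid[OF PW]] by (simp only: one_perm_wreath)
  have avg1: "D (\<Psi> (k, p)) \<one>\<^bsub>M\<^esub> = (\<Sum>b<m. if p b = b then min 1 (d (k b) \<one>\<^bsub>K\<^esub>) else 1) / real m"
    if "(k, p) \<in> carrier ?PW" for k p
    unfolding hom_one[OF \<Psi> PW M, symmetric] one_perm_wreath avg[OF that one]
    by (intro arg_cong[of _ _ "\<lambda>x. x / real m"] sum.cong) auto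
  show "D (\<Psi> (k, p)) (\<Psi> (k', p')) \<le> 2 * sqrt ((\<Sum>b<m. if p b = p' b then min 1 (d (k b) (k' b)) else 1) / real m)"
    if "(k, p) \<in> carrier ?PW" "(k', p') \<in> carrier ?PW" for k p k' p'
    by (rule le_two_sqrt_average[OF m]) (use avg[OF that] nonneg in auto)
  show "real (card {b\<in>{..<m}. p b \<noteq> b}) / (3 * real m) \<le> D (\<Psi> (k, p)) \<one>\<^bsub>M\<^esub>"
    if kp: "(k, p) \<in> carrier ?PW" for k p
  proof -
    have "real (card {b\<in>{..<m}. p b \<noteq> b}) = (\<Sum>b<m. if p b = b then 0 else 1)"
      by (simp add: sum.If_cases Int_def)
    also have "\<dots> \<le> (\<Sum>b<m. if p b = b then min 1 (d (k b) \<one>\<^bsub>K\<^esub>) else 1)"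
      using nonneg by (intro sum_mono) auto
    finally have 1: "real (card {b\<in>{..<m}. p b \<noteq> b}) / m \<le> D (\<Psi> (k, p)) \<one>\<^bsub>M\<^esub>"
      unfolding avg1[OF kp] by (intro divide_right_mono) auto
    have "real (card {b\<in>{..<m}. p b \<noteq> b}) / (3 * m) \<le> real (card {b\<in>{..<m}. p b \<noteq> b}) / m"
      using m by (intro divide_left_mono) auto
    with 1 show ?thesis by linarith
  qed
  show "(\<Sum>b<m. min 1 (d (k b) \<one>\<^bsub>K\<^esub>)) / real m \<le> D (\<Psi> (k, \<lambda>b\<in>{..<m}. b)) \<one>\<^bsub>M\<^esub>"
    if k: "k \<in> {..<m} \<rightarrow>\<^sub>E carrier K" for k
  proof -
    have "(k, \<lambda>b\<in>{..<m}. b) \<in> carrier ?PW" using k by (auto simp: carrier_perm_wreath id_Bij)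
    then show ?thesis by (simp add: avg1)
  qed
qed (rule nonneg)

section \<open>Symmetric groups\<close>

lemma hamming_agree:
  assumes "finite A" "A \<noteq> {}"
  shows "1 - hamming_dist A p q = real (card {a\<in>A. p a = q a}) / real (card A)"
proof -
  have "card A = card {a\<in>A. p a = q a} + card {a\<in>A. p a \<noteq> q a}"
    using assms by (subst card_Un_disjoint[symmetric]) (auto intro!: arg_cong[of _ _ card])
  then have "real (card {a\<in>A. p a = q a}) = real (card A) - real (card {a\<in>A. p a \<noteq> q a})" by simp
  moreover have "card A > 0" using assms by (simp add: card_gt_0_iff)
  ultimately show ?thesis unfolding hamming_dist_def by (simp add: diff_divide_distrib)
qed

lemma hamming_nonneg: "0 \<le> hamming_dist A p q"
  by (simp add: hamming_dist_def)

lemma hamming_le_1: "finite A \<Longrightarrow> hamming_dist A p q \<le> 1"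
proof (cases "card A = 0")
  case False
  assume "finite A"
  then have "card {a\<in>A. p a \<noteq> q a} \<le> card A" by (intro card_mono) auto
  then show ?thesis unfolding hamming_dist_def using False by simp
qed (simp add: hamming_dist_def)

lemma pseudometric_hamming:
  assumes "finite A"
  shows "pseudometric_on X (hamming_dist A)"
proof -
  have "hamming_dist A x z \<le> hamming_dist A x y + hamming_dist A y z" for x y z
  proof -
    have "card {a\<in>A. x a \<noteq> z a} \<le> card ({a\<in>A. x a \<noteq> y a} \<union> {a\<in>A. y a \<noteq> z a})"
      using assms by (intro card_mono) auto
    also have "\<dots> \<le> card {a\<in>A. x a \<noteq> y a} + card {a\<in>A. y a \<noteq> z a}" by (rule card_Un_le)
    finally show ?thesis
      unfolding hamming_dist_def by (simp add: divide_right_mono flip: add_divide_distrib of_nat_add)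
  qed
  moreover have "hamming_dist A x y = hamming_dist A y x" for x y
    unfolding hamming_dist_def by (simp add: eq_commute)
  ultimately show ?thesis by (auto simp: pseudometric_on_def hamming_dist_def)
qed

lemma carrier_BijGroup: "carrier (BijGroup A) = Bij A"
  by (simp add: BijGroup_def)

lemma Bij_finiteI:
  assumes "finite A" "p \<in> A \<rightarrow>\<^sub>E A" "inj_on p A"
  shows "p \<in> Bij A"
  using assms endo_inj_surj[of A p] by (auto simp: Bij_def bij_betw_def PiE_iff)

text \<open>
  Products of sets of numbers are turned into sets of numbers by a pairing function; this carries the
  permutations along.
\<close>

definition relabel :: "('x \<Rightarrow> 'y) \<Rightarrow> 'x set \<Rightarrow> ('x \<Rightarrow> 'x) \<Rightarrow> 'y \<Rightarrow> 'y" where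
  "relabel e Z p = (\<lambda>y\<in>e ` Z. e (p (inv_into Z e y)))"

lemma relabel_apply: "inj_on e Z \<Longrightarrow> z \<in> Z \<Longrightarrow> relabel e Z p (e z) = e (p z)"
  by (simp add: relabel_def)

lemma relabel_hom:
  assumes e: "inj_on e Z" and Z: "finite Z"
  shows "relabel e Z \<in> hom (BijGroup Z) (BijGroup (e ` Z))"
proof (rule homI)
  have B: "relabel e Z p \<in> Bij (e ` Z)" if p: "p \<in> Bij Z" for p
  proof (rule Bij_finiteI)
    show "relabel e Z p \<in> e ` Z \<rightarrow>\<^sub>E e ` Z"
      using p e Bij_in[OF p] by (auto simp: relabel_def)
    show "inj_on (relabel e Z p) (e ` Z)"
    proof (rule inj_onI)
      fix x y assume xy: "x \<in> e ` Z" "y \<in> e ` Z" "relabel e Z p x = relabel e Z p y"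
      then obtain u v where uv: "u \<in> Z" "v \<in> Z" "x = e u" "y = e v" by blast
      then have "e (p u) = e (p v)" using xy by (simp add: relabel_apply[OF e])
      then have "p u = p v" using inj_onD[OF e] Bij_in[OF p] uv by blast
      then show "x = y" using Bij_inj[OF p] uv by blast
    qed
  qed (use Z in simp)
  show "relabel e Z p \<in> carrier (BijGroup (e ` Z))" if "p \<in> carrier (BijGroup Z)" for p
    using that B by (simp add: carrier_BijGroup)
  fix p q assume "p \<in> carrier (BijGroup Z)" "q \<in> carrier (BijGroup Z)"
  then have pq: "p \<in> Bij Z" "q \<in> Bij Z" by (auto simp: carrier_BijGroup)
  have "p \<otimes>\<^bsub>BijGroup Z\<^esub> q \<in> Bij Z" using pq by (simp add: BijGroup_def compose_Bij)
  moreover have "relabel e Z p \<otimes>\<^bsub>BijGroup (e ` Z)\<^esub> relabel e Z q \<in> Bij (e ` Z)"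
    using B[OF pq(1)] B[OF pq(2)] by (simp add: BijGroup_def compose_Bij)
  ultimately show "relabel e Z (p \<otimes>\<^bsub>BijGroup Z\<^esub> q) = relabel e Z p \<otimes>\<^bsub>BijGroup (e ` Z)\<^esub> relabel e Z q"
    using pq e B Bij_in[OF pq(2)]
    by (intro Bij_ext[of _ "e ` Z"] B) (auto simp: BijGroup_mult_apply relabel_apply)
qed

lemma hamming_relabel:
  assumes e: "inj_on e Z" and pq: "p \<in> Bij Z" "q \<in> Bij Z"
  shows "hamming_dist (e ` Z) (relabel e Z p) (relabel e Z q) = hamming_dist Z p q"
proof -
  have "{y\<in>e ` Z. relabel e Z p y \<noteq> relabel e Z q y} = e ` {z\<in>Z. p z \<noteq> q z}"
    using e Bij_in[OF pq(1)] Bij_in[OF pq(2)] by (auto simp: relabel_apply[OF e] inj_on_eq_iff[OF e])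
  then show ?thesis
    unfolding hamming_dist_def using e
    by (simp add: card_image inj_on_subset[OF e])
qed

definition symmetric_groups :: "((nat \<Rightarrow> nat) monoid \<times> ((nat \<Rightarrow> nat) \<Rightarrow> (nat \<Rightarrow> nat) \<Rightarrow> real)) set" where
  "symmetric_groups = {(BijGroup A, hamming_dist A) | A. finite A \<and> A \<noteq> {}}"

text \<open>
  The product action on \<open>A \<times> B\<close>: two product permutations agree at a pair iff they agree at both
  entries, so the proportions of agreement multiply.
\<close>

lemma symmetric_product:
  assumes A: "finite (A::nat set)" "A \<noteq> {}" and B: "finite (B::nat set)" "B \<noteq> {}"
  shows "\<exists>C::nat set. finite C \<and> C \<noteq> {} \<and> (\<exists>T\<in>hom (BijGroup A \<times>\<times> BijGroup B) (BijGroup C).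
    \<forall>p\<in>Bij A. \<forall>p'\<in>Bij A. \<forall>q\<in>Bij B. \<forall>q'\<in>Bij B.
      1 - hamming_dist C (T (p, q)) (T (p', q')) = (1 - hamming_dist A p p') * (1 - hamming_dist B q q'))"
proof -
  define Z where "Z = A \<times> B"
  have Z: "finite Z" "Z \<noteq> {}" using A B by (auto simp: Z_def)
  have inj: "inj_on prod_encode Z" by (rule inj_prod_encode)
  define P where "P = (\<lambda>(p, q). \<lambda>(x, y)\<in>Z. (p x, q y) :: nat \<times> nat)"
  have Pz: "P (p, q) (x, y) = (p x, q y)" if "x \<in> A" "y \<in> B" for p q x y
    using that by (simp add: P_def Z_def)
  have PB: "P (p, q) \<in> Bij Z" if "p \<in> Bij A" "q \<in> Bij B" for p q
  proof (rule Bij_finiteI)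
    show "P (p, q) \<in> Z \<rightarrow>\<^sub>E Z"
      using that by (auto simp: P_def Z_def Bij_in)
    show "inj_on (P (p, q)) Z"
      using Bij_inj[OF that(1)] Bij_inj[OF that(2)] by (auto simp: inj_on_def Z_def Pz)
  qed (rule Z)
  have P: "P \<in> hom (BijGroup A \<times>\<times> BijGroup B) (BijGroup Z)"
  proof (rule homI)
    show "P pq \<in> carrier (BijGroup Z)" if "pq \<in> carrier (BijGroup A \<times>\<times> BijGroup B)" for pq
      using that PB by (cases pq) (auto simp: carrier_BijGroup)
    fix u v assume "u \<in> carrier (BijGroup A \<times>\<times> BijGroup B)" "v \<in> carrier (BijGroup A \<times>\<times> BijGroup B)"
    then obtain p q p' q' where uv: "u = (p, q)" "v = (p', q')" "p \<in> Bij A" "q \<in> Bij B" "p' \<in> Bij A" "q' \<in> Bij B"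
      by (auto simp: carrier_BijGroup)
    have c: "p \<otimes>\<^bsub>BijGroup A\<^esub> p' \<in> Bij A" "q \<otimes>\<^bsub>BijGroup B\<^esub> q' \<in> Bij B"
      using uv by (simp_all add: BijGroup_def compose_Bij)
    have "P (p \<otimes>\<^bsub>BijGroup A\<^esub> p', q \<otimes>\<^bsub>BijGroup B\<^esub> q') = P (p, q) \<otimes>\<^bsub>BijGroup Z\<^esub> P (p', q')"
    proof (rule Bij_ext[OF PB[OF c]])
      show "P (p, q) \<otimes>\<^bsub>BijGroup Z\<^esub> P (p', q') \<in> Bij Z"
        using PB uv by (simp add: BijGroup_def compose_Bij)
      fix z assume z: "z \<in> Z"
      then obtain x y where xy: "z = (x, y)" "x \<in> A" "y \<in> B" by (auto simp: Z_def)
      show "P (p \<otimes>\<^bsub>BijGroup A\<^esub> p', q \<otimes>\<^bsub>BijGroup B\<^esub> q') z = (P (p, q) \<otimes>\<^bsub>BijGroup Z\<^esub> P (p', q')) z"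
        using xy uv z by (simp add: BijGroup_mult_apply PB Pz Bij_in)
    qed
    then show "P (u \<otimes>\<^bsub>BijGroup A \<times>\<times> BijGroup B\<^esub> v) = P u \<otimes>\<^bsub>BijGroup Z\<^esub> P v" by (simp add: uv)
  qed
  have ham: "1 - hamming_dist Z (P (p, q)) (P (p', q')) = (1 - hamming_dist A p p') * (1 - hamming_dist B q q')"
    for p p' q q'
  proof -
    have "{z\<in>Z. P (p, q) z = P (p', q') z} = {x\<in>A. p x = p' x} \<times> {y\<in>B. q y = q' y}"
      by (auto simp: Z_def Pz)
    then have "card {z\<in>Z. P (p, q) z = P (p', q') z} = card {x\<in>A. p x = p' x} * card {y\<in>B. q y = q' y}"
      by (simp add: card_cartesian_product)
    moreover have "card Z = card A * card B" by (simp add: Z_def card_cartesian_product)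
    ultimately show ?thesis by (simp add: hamming_agree[OF Z] hamming_agree[OF A] hamming_agree[OF B])
  qed
  show ?thesis
  proof (intro exI conjI bexI ballI)
    show "relabel prod_encode Z \<circ> P \<in> hom (BijGroup A \<times>\<times> BijGroup B) (BijGroup (prod_encode ` Z))"
      using P relabel_hom[OF inj Z(1)] by (rule hom_compose)
    fix p p' q q' assume "p \<in> Bij A" "p' \<in> Bij A" "q \<in> Bij B" "q' \<in> Bij B"
    then show "1 - hamming_dist (prod_encode ` Z) ((relabel prod_encode Z \<circ> P) (p, q)) ((relabel prod_encode Z \<circ> P) (p', q'))
       = (1 - hamming_dist A p p') * (1 - hamming_dist B q q')"
      using ham by (simp add: hamming_relabel[OF inj] PB)
  qed (use Z in auto)
qed

text \<open>
  The imprimitive action on \<open>m\<close> copies of \<open>A\<close>, in which \<open>p\<close> permutes the copies. Its Hamming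
  distance is the average over the copies.
\<close>

lemma symmetric_monomial:
  assumes A: "finite (A::nat set)" "A \<noteq> {}" and m: "0 < m"
  shows "\<exists>C \<Psi>. finite C \<and> C \<noteq> {} \<and>
    monomial_hom m (BijGroup A, hamming_dist A) (BijGroup C, hamming_dist C) \<Psi>"
proof -
  let ?PW = "perm_wreath (BijGroup A) {..<m}"
  define Z where "Z = {..<m} \<times> A"
  have Z: "finite Z" "Z \<noteq> {}" using A m by (auto simp: Z_def)
  have cZ: "real (card Z) = real m * real (card A)" by (simp add: Z_def card_cartesian_product)
  have cA: "0 < real (card A)" using A by (simp add: card_gt_0_iff)
  have inj: "inj_on prod_encode Z" by (rule inj_prod_encode)
  define P where "P = (\<lambda>(k, p). \<lambda>(b, x)\<in>Z. (p b, k b x) :: nat \<times> nat)"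
  have Pz: "P (k, p) (b, x) = (p b, k b x)" if "b < m" "x \<in> A" for k p b x
    using that by (simp add: P_def Z_def)
  have PB: "P (k, p) \<in> Bij Z" if "(k, p) \<in> carrier ?PW" for k p
  proof -
    have kp: "p \<in> Bij {..<m}" "\<And>b. b < m \<Longrightarrow> k b \<in> Bij A"
      using that by (auto simp: carrier_perm_wreath carrier_BijGroup)
    show ?thesis
    proof (rule Bij_finiteI)
      show "P (k, p) \<in> Z \<rightarrow>\<^sub>E Z"
        using Bij_in[OF kp(1)] Bij_in[OF kp(2)] by (auto simp: P_def Z_def)
      show "inj_on (P (k, p)) Z"
        using Bij_inj[OF kp(1)] Bij_inj[OF kp(2)] by (fastforce simp: inj_on_def Z_def Pz)
    qed (rule Z)
  qed
  have PW: "group ?PW" by (intro group_perm_wreath group_BijGroup)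
  have P: "P \<in> hom ?PW (BijGroup Z)"
  proof (rule homI)
    show "P u \<in> carrier (BijGroup Z)" if "u \<in> carrier ?PW" for u
      using that PB by (cases u) (auto simp: carrier_BijGroup)
    fix u v assume uv: "u \<in> carrier ?PW" "v \<in> carrier ?PW"
    obtain k p k' p' where u: "u = (k, p)" "v = (k', p')" by (metis surj_pair)
    have kp: "p \<in> Bij {..<m}" "\<And>b. b < m \<Longrightarrow> k b \<in> Bij A" "p' \<in> Bij {..<m}" "\<And>b. b < m \<Longrightarrow> k' b \<in> Bij A"
      using uv u by (auto simp: carrier_perm_wreath carrier_BijGroup)
    have c: "u \<otimes>\<^bsub>?PW\<^esub> v \<in> carrier ?PW" using PW uv by (simp add: group.is_monoid monoid.m_closed)
    show "P (u \<otimes>\<^bsub>?PW\<^esub> v) = P u \<otimes>\<^bsub>BijGroup Z\<^esub> P v"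
    proof (rule Bij_ext)
      show "P (u \<otimes>\<^bsub>?PW\<^esub> v) \<in> Bij Z" using c PB by (metis surj_pair)
      show "P u \<otimes>\<^bsub>BijGroup Z\<^esub> P v \<in> Bij Z"
        using PB uv u by (simp add: BijGroup_def compose_Bij)
      fix z assume z: "z \<in> Z"
      then obtain b x where bx: "z = (b, x)" "b < m" "x \<in> A" by (auto simp: Z_def)
      show "P (u \<otimes>\<^bsub>?PW\<^esub> v) z = (P u \<otimes>\<^bsub>BijGroup Z\<^esub> P v) z"
        using bx u z uv kp(4)[OF bx(2)] Bij_in[OF kp(3), of b] kp(2)
        by (simp add: BijGroup_mult_apply PB Pz Bij_in mult_perm_wreath compose_eq)
    qed
  qed
  have dist: "hamming_dist Z (P (k, p)) (P (k', p'))
      = (\<Sum>b<m. if p b = p' b then hamming_dist A (k b) (k' b) else 1) / real m" for k p k' p'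
  proof -
    have "{z\<in>Z. P (k, p) z \<noteq> P (k', p') z} = (SIGMA b:{..<m}. {x\<in>A. p b \<noteq> p' b \<or> k b x \<noteq> k' b x})"
      by (auto simp: Z_def Pz)
    then have "card {z\<in>Z. P (k, p) z \<noteq> P (k', p') z} = (\<Sum>b<m. card {x\<in>A. p b \<noteq> p' b \<or> k b x \<noteq> k' b x})"
      using A by (simp add: card_SigmaI)
    then have "hamming_dist Z (P (k, p)) (P (k', p'))
      = (\<Sum>b<m. real (card {x\<in>A. p b \<noteq> p' b \<or> k b x \<noteq> k' b x})) / (real (card A) * real m)"
      unfolding hamming_dist_def cZ by (simp add: mult.commute)
    also have "\<dots> = (\<Sum>b<m. real (card {x\<in>A. p b \<noteq> p' b \<or> k b x \<noteq> k' b x}) / real (card A)) / real m"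
      by (simp add: sum_divide_distrib)
    also have "\<dots> = (\<Sum>b<m. if p b = p' b then hamming_dist A (k b) (k' b) else 1) / real m"
      using cA by (intro arg_cong[of _ _ "\<lambda>x. x / real m"] sum.cong) (auto simp: hamming_dist_def)
    finally show ?thesis .
  qed
  show ?thesis
  proof (intro exI conjI)
    let ?C = "prod_encode ` Z"
    let ?\<Psi> = "relabel prod_encode Z \<circ> P"
    have \<Psi>: "?\<Psi> \<in> hom ?PW (BijGroup ?C)"
      using P relabel_hom[OF inj Z(1)] by (rule hom_compose)
    have d\<Psi>: "hamming_dist ?C (?\<Psi> (k, p)) (?\<Psi> (k', p')) = (\<Sum>b<m. if p b = p' b then hamming_dist A (k b) (k' b) else 1) / real m"
      if "(k, p) \<in> carrier ?PW" "(k', p') \<in> carrier ?PW" for k p k' p'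
      unfolding dist[symmetric] o_apply by (rule hamming_relabel[OF inj PB[OF that(1)] PB[OF that(2)]])
    show "monomial_hom m (BijGroup A, hamming_dist A) (BijGroup ?C, hamming_dist ?C) ?\<Psi>"
      by (rule monomial_hom_average[OF group_BijGroup group_BijGroup m \<Psi>])
        (simp_all only: d\<Psi> min_absorb2[OF hamming_le_1[OF A(1)]] hamming_nonneg)
  qed (use Z in auto)
qed

lemma wreath_closed_symmetric_groups: "wreath_closed symmetric_groups"
proof (rule wreath_closed.intro)
  fix K :: "(nat \<Rightarrow> nat) monoid" and d assume "(K, d) \<in> symmetric_groups"
  then obtain A where A: "finite A" "A \<noteq> {}" and K: "K = BijGroup A" "d = hamming_dist A"
    by (auto simp: symmetric_groups_def)
  show "group K" unfolding K by (rule group_BijGroup)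
  show "pseudometric_on (carrier K) d" unfolding K by (rule pseudometric_hamming[OF A(1)])
  show "\<exists>M D \<Psi>. (M, D) \<in> symmetric_groups \<and> monomial_hom m (K, d) (M, D) \<Psi>" if "0 < m" for m
    using symmetric_monomial[OF A that] unfolding K symmetric_groups_def by blast
next
  fix K1 K2 :: "(nat \<Rightarrow> nat) monoid" and d1 d2
  assume "(K1, d1) \<in> symmetric_groups" "(K2, d2) \<in> symmetric_groups"
  then obtain A B where A: "finite A" "A \<noteq> {}" and K1: "K1 = BijGroup A" "d1 = hamming_dist A"
    and B: "finite B" "B \<noteq> {}" and K2: "K2 = BijGroup B" "d2 = hamming_dist B"
    by (auto simp: symmetric_groups_def)
  obtain C T where C: "finite (C::nat set)" "C \<noteq> {}" and T: "T \<in> hom (BijGroup A \<times>\<times> BijGroup B) (BijGroup C)"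
    and *: "\<forall>p\<in>Bij A. \<forall>p'\<in>Bij A. \<forall>q\<in>Bij B. \<forall>q'\<in>Bij B.
      1 - hamming_dist C (T (p, q)) (T (p', q')) = (1 - hamming_dist A p p') * (1 - hamming_dist B q q')"
    using symmetric_product[OF A B] by (elim exE conjE bexE)
  have [simp]: "hamming_dist A p p = 0" "hamming_dist B p p = 0" for p by (simp_all add: hamming_dist_def)
  have "hamming_dist C (T (p, q)) (T (p', q)) = hamming_dist A p p'"
    "hamming_dist C (T (p, q)) (T (p, q')) = hamming_dist B q q'"
    if "p \<in> Bij A" "p' \<in> Bij A" "q \<in> Bij B" "q' \<in> Bij B" for p p' q q'
    using *[rule_format, of p p' q q] *[rule_format, of p p q q'] that by simp_all
  then have "tensor_hom (K1, d1) (K2, d2) (BijGroup C, hamming_dist C) T"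
    using T unfolding tensor_hom_def K1 K2 by (auto simp: carrier_BijGroup)
  then show "\<exists>L d T. (L, d) \<in> symmetric_groups \<and> tensor_hom (K1, d1) (K2, d2) (L, d) T"
    using C unfolding symmetric_groups_def by blast
qed

lemma symmetric_power:
  assumes A: "finite (A::nat set)" "A \<noteq> {}"
  shows "\<exists>B::nat set. finite B \<and> B \<noteq> {} \<and> (\<exists>T\<in>hom (BijGroup A) (BijGroup B).
    \<forall>p\<in>Bij A. \<forall>q\<in>Bij A. 1 - hamming_dist B (T p) (T q) = (1 - hamming_dist A p q) ^ n)"
proof (induction n)
  case 0
  interpret G: group "BijGroup {0::nat}" by (rule group_BijGroup)
  have "(\<lambda>_. \<one>\<^bsub>BijGroup {0::nat}\<^esub>) \<in> hom (BijGroup A) (BijGroup {0::nat})"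
    by (rule homI) auto
  then show ?case by (intro exI[of _ "{0}"] conjI bexI[of _ "\<lambda>_. \<one>\<^bsub>BijGroup {0::nat}\<^esub>"])
    (auto simp: hamming_dist_def)
next
  case (Suc n)
  then obtain B T where B: "finite (B::nat set)" "B \<noteq> {}" and T: "T \<in> hom (BijGroup A) (BijGroup B)"
    and pow: "\<forall>p\<in>Bij A. \<forall>q\<in>Bij A. 1 - hamming_dist B (T p) (T q) = (1 - hamming_dist A p q) ^ n"
    by (elim exE conjE bexE)
  obtain C S where C: "finite (C::nat set)" "C \<noteq> {}" and S: "S \<in> hom (BijGroup A \<times>\<times> BijGroup B) (BijGroup C)"
    and prod: "\<forall>p\<in>Bij A. \<forall>p'\<in>Bij A. \<forall>q\<in>Bij B. \<forall>q'\<in>Bij B.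
      1 - hamming_dist C (S (p, q)) (S (p', q')) = (1 - hamming_dist A p p') * (1 - hamming_dist B q q')"
    using symmetric_product[OF A B] by (elim exE conjE bexE)
  have TB: "T p \<in> Bij B" if "p \<in> Bij A" for p
    using T that by (auto simp: hom_def carrier_BijGroup)
  have "(\<lambda>p. (p, T p)) \<in> hom (BijGroup A) (BijGroup A \<times>\<times> BijGroup B)"
    using T by (auto simp: hom_def)
  then have "S \<circ> (\<lambda>p. (p, T p)) \<in> hom (BijGroup A) (BijGroup C)"
    using S by (rule hom_compose)
  moreover have "\<forall>p\<in>Bij A. \<forall>q\<in>Bij A. 1 - hamming_dist C ((S \<circ> (\<lambda>p. (p, T p))) p) ((S \<circ> (\<lambda>p. (p, T p))) q)
      = (1 - hamming_dist A p q) ^ Suc n"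
    using pow prod TB by simp
  ultimately show ?case using C by blast
qed

text \<open>
  Soficity asks for lengths close to \<open>1\<close>, approximability for a positive lower bound only. On a finite
  set the lower bound is some \<open>c0 > 0\<close>, and the \<open>n\<close>-th diagonal power replaces the proportion
  \<open>1 - c0\<close> of fixed points by \<open>(1 - c0) ^ n\<close>, while it multiplies the errors by at most \<open>n\<close>, by
  Bernoulli's inequality.
\<close>

lemma sofic_iff_approximable:
  "sofic G \<longleftrightarrow> countable (carrier G) \<and> approximable symmetric_groups G"
proof (intro iffI conjI)
  assume G: "sofic G"
  then show "countable (carrier G)" by (simp add: sofic_def)
  show "approximable symmetric_groups G"
    unfolding approximable_def
  proof (intro conjI exI[of _ "\<lambda>_. 1 / 2"] allI impI ballI; (elim conjE)?)
    show "group G" using G by (simp add: sofic_def)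
    fix F and \<epsilon> :: real assume F: "F \<subseteq> carrier G" "finite F" "0 < \<epsilon>"
    define \<epsilon>' where "\<epsilon>' = min \<epsilon> (1 / 2)"
    have "0 < \<epsilon>'" using F by (simp add: \<epsilon>'_def)
    then obtain A :: "nat set" and \<sigma> where A: "finite A" "A \<noteq> {}" and \<sigma>: "\<sigma> \<in> carrier G \<rightarrow> carrier (BijGroup A)"
      and mult: "multiplicative_map G (BijGroup A) F \<epsilon>' (hamming_dist A) \<sigma>"
      and len: "\<forall>g\<in>F - {\<one>\<^bsub>G\<^esub>}. hamming_length A (\<sigma> g) > 1 - \<epsilon>'"
      using G F unfolding sofic_def by meson
    have "multiplicative_map G (BijGroup A) F \<epsilon> (hamming_dist A) \<sigma>"
      using mult by (auto simp: multiplicative_map_def \<epsilon>'_def)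
    moreover have "injective_map G (BijGroup A) F (\<lambda>_. 1 / 2) (hamming_dist A) \<sigma>"
      using len by (force simp: injective_map_def \<epsilon>'_def hamming_length_def)
    ultimately show "\<exists>(K, d)\<in>symmetric_groups. \<exists>\<theta>\<in>carrier G \<rightarrow> carrier K.
        multiplicative_map G K F \<epsilon> d \<theta> \<and> injective_map G K F (\<lambda>_. 1 / 2) d \<theta>"
      using A \<sigma> unfolding symmetric_groups_def by blast
  qed simp
next
  assume G: "countable (carrier G) \<and> approximable symmetric_groups G"
  then obtain c where c: "\<forall>g\<in>carrier G - {\<one>\<^bsub>G\<^esub>}. 0 < c g"
    and approx: "\<forall>F \<epsilon>. F \<subseteq> carrier G \<and> finite F \<and> 0 < \<epsilon> \<longrightarrow>
       (\<exists>(K, d)\<in>symmetric_groups. \<exists>\<theta>\<in>carrier G \<rightarrow> carrier K. multiplicative_map G K F \<epsilon> d \<theta> \<and> injective_map G K F c d \<theta>)"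
    unfolding approximable_def by (elim conjE exE)
  show "sofic G"
    unfolding sofic_def
  proof (intro conjI allI impI; (elim conjE)?)
    show "group G" "countable (carrier G)" using G by (auto simp: approximable_def)
    fix F and \<epsilon> :: real assume F: "F \<subseteq> carrier G" "finite F" "0 < \<epsilon>"
    define c0 where "c0 = Min (insert 1 (c ` (F - {\<one>\<^bsub>G\<^esub>})))"
    have c0: "0 < c0" "c0 \<le> 1" "\<And>g. g \<in> F - {\<one>\<^bsub>G\<^esub>} \<Longrightarrow> c0 \<le> c g"
      unfolding c0_def using F c by (auto simp: Min_gr_iff)
    obtain n where n: "(1 - c0) ^ n < \<epsilon>" using real_arch_pow_inv[OF F(3), of "1 - c0"] c0 by auto
    define \<epsilon>' where "\<epsilon>' = \<epsilon> / (real n + 1)"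
    have "0 < \<epsilon>'" using F by (simp add: \<epsilon>'_def)
    then obtain A \<theta> where A: "finite (A :: nat set)" "A \<noteq> {}" and \<theta>: "\<theta> \<in> carrier G \<rightarrow> carrier (BijGroup A)"
      and mult: "multiplicative_map G (BijGroup A) F \<epsilon>' (hamming_dist A) \<theta>"
      and injm: "injective_map G (BijGroup A) F c (hamming_dist A) \<theta>"
      using approx[rule_format, OF conjI[OF F(1) conjI[OF F(2)]], of \<epsilon>'] unfolding symmetric_groups_def by auto
    obtain B T where B: "finite (B::nat set)" "B \<noteq> {}" and T: "T \<in> hom (BijGroup A) (BijGroup B)"
      and pow: "\<forall>p\<in>Bij A. \<forall>q\<in>Bij A. 1 - hamming_dist B (T p) (T q) = (1 - hamming_dist A p q) ^ n"
      using symmetric_power[OF A, of n] by (elim exE conjE bexE)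
    interpret G: group G using G by (simp add: approximable_def)
    have \<theta>B: "\<theta> g \<in> Bij A" if "g \<in> carrier G" for g using \<theta> that by (auto simp: carrier_BijGroup)
    have T1: "T \<one>\<^bsub>BijGroup A\<^esub> = \<one>\<^bsub>BijGroup B\<^esub>" by (rule hom_one[OF T group_BijGroup group_BijGroup])
    have oneA: "\<one>\<^bsub>BijGroup A\<^esub> \<in> Bij A" by (simp add: BijGroup_def id_Bij)
    have "multiplicative_map G (BijGroup B) F \<epsilon> (hamming_dist B) (T \<circ> \<theta>)"
      unfolding multiplicative_map_def
    proof (intro conjI ballI)
      show "(T \<circ> \<theta>) \<one>\<^bsub>G\<^esub> = \<one>\<^bsub>BijGroup B\<^esub>" using T1 mult by (simp add: multiplicative_map_def)
      fix g h assume gh: "g \<in> F" "h \<in> F"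
      then have ghc: "g \<in> carrier G" "h \<in> carrier G" using F by auto
      define s where "s = hamming_dist A (\<theta> (g \<otimes>\<^bsub>G\<^esub> h)) (\<theta> g \<otimes>\<^bsub>BijGroup A\<^esub> \<theta> h)"
      have s: "s < \<epsilon>'" "0 \<le> s" "s \<le> 1"
        using mult gh hamming_nonneg hamming_le_1[OF A(1)] unfolding multiplicative_map_def s_def by auto
      have "\<theta> g \<otimes>\<^bsub>BijGroup A\<^esub> \<theta> h \<in> Bij A" using \<theta>B ghc by (simp add: BijGroup_def compose_Bij)
      then have "1 - hamming_dist B (T (\<theta> (g \<otimes>\<^bsub>G\<^esub> h))) (T (\<theta> g \<otimes>\<^bsub>BijGroup A\<^esub> \<theta> h)) = (1 - s) ^ n"
        using pow \<theta>B ghc unfolding s_def by simp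
      moreover have "1 + real n * (- s) \<le> (1 + (- s)) ^ n"
        using s by (intro Bernoulli_inequality) auto
      ultimately have "hamming_dist B (T (\<theta> (g \<otimes>\<^bsub>G\<^esub> h))) (T (\<theta> g \<otimes>\<^bsub>BijGroup A\<^esub> \<theta> h)) \<le> real n * s"
        by simp
      also have "\<dots> \<le> real n * \<epsilon>'" using s by (intro mult_left_mono) auto
      also have "\<dots> < \<epsilon>" using F by (simp add: \<epsilon>'_def field_simps)
      also have "T (\<theta> g \<otimes>\<^bsub>BijGroup A\<^esub> \<theta> h) = T (\<theta> g) \<otimes>\<^bsub>BijGroup B\<^esub> T (\<theta> h)"
        using \<theta> ghc by (intro hom_mult[OF T]) auto
      finally show "hamming_dist B ((T \<circ> \<theta>) (g \<otimes>\<^bsub>G\<^esub> h)) ((T \<circ> \<theta>) g \<otimes>\<^bsub>BijGroup B\<^esub> (T \<circ> \<theta>) h) < \<epsilon>"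
        by simp
    qed
    moreover have "hamming_length B ((T \<circ> \<theta>) g) > 1 - \<epsilon>" if g: "g \<in> F - {\<one>\<^bsub>G\<^esub>}" for g
    proof -
      have s: "c0 \<le> hamming_dist A (\<theta> g) \<one>\<^bsub>BijGroup A\<^esub>" "hamming_dist A (\<theta> g) \<one>\<^bsub>BijGroup A\<^esub> \<le> 1"
        using c0(3)[OF g] injm g hamming_le_1[OF A(1)] by (auto simp: injective_map_def intro: order_trans)
      have "1 - hamming_dist B (T (\<theta> g)) (T \<one>\<^bsub>BijGroup A\<^esub>) = (1 - hamming_dist A (\<theta> g) \<one>\<^bsub>BijGroup A\<^esub>) ^ n"
        using pow \<theta>B oneA g F by auto
      also have "\<dots> \<le> (1 - c0) ^ n" using s by (intro power_mono) auto
      also have "\<dots> < \<epsilon>" by (rule n)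
      finally show ?thesis by (simp add: hamming_length_def T1)
    qed
    moreover have "T \<circ> \<theta> \<in> carrier G \<rightarrow> carrier (BijGroup B)" using T \<theta> by (auto simp: hom_def)
    ultimately show "\<exists>(A :: nat set) \<sigma>. finite A \<and> A \<noteq> {} \<and> \<sigma> \<in> carrier G \<rightarrow> carrier (BijGroup A) \<and>
          multiplicative_map G (BijGroup A) F \<epsilon> (hamming_dist A) \<sigma> \<and>
          (\<forall>g\<in>F - {\<one>\<^bsub>G\<^esub>}. hamming_length A (\<sigma> g) > 1 - \<epsilon>)"
      using B by blast
  qed
qed

section \<open>Kronecker products and block monomial matrices\<close>

lemma sum_div_mod:
  fixes g :: "nat \<Rightarrow> nat \<Rightarrow> 'x::comm_monoid_add"
  assumes n: "0 < n"
  shows "(\<Sum>i<m * n. g (i div n) (i mod n)) = (\<Sum>b<m. \<Sum>x<n. g b x)"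
proof -
  have "(\<Sum>b<m. \<Sum>x<n. g b x) = (\<Sum>(b, x)\<in>{..<m} \<times> {..<n}. g b x)"
    by (simp add: sum.cartesian_product)
  also have "\<dots> = (\<Sum>i<m * n. g (i div n) (i mod n))"
  proof (rule sum.reindex_bij_witness[of _ "\<lambda>i. (i div n, i mod n)" "\<lambda>(b, x). b * n + x"])
    fix z assume "z \<in> {..<m} \<times> {..<n}"
    then obtain b x where z: "z = (b, x)" "b < m" "x < n" by auto
    have "b * n + x < (b + 1) * n" using z by simp
    also have "\<dots> \<le> m * n" using z by (intro mult_le_mono1) auto
    finally show "(case z of (b, x) \<Rightarrow> b * n + x) \<in> {..<m * n}" using z by simp
  qed (use n in \<open>auto simp: less_mult_imp_div_less\<close>)
  finally show ?thesis by simp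
qed

lemma mat_mult_entry:
  assumes "A \<in> carrier_mat n l" "B \<in> carrier_mat l n'" "i < n" "j < n'"
  shows "(A * B) $$ (i, j) = (\<Sum>k<l. A $$ (i, k) * B $$ (k, j))"
  using assms by (auto simp: scalar_prod_def atLeast0LessThan)

definition kron :: "'a::semiring_1 mat \<Rightarrow> 'a mat \<Rightarrow> 'a mat" where
  "kron A B = mat (dim_row A * dim_row B) (dim_col A * dim_col B)
     (\<lambda>(i, j). A $$ (i div dim_row B, j div dim_col B) * B $$ (i mod dim_row B, j mod dim_col B))"

lemma kron_carrier: "A \<in> carrier_mat m m \<Longrightarrow> B \<in> carrier_mat n n \<Longrightarrow> kron A B \<in> carrier_mat (m * n) (m * n)"
  by (auto simp: kron_def)

lemma kron_entry:
  assumes "A \<in> carrier_mat m m" "B \<in> carrier_mat n n" "i < m * n" "j < m * n"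
  shows "kron A B $$ (i, j) = A $$ (i div n, j div n) * B $$ (i mod n, j mod n)"
  using assms by (auto simp: kron_def)

lemma kron_mult:
  fixes A :: "'a::comm_semiring_1 mat"
  assumes A: "A \<in> carrier_mat m m" "A' \<in> carrier_mat m m" and B: "B \<in> carrier_mat n n" "B' \<in> carrier_mat n n"
  shows "kron A B * kron A' B' = kron (A * A') (B * B')"
proof (rule eq_matI)
  note c = kron_carrier[OF A(1) B(1)] kron_carrier[OF A(2) B(2)]
    kron_carrier[OF mult_carrier_mat[OF A] mult_carrier_mat[OF B]]
  show "dim_row (kron A B * kron A' B') = dim_row (kron (A * A') (B * B'))"
    "dim_col (kron A B * kron A' B') = dim_col (kron (A * A') (B * B'))" using c by auto
  fix i j assume "i < dim_row (kron (A * A') (B * B'))" "j < dim_col (kron (A * A') (B * B'))"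
  then have ij: "i < m * n" "j < m * n" using c by auto
  then have n: "0 < n" by (cases n) auto
  have b: "i div n < m" "j div n < m" "i mod n < n" "j mod n < n"
    using ij n by (auto simp: less_mult_imp_div_less)
  have "(kron A B * kron A' B') $$ (i, j) = (\<Sum>k<m * n. kron A B $$ (i, k) * kron A' B' $$ (k, j))"
    by (rule mat_mult_entry[OF c(1,2) ij])
  also have "\<dots> = (\<Sum>k<m * n. (A $$ (i div n, k div n) * B $$ (i mod n, k mod n)) *
      (A' $$ (k div n, j div n) * B' $$ (k mod n, j mod n)))"
    using ij by (intro sum.cong) (auto simp: kron_entry[OF A(1) B(1)] kron_entry[OF A(2) B(2)])
  also have "\<dots> = (\<Sum>u<m. \<Sum>v<n. (A $$ (i div n, u) * B $$ (i mod n, v)) * (A' $$ (u, j div n) * B' $$ (v, j mod n)))"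
    by (rule sum_div_mod[OF n])
  also have "\<dots> = (\<Sum>u<m. A $$ (i div n, u) * A' $$ (u, j div n)) * (\<Sum>v<n. B $$ (i mod n, v) * B' $$ (v, j mod n))"
    unfolding sum_product by (intro sum.cong refl) (simp add: mult_ac)
  also have "\<dots> = kron (A * A') (B * B') $$ (i, j)"
    using kron_entry[OF mult_carrier_mat[OF A] mult_carrier_mat[OF B] ij]
    by (simp only: mat_mult_entry[OF A b(1,2)] mat_mult_entry[OF B b(3,4)])
  finally show "(kron A B * kron A' B') $$ (i, j) = kron (A * A') (B * B') $$ (i, j)" .
qed

lemma kron_one: "kron (1\<^sub>m m) (1\<^sub>m n) = (1\<^sub>m (m * n) :: 'a::semiring_1 mat)"
proof (rule eq_matI)
  fix i j assume "i < dim_row (1\<^sub>m (m * n) :: 'a mat)" "j < dim_col (1\<^sub>m (m * n) :: 'a mat)"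
  then have ij: "i < m * n" "j < m * n" by auto
  then have n: "0 < n" by (cases n) auto
  have b: "i div n < m" "j div n < m" "i mod n < n" "j mod n < n"
    using ij n by (auto simp: less_mult_imp_div_less)
  have "i div n = j div n \<and> i mod n = j mod n \<longleftrightarrow> i = j"
    by (metis div_mult_mod_eq)
  then show "kron (1\<^sub>m m) (1\<^sub>m n) $$ (i, j) = (1\<^sub>m (m * n) :: 'a mat) $$ (i, j)"
    using ij b kron_entry[OF one_carrier_mat one_carrier_mat ij] by auto
qed (auto simp: kron_def)

lemma kron_minus:
  fixes A :: "'a::comm_ring_1 mat"
  assumes "A \<in> carrier_mat m m" "A' \<in> carrier_mat m m" "B \<in> carrier_mat n n" "B' \<in> carrier_mat n n"
  shows "kron A B - kron A' B = kron (A - A') B" "kron A B - kron A B' = kron A (B - B')"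
proof -
  have b: "i div n < m" "i mod n < n" if "i < m * n" for i
    using that by (cases "n = 0"; auto simp: less_mult_imp_div_less)+
  show "kron A B - kron A' B = kron (A - A') B" "kron A B - kron A B' = kron A (B - B')"
    using assms b by (auto simp: kron_def algebra_simps intro!: eq_matI)
qed

text \<open>
  Block column \<open>b\<close> has the single block \<open>k b\<close>, in block row \<open>p b\<close>. Singular and zero blocks are
  useful too: with them the matrix selects rows or columns.
\<close>

definition block_monomial :: "nat \<Rightarrow> nat \<Rightarrow> (nat \<Rightarrow> 'a::semiring_1 mat) \<Rightarrow> (nat \<Rightarrow> nat) \<Rightarrow> 'a mat" where
  "block_monomial m n k p = mat (m * n) (m * n)
     (\<lambda>(i, j). if i div n = p (j div n) then k (j div n) $$ (i mod n, j mod n) else 0)"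

lemma block_monomial_carrier [simp]: "block_monomial m n k p \<in> carrier_mat (m * n) (m * n)"
  by (simp add: block_monomial_def)

lemma block_monomial_cong:
  assumes "\<And>b. b < m \<Longrightarrow> p b = p' b" "\<And>b. b < m \<Longrightarrow> k b = k' b"
  shows "block_monomial m n k p = block_monomial m n k' p'"
  unfolding block_monomial_def using assms
  by (intro cong_mat) (auto simp: less_mult_imp_div_less)

lemma block_monomial_mult:
  fixes k :: "nat \<Rightarrow> 'a::comm_semiring_1 mat"
  assumes p': "\<And>b. b < m \<Longrightarrow> p' b < m"
    and k: "\<And>b. b < m \<Longrightarrow> k b \<in> carrier_mat n n" "\<And>b. b < m \<Longrightarrow> k' b \<in> carrier_mat n n"
  shows "block_monomial m n k p * block_monomial m n k' p' = block_monomial m n (\<lambda>b. k (p' b) * k' b) (\<lambda>b. p (p' b))"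
proof (rule eq_matI)
  fix i j assume "i < dim_row (block_monomial m n (\<lambda>b. k (p' b) * k' b) (\<lambda>b. p (p' b)))"
    "j < dim_col (block_monomial m n (\<lambda>b. k (p' b) * k' b) (\<lambda>b. p (p' b)))"
  then have ij: "i < m * n" "j < m * n" by (auto simp: block_monomial_def)
  then have n: "0 < n" by (cases n) auto
  have b: "i div n < m" "j div n < m" "i mod n < n" "j mod n < n"
    using ij n by (auto simp: less_mult_imp_div_less)
  let ?c = "j div n"
  have "(block_monomial m n k p * block_monomial m n k' p') $$ (i, j)
      = (\<Sum>l<m * n. block_monomial m n k p $$ (i, l) * block_monomial m n k' p' $$ (l, j))"
    by (rule mat_mult_entry[OF block_monomial_carrier block_monomial_carrier ij])
  also have "\<dots> = (\<Sum>l<m * n. (if i div n = p (l div n) then k (l div n) $$ (i mod n, l mod n) else 0) *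
      (if l div n = p' ?c then k' ?c $$ (l mod n, j mod n) else 0))"
    using ij by (intro sum.cong) (auto simp: block_monomial_def)
  also have "\<dots> = (\<Sum>u<m. \<Sum>v<n. (if i div n = p u then k u $$ (i mod n, v) else 0) *
      (if u = p' ?c then k' ?c $$ (v, j mod n) else 0))"
    by (rule sum_div_mod[OF n])
  also have "\<dots> = (\<Sum>u<m. if u = p' ?c then (\<Sum>v<n. (if i div n = p u then k u $$ (i mod n, v) else 0) * k' ?c $$ (v, j mod n)) else 0)"
    by (intro sum.cong) auto
  also have "\<dots> = (\<Sum>v<n. (if i div n = p (p' ?c) then k (p' ?c) $$ (i mod n, v) else 0) * k' ?c $$ (v, j mod n))"
    using p'[OF b(2)] by simp
  also have "\<dots> = (if i div n = p (p' ?c) then (\<Sum>v<n. k (p' ?c) $$ (i mod n, v) * k' ?c $$ (v, j mod n)) else 0)"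
    by simp
  also have "\<dots> = block_monomial m n (\<lambda>b. k (p' b) * k' b) (\<lambda>b. p (p' b)) $$ (i, j)"
    using ij mat_mult_entry[OF k(1)[OF p'[OF b(2)]] k(2)[OF b(2)] b(3,4)] by (simp add: block_monomial_def)
  finally show "(block_monomial m n k p * block_monomial m n k' p') $$ (i, j)
    = block_monomial m n (\<lambda>b. k (p' b) * k' b) (\<lambda>b. p (p' b)) $$ (i, j)" .
qed (auto simp: block_monomial_def)

lemma block_monomial_one: "block_monomial m n (\<lambda>_. 1\<^sub>m n) (\<lambda>b. b) = 1\<^sub>m (m * n)"
proof (rule eq_matI)
  fix i j assume "i < dim_row (1\<^sub>m (m * n) :: 'a mat)" "j < dim_col (1\<^sub>m (m * n) :: 'a mat)"
  then have ij: "i < m * n" "j < m * n" by auto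
  then have n: "0 < n" by (cases n) auto
  have "i div n = j div n \<and> i mod n = j mod n \<longleftrightarrow> i = j" by (metis div_mult_mod_eq)
  then show "block_monomial m n (\<lambda>_. 1\<^sub>m n) (\<lambda>b. b) $$ (i, j) = (1\<^sub>m (m * n) :: 'a mat) $$ (i, j)"
    using ij n by (auto simp: block_monomial_def)
qed (auto simp: block_monomial_def)

lemma block_monomial_inverse:
  fixes k :: "nat \<Rightarrow> 'a::comm_semiring_1 mat"
  assumes p: "p \<in> Bij {..<m}" and q: "\<And>b. b < m \<Longrightarrow> q (p b) = b" "\<And>b. b < m \<Longrightarrow> p (q b) = b" "\<And>b. b < m \<Longrightarrow> q b < m"
    and k: "\<And>b. b < m \<Longrightarrow> k b \<in> carrier_mat n n" "\<And>b. b < m \<Longrightarrow> k' b \<in> carrier_mat n n"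
      "\<And>b. b < m \<Longrightarrow> k' b * k b = 1\<^sub>m n" "\<And>b. b < m \<Longrightarrow> k b * k' b = 1\<^sub>m n"
  shows "block_monomial m n (\<lambda>b. k' (q b)) q * block_monomial m n k p = 1\<^sub>m (m * n)"
    and "block_monomial m n k p * block_monomial m n (\<lambda>b. k' (q b)) q = 1\<^sub>m (m * n)"
proof -
  have pm: "p b < m" if "b < m" for b using Bij_in[OF p, of b] that by auto
  show "block_monomial m n (\<lambda>b. k' (q b)) q * block_monomial m n k p = 1\<^sub>m (m * n)"
    unfolding block_monomial_one[symmetric]
    by (subst block_monomial_mult) (use pm q k in \<open>auto intro!: block_monomial_cong\<close>)
  show "block_monomial m n k p * block_monomial m n (\<lambda>b. k' (q b)) q = 1\<^sub>m (m * n)"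
    unfolding block_monomial_one[symmetric]
    by (subst block_monomial_mult) (use pm q k in \<open>auto intro!: block_monomial_cong\<close>)
qed

lemma block_monomial_hom:
  assumes K: "\<And>x. x \<in> carrier K \<Longrightarrow> x \<in> carrier_mat n n"
    and mult: "\<And>x y. x \<otimes>\<^bsub>K\<^esub> y = x * y" "\<And>x y. x \<otimes>\<^bsub>M\<^esub> y = x * (y :: 'a::comm_semiring_1 mat)"
    and closed: "\<And>k p. (k, p) \<in> carrier (perm_wreath K {..<m}) \<Longrightarrow> block_monomial m n k p \<in> carrier M"
  shows "(\<lambda>(k, p). block_monomial m n k p) \<in> hom (perm_wreath K {..<m}) M"
proof (rule homI)
  let ?PW = "perm_wreath K {..<m}"
  fix x assume x: "x \<in> carrier ?PW"
  then show "(case x of (k, p) \<Rightarrow> block_monomial m n k p) \<in> carrier M"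
    using closed by (cases x) auto
  fix y assume y: "y \<in> carrier ?PW"
  obtain k p k' p' where xy: "x = (k, p)" "y = (k', p')" by (metis surj_pair)
  have k: "k b \<in> carrier_mat n n" "k' b \<in> carrier_mat n n" if "b < m" for b
    using x y xy that by (auto simp: carrier_perm_wreath intro!: K)
  have p': "p' b < m" if "b < m" for b
    using y xy Bij_in[of p' "{..<m}" b] that by (auto simp: carrier_perm_wreath)
  have "block_monomial m n k p * block_monomial m n k' p' = block_monomial m n (\<lambda>b. k (p' b) * k' b) (\<lambda>b. p (p' b))"
    by (intro block_monomial_mult p' k)
  also have "\<dots> = block_monomial m n (\<lambda>b\<in>{..<m}. k (p' b) * k' b) (compose {..<m} p p')"
    by (intro block_monomial_cong) (auto simp: compose_eq)
  finally show "(case x \<otimes>\<^bsub>?PW\<^esub> y of (k, p) \<Rightarrow> block_monomial m n k p)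
    = (case x of (k, p) \<Rightarrow> block_monomial m n k p) \<otimes>\<^bsub>M\<^esub> (case y of (k, p) \<Rightarrow> block_monomial m n k p)"
    by (simp add: xy mult_perm_wreath mult)
qed

lemma Bij_inverse:
  assumes "p \<in> Bij {..<m}"
  obtains q where "\<And>b. b < m \<Longrightarrow> q (p b) = b" "\<And>b. b < m \<Longrightarrow> p (q b) = b" "\<And>b. b < m \<Longrightarrow> q b < m"
proof
  have p: "bij_betw p {..<m} {..<m}" using assms by (simp add: Bij_def)
  let ?q = "inv_into {..<m} p"
  show "?q (p b) = b" "p (?q b) = b" "?q b < m" if "b < m" for b
    using that bij_betw_inv_into_left[OF p] bij_betw_inv_into_right[OF p] bij_betwE[OF bij_betw_inv_into[OF p]]
    by auto
qed

section \<open>Unitary groups\<close>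

lemma mat_adjoint_carrier: "A \<in> carrier_mat n n \<Longrightarrow> mat_adjoint A \<in> carrier_mat n n"
  by (auto simp: mat_adjoint_def)

lemma mat_adjoint_entry:
  fixes A :: "complex mat"
  assumes "A \<in> carrier_mat n n" "i < n" "j < n"
  shows "mat_adjoint A $$ (i, j) = cnj (A $$ (j, i))"
  using assms by (auto simp: mat_adjoint_def mat_of_rows_def)

text \<open>
  The square of the Frobenius norm.
\<close>

definition frob :: "nat \<Rightarrow> complex mat \<Rightarrow> real" where
  "frob n A = (\<Sum>j<n. \<Sum>i<n. (cmod (A $$ (i, j)))\<^sup>2)"

lemma frob_nonneg: "0 \<le> frob n A"
  by (simp add: frob_def sum_nonneg)

lemma trace_adjoint_mult:
  assumes A: "A \<in> carrier_mat n n"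
  shows "(\<Sum>j<n. (mat_adjoint A * A) $$ (j, j)) = of_real (frob n A)"
proof -
  have "(mat_adjoint A * A) $$ (j, j) = of_real (\<Sum>i<n. (cmod (A $$ (i, j)))\<^sup>2)" if j: "j < n" for j
  proof -
    have "(mat_adjoint A * A) $$ (j, j) = (\<Sum>i<n. cnj (A $$ (i, j)) * A $$ (i, j))"
      using mat_mult_entry[OF mat_adjoint_carrier[OF A] A j j] mat_adjoint_entry[OF A j] by simp
    also have "\<dots> = of_real (\<Sum>i<n. (cmod (A $$ (i, j)))\<^sup>2)"
      by (simp add: complex_norm_square mult.commute del: of_real_power)
    finally show ?thesis .
  qed
  then show ?thesis by (simp add: frob_def)
qed

lemma hs_norm_frob:
  assumes "A \<in> carrier_mat n n"
  shows "hs_norm n A = sqrt (frob n A / n)"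
  unfolding hs_norm_def normalized_trace_def trace_adjoint_mult[OF assms]
  by (simp add: Re_divide_of_nat)

lemma unitary_carrier: "U \<in> carrier (unitary_group n) \<longleftrightarrow>
    U \<in> carrier_mat n n \<and> mat_adjoint U * U = 1\<^sub>m n \<and> U * mat_adjoint U = 1\<^sub>m n"
  by (simp add: unitary_group_def)

lemma unitary_mult: "U \<otimes>\<^bsub>unitary_group n\<^esub> V = U * V" and unitary_one: "\<one>\<^bsub>unitary_group n\<^esub> = 1\<^sub>m n"
  by (simp_all add: unitary_group_def)

lemma frob_unitary:
  assumes "U \<in> carrier (unitary_group n)"
  shows "frob n U = n"
proof -
  have "of_real (frob n U) = (\<Sum>j<n. (1\<^sub>m n :: complex mat) $$ (j, j))"
    using assms trace_adjoint_mult[of U n] by (simp add: unitary_carrier)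
  then have "of_real (frob n U) = (of_real (real n) :: complex)" by simp
  then show ?thesis using of_real_eq_iff by blast
qed

lemma unitary_mult_closed:
  assumes "U \<in> carrier (unitary_group n)" "V \<in> carrier (unitary_group n)"
  shows "U * V \<in> carrier (unitary_group n)"
proof -
  have c: "U \<in> carrier_mat n n" "V \<in> carrier_mat n n" "mat_adjoint U \<in> carrier_mat n n" "mat_adjoint V \<in> carrier_mat n n"
    and U: "mat_adjoint U * U = 1\<^sub>m n" "U * mat_adjoint U = 1\<^sub>m n"
    and V: "mat_adjoint V * V = 1\<^sub>m n" "V * mat_adjoint V = 1\<^sub>m n"
    using assms by (auto simp: unitary_carrier mat_adjoint_carrier)
  have adj: "mat_adjoint (U * V) = mat_adjoint V * mat_adjoint U"
  proof (rule eq_matI)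
    have uv: "U * V \<in> carrier_mat n n" using c by simp
    show "dim_row (mat_adjoint (U * V)) = dim_row (mat_adjoint V * mat_adjoint U)"
      "dim_col (mat_adjoint (U * V)) = dim_col (mat_adjoint V * mat_adjoint U)"
      using c mat_adjoint_carrier[OF uv] by auto
    fix i j assume "i < dim_row (mat_adjoint V * mat_adjoint U)" "j < dim_col (mat_adjoint V * mat_adjoint U)"
    then have ij: "i < n" "j < n" using c by auto
    show "mat_adjoint (U * V) $$ (i, j) = (mat_adjoint V * mat_adjoint U) $$ (i, j)"
      using ij mat_adjoint_entry[OF uv ij] mat_mult_entry[OF c(1,2) ij(2,1)] mat_mult_entry[OF c(4,3) ij]
        mat_adjoint_entry[OF c(1)] mat_adjoint_entry[OF c(2)]
      by (simp add: mult.commute)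
  qed
  have "(mat_adjoint V * mat_adjoint U) * (U * V) = mat_adjoint V * ((mat_adjoint U * U) * V)"
    using c by (simp add: assoc_mult_mat[of _ n n _ n _ n])
  then have 1: "(mat_adjoint V * mat_adjoint U) * (U * V) = 1\<^sub>m n" using U V c by simp
  have "(U * V) * (mat_adjoint V * mat_adjoint U) = U * ((V * mat_adjoint V) * mat_adjoint U)"
    using c by (simp add: assoc_mult_mat[of _ n n _ n _ n])
  then have 2: "(U * V) * (mat_adjoint V * mat_adjoint U) = 1\<^sub>m n" using U V c by simp
  show ?thesis using 1 2 c adj by (simp add: unitary_carrier)
qed

lemma adjoint_adjoint:
  assumes "A \<in> carrier_mat n n"
  shows "mat_adjoint (mat_adjoint A) = (A :: complex mat)"
  using assms mat_adjoint_carrier[OF assms] mat_adjoint_carrier[OF mat_adjoint_carrier[OF assms]]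
  by (intro eq_matI) (auto simp: mat_adjoint_entry[OF mat_adjoint_carrier[OF assms]] mat_adjoint_entry[OF assms])

lemma adjoint_one: "mat_adjoint (1\<^sub>m n) = (1\<^sub>m n :: complex mat)"
  using mat_adjoint_carrier[OF one_carrier_mat[of n, where 'a = complex]]
  by (intro eq_matI) (auto simp: mat_adjoint_entry[OF one_carrier_mat])

lemma group_unitary_group: "group (unitary_group n)"
proof (rule groupI)
  fix U assume U: "U \<in> carrier (unitary_group n)"
  then have "mat_adjoint U \<in> carrier (unitary_group n)"
    by (auto simp: unitary_carrier adjoint_adjoint mat_adjoint_carrier)
  then show "\<exists>V\<in>carrier (unitary_group n). V \<otimes>\<^bsub>unitary_group n\<^esub> U = \<one>\<^bsub>unitary_group n\<^esub>"
    using U by (auto simp: unitary_carrier unitary_mult unitary_one)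
next
  fix U V W assume "U \<in> carrier (unitary_group n)" "V \<in> carrier (unitary_group n)" "W \<in> carrier (unitary_group n)"
  then show "U \<otimes>\<^bsub>unitary_group n\<^esub> V \<otimes>\<^bsub>unitary_group n\<^esub> W = U \<otimes>\<^bsub>unitary_group n\<^esub> (V \<otimes>\<^bsub>unitary_group n\<^esub> W)"
    by (auto simp: unitary_mult unitary_carrier intro: assoc_mult_mat)
next
  fix U V assume "U \<in> carrier (unitary_group n)" "V \<in> carrier (unitary_group n)"
  then show "U \<otimes>\<^bsub>unitary_group n\<^esub> V \<in> carrier (unitary_group n)"
    unfolding unitary_mult by (rule unitary_mult_closed)
qed (auto simp: unitary_mult unitary_one unitary_carrier adjoint_one)

lemma kron_unitary:
  assumes "U \<in> carrier (unitary_group m)" "V \<in> carrier (unitary_group n)"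
  shows "kron U V \<in> carrier (unitary_group (m * n))"
proof -
  have c: "U \<in> carrier_mat m m" "V \<in> carrier_mat n n" "mat_adjoint U \<in> carrier_mat m m" "mat_adjoint V \<in> carrier_mat n n"
    and U: "mat_adjoint U * U = 1\<^sub>m m" "U * mat_adjoint U = 1\<^sub>m m"
    and V: "mat_adjoint V * V = 1\<^sub>m n" "V * mat_adjoint V = 1\<^sub>m n"
    using assms by (auto simp: unitary_carrier mat_adjoint_carrier)
  note k = kron_carrier[OF c(1,2)] and k' = kron_carrier[OF c(3,4)]
  have adj: "mat_adjoint (kron U V) = kron (mat_adjoint U) (mat_adjoint V)"
  proof (rule eq_matI)
    show "dim_row (mat_adjoint (kron U V)) = dim_row (kron (mat_adjoint U) (mat_adjoint V))"
      "dim_col (mat_adjoint (kron U V)) = dim_col (kron (mat_adjoint U) (mat_adjoint V))"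
      using k' mat_adjoint_carrier[OF k] by auto
    fix i j assume "i < dim_row (kron (mat_adjoint U) (mat_adjoint V))" "j < dim_col (kron (mat_adjoint U) (mat_adjoint V))"
    then have ij: "i < m * n" "j < m * n" using k' by auto
    then have n: "0 < n" by (cases n) auto
    have b: "i div n < m" "j div n < m" "i mod n < n" "j mod n < n"
      using ij n by (auto simp: less_mult_imp_div_less)
    show "mat_adjoint (kron U V) $$ (i, j) = kron (mat_adjoint U) (mat_adjoint V) $$ (i, j)"
      by (simp add: mat_adjoint_entry[OF k ij] kron_entry[OF c(3,4) ij] kron_entry[OF c(1,2) ij(2,1)]
          mat_adjoint_entry[OF c(1) b(1,2)] mat_adjoint_entry[OF c(2) b(3,4)])
  qed
  show ?thesis
    using k kron_mult[OF c(3,1) c(4,2)] kron_mult[OF c(1,3) c(2,4)] U V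
    by (simp add: unitary_carrier adj kron_one)
qed

lemma block_monomial_unitary:
  assumes p: "p \<in> Bij {..<m}" and k: "\<And>b. b < m \<Longrightarrow> k b \<in> carrier (unitary_group n)"
  shows "block_monomial m n k p \<in> carrier (unitary_group (m * n))"
proof -
  have c: "k b \<in> carrier_mat n n" "mat_adjoint (k b) \<in> carrier_mat n n"
    "mat_adjoint (k b) * k b = 1\<^sub>m n" "k b * mat_adjoint (k b) = 1\<^sub>m n" if "b < m" for b
    using k[OF that] by (auto simp: unitary_carrier mat_adjoint_carrier)
  obtain q where q: "\<And>b. b < m \<Longrightarrow> q (p b) = b" "\<And>b. b < m \<Longrightarrow> p (q b) = b" "\<And>b. b < m \<Longrightarrow> q b < m"
    using Bij_inverse[OF p] by blast
  have pm: "p b < m" if "b < m" for b using Bij_in[OF p, of b] that by auto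
  let ?M = "block_monomial m n k p" and ?M' = "block_monomial m n (\<lambda>b. mat_adjoint (k (q b))) q"
  have adj: "mat_adjoint ?M = ?M'"
  proof (rule eq_matI)
    show "dim_row (mat_adjoint ?M) = dim_row ?M'" "dim_col (mat_adjoint ?M) = dim_col ?M'"
      using mat_adjoint_carrier[OF block_monomial_carrier[of m n k p]] by (auto simp: block_monomial_def)
    fix i j assume "i < dim_row ?M'" "j < dim_col ?M'"
    then have ij: "i < m * n" "j < m * n" by (auto simp: block_monomial_def)
    then have n: "0 < n" by (cases n) auto
    have b: "i div n < m" "j div n < m" "i mod n < n" "j mod n < n"
      using ij n by (auto simp: less_mult_imp_div_less)
    have adj: "mat_adjoint ?M $$ (i, j) = cnj (?M $$ (j, i))"
      by (rule mat_adjoint_entry[OF block_monomial_carrier ij])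
    show "mat_adjoint ?M $$ (i, j) = ?M' $$ (i, j)"
    proof (cases "i div n = q (j div n)")
      case True
      then have e: "p (i div n) = j div n" using q(2)[OF b(2)] by simp
      have "?M $$ (j, i) = k (i div n) $$ (j mod n, i mod n)"
        using ij e by (simp add: block_monomial_def)
      moreover have "?M' $$ (i, j) = mat_adjoint (k (i div n)) $$ (i mod n, j mod n)"
        using ij True[symmetric] by (simp add: block_monomial_def)
      ultimately show ?thesis
        using adj mat_adjoint_entry[OF c(1)[OF b(1)] b(3,4)] by simp
    next
      case False
      then have e: "p (i div n) \<noteq> j div n" using q(1)[OF b(1)] by metis
      have "?M $$ (j, i) = 0" using ij e by (simp add: block_monomial_def)
      moreover have "?M' $$ (i, j) = 0" using ij False by (simp add: block_monomial_def)
      ultimately show ?thesis using adj by simp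
    qed
  qed
  show ?thesis
    using block_monomial_inverse[OF p q, of k n "\<lambda>b. mat_adjoint (k b)"] c
    by (simp add: unitary_carrier adj)
qed

lemma hs_dist_frob:
  assumes "A \<in> carrier_mat n n" "B \<in> carrier_mat n n"
  shows "hs_dist n A B = sqrt (frob n (A - B) / n)"
  unfolding hs_dist_def using assms by (intro hs_norm_frob) auto

lemma frob_L2: "frob n A = (L2_set (\<lambda>(j, i). cmod (A $$ (i, j))) ({..<n} \<times> {..<n}))\<^sup>2"
  unfolding frob_def L2_set_def by (simp add: sum_nonneg sum.cartesian_product split_beta)

lemma hs_dist_L2:
  assumes "A \<in> carrier_mat n n" "B \<in> carrier_mat n n"
  shows "hs_dist n A B = L2_set (\<lambda>(j, i). cmod (A $$ (i, j) - B $$ (i, j))) ({..<n} \<times> {..<n}) / sqrt n"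
proof -
  have "frob n (A - B) = (L2_set (\<lambda>(j, i). cmod (A $$ (i, j) - B $$ (i, j))) ({..<n} \<times> {..<n}))\<^sup>2"
    unfolding frob_L2 using assms by (intro arg_cong[of _ _ "\<lambda>x. x\<^sup>2"] L2_set_cong) auto
  then show ?thesis using assms by (simp add: hs_dist_frob real_sqrt_divide L2_set_nonneg)
qed

lemma pseudometric_hs: "pseudometric_on (carrier_mat n n) (hs_dist n)"
  unfolding pseudometric_on_def
proof (intro conjI ballI)
  fix A :: "complex mat" assume A: "A \<in> carrier_mat n n"
  show "hs_dist n A A = 0" using A by (simp add: hs_dist_frob frob_def)
  fix B :: "complex mat" assume B: "B \<in> carrier_mat n n"
  show "hs_dist n A B = hs_dist n B A"
    using A B by (simp add: hs_dist_L2 norm_minus_commute)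
  fix C :: "complex mat" assume C: "C \<in> carrier_mat n n"
  let ?I = "{..<n} \<times> {..<n}"
  have "L2_set (\<lambda>(j, i). cmod (A $$ (i, j) - C $$ (i, j))) ?I
      \<le> L2_set (\<lambda>z. (\<lambda>(j, i). cmod (A $$ (i, j) - B $$ (i, j))) z + (\<lambda>(j, i). cmod (B $$ (i, j) - C $$ (i, j))) z) ?I"
    using norm_triangle_ineq[of "A $$ (i, j) - B $$ (i, j)" "B $$ (i, j) - C $$ (i, j)" for i j]
    by (intro L2_set_mono) auto
  also have "\<dots> \<le> L2_set (\<lambda>(j, i). cmod (A $$ (i, j) - B $$ (i, j))) ?I + L2_set (\<lambda>(j, i). cmod (B $$ (i, j) - C $$ (i, j))) ?I"
    by (rule L2_set_triangle_ineq)
  finally show "hs_dist n A C \<le> hs_dist n A B + hs_dist n B C"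
    using A B C by (simp add: hs_dist_L2 add_divide_distrib[symmetric] divide_right_mono)
qed

lemma frob_kron:
  assumes A: "A \<in> carrier_mat m m" and B: "B \<in> carrier_mat n n"
  shows "frob (m * n) (kron A B) = frob m A * frob n B"
proof (cases "n = 0")
  case True
  then show ?thesis by (simp add: frob_def)
next
  case False
  then have n: "0 < n" by simp
  have "frob (m * n) (kron A B) = (\<Sum>j<m * n. \<Sum>i<m * n.
      (cmod (A $$ (i div n, j div n)))\<^sup>2 * (cmod (B $$ (i mod n, j mod n)))\<^sup>2)"
    unfolding frob_def by (intro sum.cong refl) (simp add: kron_entry[OF A B] norm_mult power_mult_distrib)
  also have "\<dots> = (\<Sum>j<m * n. \<Sum>u<m. \<Sum>v<n. (cmod (A $$ (u, j div n)))\<^sup>2 * (cmod (B $$ (v, j mod n)))\<^sup>2)"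
    by (intro sum.cong refl sum_div_mod[OF n])
  also have "\<dots> = (\<Sum>s<m. \<Sum>t<n. \<Sum>u<m. \<Sum>v<n. (cmod (A $$ (u, s)))\<^sup>2 * (cmod (B $$ (v, t)))\<^sup>2)"
    by (rule sum_div_mod[OF n])
  also have "\<dots> = frob m A * frob n B"
    unfolding frob_def by (simp add: sum_product)
  finally show ?thesis .
qed

lemma hs_dist_kron:
  assumes U: "U \<in> carrier (unitary_group m)" "U' \<in> carrier (unitary_group m)"
    and V: "V \<in> carrier (unitary_group n)" "V' \<in> carrier (unitary_group n)" and mn: "0 < m" "0 < n"
  shows "hs_dist (m * n) (kron U V) (kron U' V) = hs_dist m U U'"
    and "hs_dist (m * n) (kron U V) (kron U V') = hs_dist n V V'"
proof -
  have c: "U \<in> carrier_mat m m" "U' \<in> carrier_mat m m" "V \<in> carrier_mat n n" "V' \<in> carrier_mat n n"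
    using U V by (auto simp: unitary_carrier)
  note k = kron_carrier[OF c(1,3)] kron_carrier[OF c(2,3)] kron_carrier[OF c(1,4)]
  have "frob (m * n) (kron U V - kron U' V) = frob m (U - U') * n"
    by (simp add: kron_minus(1)[OF c(1,2,3,4)] frob_kron[OF minus_carrier_mat[OF c(2)] c(3)] frob_unitary[OF V(1)])
  then show "hs_dist (m * n) (kron U V) (kron U' V) = hs_dist m U U'"
    using mn by (simp add: hs_dist_frob[OF k(1,2)] hs_dist_frob[OF c(1,2)])
  have "frob (m * n) (kron U V - kron U V') = m * frob n (V - V')"
    by (simp add: kron_minus(2)[OF c(1,2,3,4)] frob_kron[OF c(1) minus_carrier_mat[OF c(4)]] frob_unitary[OF U(1)])
  then show "hs_dist (m * n) (kron U V) (kron U V') = hs_dist n V V'"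
    using mn by (simp add: hs_dist_frob[OF k(1,3)] hs_dist_frob[OF c(3,4)])
qed

text \<open>
  In block column \<open>b\<close>, each matrix has one block. If these are in the same row, they are subtracted;
  otherwise the difference contains both of them, and the squares of their norms add up.
\<close>

lemma frob_block_monomial:
  assumes p: "\<And>b. b < m \<Longrightarrow> p b < m" "\<And>b. b < m \<Longrightarrow> p' b < m"
    and k: "\<And>b. b < m \<Longrightarrow> k b \<in> carrier_mat n n" "\<And>b. b < m \<Longrightarrow> k' b \<in> carrier_mat n n" and n: "0 < n"
  shows "frob (m * n) (block_monomial m n k p - block_monomial m n k' p')
    = (\<Sum>b<m. if p b = p' b then frob n (k b - k' b) else frob n (k b) + frob n (k' b))"
proof -
  let ?e = "\<lambda>b y a x. (cmod ((if a = p b then k b $$ (x, y) else 0) - (if a = p' b then k' b $$ (x, y) else 0)))\<^sup>2"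
  have "frob (m * n) (block_monomial m n k p - block_monomial m n k' p')
      = (\<Sum>j<m * n. \<Sum>i<m * n. ?e (j div n) (j mod n) (i div n) (i mod n))"
    unfolding frob_def by (intro sum.cong refl) (auto simp: block_monomial_def)
  also have "\<dots> = (\<Sum>j<m * n. \<Sum>a<m. \<Sum>x<n. ?e (j div n) (j mod n) a x)"
    by (intro sum.cong refl sum_div_mod[OF n])
  also have "\<dots> = (\<Sum>b<m. \<Sum>y<n. \<Sum>a<m. \<Sum>x<n. ?e b y a x)"
    by (rule sum_div_mod[OF n])
  also have "\<dots> = (\<Sum>b<m. if p b = p' b then frob n (k b - k' b) else frob n (k b) + frob n (k' b))"
  proof (rule sum.cong)
    fix b assume "b \<in> {..<m}"
    then have b: "b < m" by simp
    show "(\<Sum>y<n. \<Sum>a<m. \<Sum>x<n. ?e b y a x)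
      = (if p b = p' b then frob n (k b - k' b) else frob n (k b) + frob n (k' b))"
    proof (cases "p b = p' b")
      case True
      have "(\<Sum>a<m. \<Sum>x<n. ?e b y a x) = (\<Sum>x<n. (cmod (k b $$ (x, y) - k' b $$ (x, y)))\<^sup>2)" for y
      proof -
        have "(\<Sum>a<m. \<Sum>x<n. ?e b y a x) = (\<Sum>a<m. if a = p b then (\<Sum>x<n. (cmod (k b $$ (x, y) - k' b $$ (x, y)))\<^sup>2) else 0)"
          using True by (intro sum.cong) auto
        then show ?thesis using p(1)[OF b] by simp
      qed
      then show ?thesis using True k[OF b] by (auto simp: frob_def intro!: sum.cong)
    next
      case False
      have "(\<Sum>a<m. \<Sum>x<n. ?e b y a x) = (\<Sum>x<n. (cmod (k b $$ (x, y)))\<^sup>2) + (\<Sum>x<n. (cmod (k' b $$ (x, y)))\<^sup>2)" for y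
      proof -
        have "(\<Sum>a<m. \<Sum>x<n. ?e b y a x) = (\<Sum>a<m. (if a = p b then (\<Sum>x<n. (cmod (k b $$ (x, y)))\<^sup>2) else 0)
            + (if a = p' b then (\<Sum>x<n. (cmod (k' b $$ (x, y)))\<^sup>2) else 0))"
          using False by (intro sum.cong) auto
        then show ?thesis using p(1)[OF b] p(2)[OF b] by (simp add: sum.distrib)
      qed
      then show ?thesis using False by (simp add: frob_def sum.distrib)
    qed
  qed simp
  finally show ?thesis .
qed

definition unitary_groups :: "(complex mat monoid \<times> (complex mat \<Rightarrow> complex mat \<Rightarrow> real)) set" where
  "unitary_groups = {(unitary_group n, hs_dist n) | n. n \<ge> 1}"

lemma hs_dist_unitary_le_2:
  assumes U: "U \<in> carrier (unitary_group n)" "V \<in> carrier (unitary_group n)" and n: "0 < n"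
  shows "hs_dist n U V \<le> 2"
proof -
  have c: "U \<in> carrier_mat n n" "V \<in> carrier_mat n n" "0\<^sub>m n n \<in> carrier_mat n n"
    using U by (auto simp: unitary_carrier)
  have one: "hs_dist n W (0\<^sub>m n n) = 1" if "W \<in> carrier (unitary_group n)" for W
  proof -
    have "W - 0\<^sub>m n n = W" using that by (intro eq_matI) (auto simp: unitary_carrier)
    then show ?thesis using that n frob_unitary[OF that] by (simp add: hs_dist_frob[of _ n] unitary_carrier)
  qed
  have "hs_dist n U V \<le> hs_dist n U (0\<^sub>m n n) + hs_dist n (0\<^sub>m n n) V"
    using pseudometric_hs[of n] c unfolding pseudometric_on_def by blast
  also have "hs_dist n (0\<^sub>m n n) V = hs_dist n V (0\<^sub>m n n)"
    using pseudometric_hs[of n] c unfolding pseudometric_on_def by blast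
  also have "hs_dist n U (0\<^sub>m n n) + hs_dist n V (0\<^sub>m n n) = 2"
    using one[OF U(1)] one[OF U(2)] by simp
  finally show ?thesis .
qed

lemma hs_dist_block_monomial:
  assumes kp: "(k, p) \<in> carrier (perm_wreath (unitary_group n) {..<m})"
    "(k', p') \<in> carrier (perm_wreath (unitary_group n) {..<m})" and mn: "0 < m" "0 < n"
  shows "(hs_dist (m * n) (block_monomial m n k p) (block_monomial m n k' p'))\<^sup>2
    = (\<Sum>b<m. if p b = p' b then (hs_dist n (k b) (k' b))\<^sup>2 else 2) / m"
proof -
  have u: "k b \<in> carrier (unitary_group n)" "k' b \<in> carrier (unitary_group n)" if "b < m" for b
    using kp that by (auto simp: carrier_perm_wreath)
  then have c: "k b \<in> carrier_mat n n" "k' b \<in> carrier_mat n n" if "b < m" for b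
    using that by (auto simp: unitary_carrier)
  have p: "p b < m" "p' b < m" if "b < m" for b
    using kp Bij_in[of p "{..<m}" b] Bij_in[of p' "{..<m}" b] that by (auto simp: carrier_perm_wreath)
  have "(hs_dist (m * n) (block_monomial m n k p) (block_monomial m n k' p'))\<^sup>2
      = frob (m * n) (block_monomial m n k p - block_monomial m n k' p') / (m * n)"
    by (simp add: hs_dist_frob[OF block_monomial_carrier block_monomial_carrier] frob_nonneg)
  also have "\<dots> = (\<Sum>b<m. (if p b = p' b then frob n (k b - k' b) else frob n (k b) + frob n (k' b)) / n) / m"
    by (simp add: frob_block_monomial[OF p c mn(2)] sum_divide_distrib mult.commute)
  also have "\<dots> = (\<Sum>b<m. if p b = p' b then (hs_dist n (k b) (k' b))\<^sup>2 else 2) / m"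
    using mn c frob_unitary[OF u(1)] frob_unitary[OF u(2)]
    by (intro arg_cong[of _ _ "\<lambda>x. x / real m"] sum.cong) (auto simp: hs_dist_frob frob_nonneg)
  finally show ?thesis .
qed

text \<open>
  Here the square of the distance is the average over the blocks. Distances of unitary matrices are at
  most \<open>2\<close>, so their squares are at most four times the truncated distances, and the Cauchy-Schwarz
  inequality bounds the square of an average by the average of the squares.
\<close>

lemma unitary_monomial:
  assumes n: "0 < n" and m: "0 < m"
  shows "monomial_hom m (unitary_group n, hs_dist n) (unitary_group (m * n), hs_dist (m * n))
    (\<lambda>(k, p). block_monomial m n k p)"
proof (rule monomial_hom_of_average_bounds[OF m])
  let ?U = "unitary_group n" and ?PW = "perm_wreath (unitary_group n) {..<m}"
  let ?V = "unitary_group (m * n)" and ?M = "block_monomial m n"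
  have car: "k b \<in> carrier ?U" if "(k, p) \<in> carrier ?PW" "b < m" for k p b
    using that by (auto simp: carrier_perm_wreath)
  show "(\<lambda>(k, p). ?M k p) \<in> hom ?PW ?V"
  proof (rule block_monomial_hom[OF _ unitary_mult unitary_mult])
    show "x \<in> carrier_mat n n" if "x \<in> carrier ?U" for x
      using that by (simp add: unitary_carrier)
    show "?M k p \<in> carrier ?V" if "(k, p) \<in> carrier ?PW" for k p
      using car[OF that] that by (intro block_monomial_unitary) (auto simp: carrier_perm_wreath)
  qed
  have d: "0 \<le> hs_dist n A B" "hs_dist n A B \<le> 2" if "A \<in> carrier ?U" "B \<in> carrier ?U" for A B
    using hs_dist_unitary_le_2[OF that n] that by (auto simp: hs_dist_frob frob_nonneg unitary_carrier)
  have PW: "group ?PW" by (intro group_perm_wreath group_unitary_group)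
  note dist = hs_dist_block_monomial[OF _ _ m n]
  have one: "(\<lambda>b\<in>{..<m}. 1\<^sub>m n, \<lambda>b\<in>{..<m}. b) \<in> carrier ?PW" "1\<^sub>m n \<in> carrier ?U"
    using monoid.one_closed[OF group.is_monoid[OF PW]] monoid.one_closed[OF group.is_monoid[OF group_unitary_group[of n]]]
    by (simp_all only: one_perm_wreath unitary_one)
  have M1: "\<one>\<^bsub>?V\<^esub> = ?M (\<lambda>b\<in>{..<m}. 1\<^sub>m n) (\<lambda>b\<in>{..<m}. b)"
    unfolding unitary_one block_monomial_one[symmetric] by (intro block_monomial_cong) auto
  have nonneg: "0 \<le> hs_dist (m * n) (?M k p) \<one>\<^bsub>?V\<^esub>" for k p
    unfolding M1 by (simp add: hs_dist_frob[OF block_monomial_carrier block_monomial_carrier] frob_nonneg)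
  have dist1: "(hs_dist (m * n) (?M k p) \<one>\<^bsub>?V\<^esub>)\<^sup>2
      = (\<Sum>b<m. if p b = b then (hs_dist n (k b) (1\<^sub>m n))\<^sup>2 else 2) / m" if "(k, p) \<in> carrier ?PW" for k p
    unfolding M1 dist[OF that one(1)] by (intro arg_cong[of _ _ "\<lambda>x. x / real m"] sum.cong) auto
  show "0 \<le> hs_dist n A \<one>\<^bsub>?U\<^esub>" if "A \<in> carrier ?U" for A
    using d(1)[OF that one(2)] by (simp add: unitary_one)
  show "hs_dist (m * n) (case (k, p) of (k, p) \<Rightarrow> ?M k p) (case (k', p') of (k, p) \<Rightarrow> ?M k p)
      \<le> 2 * sqrt ((\<Sum>b<m. if p b = p' b then min 1 (hs_dist n (k b) (k' b)) else 1) / real m)"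
    if kp: "(k, p) \<in> carrier ?PW" "(k', p') \<in> carrier ?PW" for k p k' p'
  proof -
    have "t\<^sup>2 \<le> 4 * min 1 t" if "0 \<le> t" "t \<le> 2" for t :: real
      using mult_mono[of t 1 t t] mult_mono[of t 2 t 2] that by (auto simp: power2_eq_square min_def)
    then have "(\<Sum>b<m. if p b = p' b then (hs_dist n (k b) (k' b))\<^sup>2 else 2)
        \<le> (\<Sum>b<m. 4 * (if p b = p' b then min 1 (hs_dist n (k b) (k' b)) else 1))"
      using d[OF car[OF kp(1)] car[OF kp(2)]] by (intro sum_mono) auto
    then have "(hs_dist (m * n) (?M k p) (?M k' p'))\<^sup>2
        \<le> 4 * ((\<Sum>b<m. if p b = p' b then min 1 (hs_dist n (k b) (k' b)) else 1) / real m)"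
      unfolding dist[OF kp] sum_distrib_left[symmetric] times_divide_eq_right by (intro divide_right_mono) auto
    then have "hs_dist (m * n) (?M k p) (?M k' p')
        \<le> sqrt (4 * ((\<Sum>b<m. if p b = p' b then min 1 (hs_dist n (k b) (k' b)) else 1) / real m))"
      by (rule real_le_rsqrt)
    then show ?thesis by (simp only: real_sqrt_mult real_sqrt_four prod.case)
  qed
  show "real (card {b\<in>{..<m}. p b \<noteq> b}) / (3 * real m) \<le> hs_dist (m * n) (case (k, p) of (k, p) \<Rightarrow> ?M k p) \<one>\<^bsub>?V\<^esub>"
    if kp: "(k, p) \<in> carrier ?PW" for k p
  proof -
    define s where "s = real (card {b\<in>{..<m}. p b \<noteq> b}) / m"
    have "card {b\<in>{..<m}. p b \<noteq> b} \<le> card {..<m}" by (intro card_mono) auto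
    then have s: "0 \<le> s" "s \<le> 1" using m by (simp_all add: s_def)
    have "real (card {b\<in>{..<m}. p b \<noteq> b}) = (\<Sum>b<m. if p b = b then 0 else 1)"
      by (simp add: sum.If_cases Int_def)
    also have "\<dots> \<le> (\<Sum>b<m. if p b = b then (hs_dist n (k b) (1\<^sub>m n))\<^sup>2 else 2)"
      by (intro sum_mono) auto
    finally have "s \<le> (hs_dist (m * n) (?M k p) \<one>\<^bsub>?V\<^esub>)\<^sup>2"
      unfolding dist1[OF kp] s_def by (intro divide_right_mono) auto
    moreover have "(s / 3)\<^sup>2 \<le> s" using mult_left_mono[of s 1 s] s by (simp add: power2_eq_square)
    ultimately have "(s / 3)\<^sup>2 \<le> (hs_dist (m * n) (?M k p) \<one>\<^bsub>?V\<^esub>)\<^sup>2" by linarith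
    then have "s / 3 \<le> hs_dist (m * n) (?M k p) \<one>\<^bsub>?V\<^esub>" by (rule power2_le_imp_le) (rule nonneg)
    then show ?thesis by (simp add: s_def mult.commute)
  qed
  show "(\<Sum>b<m. min 1 (hs_dist n (k b) \<one>\<^bsub>?U\<^esub>)) / real m
      \<le> hs_dist (m * n) (case (k, \<lambda>b\<in>{..<m}. b) of (k, p) \<Rightarrow> ?M k p) \<one>\<^bsub>?V\<^esub>"
    if k: "k \<in> {..<m} \<rightarrow>\<^sub>E carrier ?U" for k
  proof -
    let ?t = "\<lambda>b. min 1 (hs_dist n (k b) \<one>\<^bsub>?U\<^esub>)"
    have kp: "(k, \<lambda>b\<in>{..<m}. b) \<in> carrier ?PW" using k by (auto simp: carrier_perm_wreath id_Bij)
    have "(\<Sum>b<m. ?t b)\<^sup>2 \<le> (\<Sum>b<m. (?t b)\<^sup>2) * m"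
      using sum_squared_le_sum_of_squares[of ?t "{..<m}"] by simp
    then have "((\<Sum>b<m. ?t b) / m)\<^sup>2 \<le> (\<Sum>b<m. (?t b)\<^sup>2) / m"
      using m by (simp add: power_divide power2_eq_square divide_simps)
    also have "\<dots> \<le> (\<Sum>b<m. if (\<lambda>b\<in>{..<m}. b) b = b then (hs_dist n (k b) (1\<^sub>m n))\<^sup>2 else 2) / m"
      using d[OF car[OF kp] one(2)] by (intro divide_right_mono sum_mono) (auto simp: unitary_one intro!: power_mono)
    finally have "((\<Sum>b<m. ?t b) / m)\<^sup>2 \<le> (hs_dist (m * n) (?M k (\<lambda>b\<in>{..<m}. b)) \<one>\<^bsub>?V\<^esub>)\<^sup>2"
      unfolding dist1[OF kp] .
    then show ?thesis unfolding prod.case by (rule power2_le_imp_le) (rule nonneg)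
  qed
qed

lemma wreath_closed_unitary_groups: "wreath_closed unitary_groups"
proof (rule wreath_closed.intro)
  fix K d assume K: "(K, d) \<in> unitary_groups"
  then obtain n where n: "0 < n" "K = unitary_group n" "d = hs_dist n"
    by (auto simp: unitary_groups_def Suc_le_eq)
  show "group K" unfolding n by (rule group_unitary_group)
  show "pseudometric_on (carrier K) d"
    using pseudometric_hs[of n] unfolding n pseudometric_on_def by (auto simp: unitary_carrier)
  show "\<exists>M D \<Psi>. (M, D) \<in> unitary_groups \<and> monomial_hom m (K, d) (M, D) \<Psi>" if m: "0 < m" for m
  proof -
    have "(unitary_group (m * n), hs_dist (m * n)) \<in> unitary_groups"
      unfolding unitary_groups_def using n m by (auto simp: Suc_le_eq)
    then show ?thesis using unitary_monomial[OF n(1) m] unfolding n by blast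
  qed
next
  fix K1 d1 K2 d2 assume "(K1, d1) \<in> unitary_groups" "(K2, d2) \<in> unitary_groups"
  then obtain m n where m: "0 < m" "K1 = unitary_group m" "d1 = hs_dist m"
    and n: "0 < n" "K2 = unitary_group n" "d2 = hs_dist n"
    by (auto simp: unitary_groups_def Suc_le_eq)
  have "(\<lambda>(A, B). kron A B) \<in> hom (unitary_group m \<times>\<times> unitary_group n) (unitary_group (m * n))"
  proof (rule homI)
    fix x y assume xy: "x \<in> carrier (unitary_group m \<times>\<times> unitary_group n)" "y \<in> carrier (unitary_group m \<times>\<times> unitary_group n)"
    show "(case x of (A, B) \<Rightarrow> kron A B) \<in> carrier (unitary_group (m * n))"
      using xy by (cases x) (auto intro: kron_unitary)
    show "(case x \<otimes>\<^bsub>unitary_group m \<times>\<times> unitary_group n\<^esub> y of (A, B) \<Rightarrow> kron A B)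
        = (case x of (A, B) \<Rightarrow> kron A B) \<otimes>\<^bsub>unitary_group (m * n)\<^esub> (case y of (A, B) \<Rightarrow> kron A B)"
      using xy by (cases x; cases y) (auto simp: unitary_mult unitary_carrier kron_mult)
  qed
  then have "tensor_hom (K1, d1) (K2, d2) (unitary_group (m * n), hs_dist (m * n)) (\<lambda>(A, B). kron A B)"
    using m n unfolding tensor_hom_def by (auto intro: hs_dist_kron)
  moreover have "(unitary_group (m * n), hs_dist (m * n)) \<in> unitary_groups"
    unfolding unitary_groups_def using n m by (auto simp: Suc_le_eq)
  ultimately show "\<exists>L d T. (L, d) \<in> unitary_groups \<and> tensor_hom (K1, d1) (K2, d2) (L, d) T"
    by blast
qed

section \<open>Rank\<close>

definition coord_proj :: "nat \<Rightarrow> nat set \<Rightarrow> 'a::field mat" where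
  "coord_proj n S = mat n n (\<lambda>(i, j). if i = j \<and> i \<in> S then 1 else 0)"

lemma coord_proj_carrier [simp]: "coord_proj n S \<in> carrier_mat n n"
  by (simp add: coord_proj_def)

lemma coord_proj_entry: "i < n \<Longrightarrow> j < n \<Longrightarrow> coord_proj n S $$ (i, j) = (if i = j \<and> i \<in> S then 1 else 0)"
  by (simp add: coord_proj_def)

lemma sandwich_entry:
  fixes P Q :: "'a::field mat"
  assumes P: "P \<in> carrier_mat n n" and Q: "Q \<in> carrier_mat n n" and S: "S \<subseteq> {..<n}" and ij: "i < n" "j < n"
  shows "(P * coord_proj n S * Q) $$ (i, j) = (\<Sum>s\<in>S. P $$ (i, s) * Q $$ (s, j))"
proof -
  have "(P * coord_proj n S) $$ (i, l) = (if l \<in> S then P $$ (i, l) else 0)" if l: "l < n" for l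
  proof -
    have "(P * coord_proj n S) $$ (i, l) = (\<Sum>u<n. P $$ (i, u) * coord_proj n S $$ (u, l))"
      by (rule mat_mult_entry[OF P coord_proj_carrier ij(1) l])
    also have "\<dots> = (\<Sum>u<n. if u = l then (if l \<in> S then P $$ (i, l) else 0) else 0)"
      using l by (intro sum.cong) (auto simp: coord_proj_entry)
    finally show ?thesis using l by simp
  qed
  then have "(P * coord_proj n S * Q) $$ (i, j) = (\<Sum>l<n. (if l \<in> S then P $$ (i, l) else 0) * Q $$ (l, j))"
    using mat_mult_entry[OF mult_carrier_mat[OF P coord_proj_carrier] Q ij] by simp
  also have "\<dots> = (\<Sum>l\<in>S. P $$ (i, l) * Q $$ (l, j))"
    using S by (intro sum.mono_neutral_cong_right) auto
  finally show ?thesis .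
qed

text \<open>
  The coordinate projection is a sum of projections to single coordinates, each of which contributes
  a matrix of rank at most one.
\<close>

lemma rank_sandwich_le:
  fixes P Q :: "'a::field mat"
  assumes P: "P \<in> carrier_mat n n" and Q: "Q \<in> carrier_mat n n" and S: "S \<subseteq> {..<n}"
  shows "vec_space.rank n (P * coord_proj n S * Q) \<le> card S"
proof -
  interpret vec_space "TYPE('a)" n .
  have "finite S" using S finite_subset by blast
  then show ?thesis using S
  proof (induction S)
    case empty
    have "P * coord_proj n {} * Q = 0\<^sub>m n n"
    proof (rule eq_matI)
      fix i j assume "i < dim_row (0\<^sub>m n n :: 'a mat)" "j < dim_col (0\<^sub>m n n :: 'a mat)"
      then show "(P * coord_proj n {} * Q) $$ (i, j) = 0\<^sub>m n n $$ (i, j)"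
        using sandwich_entry[OF P Q empty_subsetI, of i j] by simp
    qed (use P Q in auto)
    then show ?case by (simp add: rank_0I)
  next
    case (insert s S)
    have s: "{s} \<subseteq> {..<n}" "S \<subseteq> {..<n}" using insert by auto
    have c: "P * coord_proj n T * Q \<in> carrier_mat n n" for T
      using P Q by (meson coord_proj_carrier mult_carrier_mat)
    have "P * coord_proj n (insert s S) * Q = P * coord_proj n S * Q + P * coord_proj n {s} * Q"
    proof (rule eq_matI)
      fix i j assume "i < dim_row (P * coord_proj n S * Q + P * coord_proj n {s} * Q)"
        "j < dim_col (P * coord_proj n S * Q + P * coord_proj n {s} * Q)"
      then have ij: "i < n" "j < n" using P Q by auto
      show "(P * coord_proj n (insert s S) * Q) $$ (i, j) = (P * coord_proj n S * Q + P * coord_proj n {s} * Q) $$ (i, j)"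
        using ij carrier_matD[OF c[of S]] carrier_matD[OF c[of "{s}"]] insert(1,2)
        by (simp add: sandwich_entry[OF P Q insert(4) ij] sandwich_entry[OF P Q s(1) ij] sandwich_entry[OF P Q s(2) ij])
    qed (use P Q in auto)
    then have "rank (P * coord_proj n (insert s S) * Q) \<le> rank (P * coord_proj n S * Q) + rank (P * coord_proj n {s} * Q)"
      using rank_subadditive[OF c c] by simp
    also have "rank (P * coord_proj n {s} * Q) \<le> 1"
    proof (rule rank_le_1_product_entries[OF c])
      fix i j assume "i < dim_row (P * coord_proj n {s} * Q)" "j < dim_col (P * coord_proj n {s} * Q)"
      then have "i < n" "j < n" using P Q by auto
      then show "(P * coord_proj n {s} * Q) $$ (i, j) = P $$ (i, s) * Q $$ (s, j)"
        using sandwich_entry[OF P Q s(1)] by simp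
    qed
    finally show ?case using insert by simp
  qed
qed

text \<open>
  The projections to \<open>S\<close> and to its complement add up to the identity, which has full rank.
\<close>

lemma rank_coord_proj_ge:
  assumes S: "S \<subseteq> {..<n}"
  shows "card S \<le> vec_space.rank n (coord_proj n S :: 'a::field mat)"
proof -
  interpret vec_space "TYPE('a)" n .
  have "coord_proj n S + coord_proj n ({..<n} - S) = (1\<^sub>m n :: 'a mat)"
    by (rule eq_matI) (auto simp: coord_proj_def)
  then have "rank (1\<^sub>m n) \<le> rank (coord_proj n S :: 'a mat) + rank (coord_proj n ({..<n} - S) :: 'a mat)"
    using rank_subadditive[of "coord_proj n S" n "coord_proj n ({..<n} - S)"] by simp
  moreover have "rank (1\<^sub>m n) = n"
    by (rule low_rank_det_zero) auto
  moreover have "rank (coord_proj n ({..<n} - S) :: 'a mat) \<le> n - card S"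
  proof -
    have "1\<^sub>m n * coord_proj n ({..<n} - S) * 1\<^sub>m n = (coord_proj n ({..<n} - S) :: 'a mat)"
      by (simp add: left_mult_one_mat[of _ n n] right_mult_one_mat[of _ n n])
    then have "rank (coord_proj n ({..<n} - S) :: 'a mat) \<le> card ({..<n} - S)"
      using rank_sandwich_le[of "1\<^sub>m n :: 'a mat" n "1\<^sub>m n" "{..<n} - S"] by simp
    then show ?thesis using S by (simp add: card_Diff_subset finite_subset[OF S])
  qed
  moreover have "card S \<le> n" using card_mono[OF _ S] by simp
  ultimately show ?thesis by linarith
qed

text \<open>
  The columns of \<open>P\<close> are a maximal independent set of columns of \<open>A\<close>, and \<open>Q\<close> expresses the columns
  of \<open>A\<close> by them. Square matrices, padded by zeros, are easier to combine into blocks than rectangular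
  ones.
\<close>

lemma rank_factorization:
  fixes A :: "'a::field mat"
  assumes A: "A \<in> carrier_mat n n"
  shows "\<exists>P Q S. P \<in> carrier_mat n n \<and> Q \<in> carrier_mat n n \<and> S \<subseteq> {..<n} \<and> card S = vec_space.rank n A \<and>
    A = P * coord_proj n S * Q"
proof -
  interpret vec_space "TYPE('a)" n .
  have fin: "finite (set (cols A))" and sub: "set (cols A) \<subseteq> carrier_vec n"
    using A cols_dim[of A] by auto
  obtain U where U: "maximal U (\<lambda>T. T \<subseteq> set (cols A) \<and> lin_indpt T)"
    using maximal_exists_superset[OF fin, of "\<lambda>T. T \<subseteq> set (cols A) \<and> lin_indpt T" "{}"] finite_lin_indpt2
    by (metis (no_types, lifting) empty_iff empty_subsetI finite.emptyI)
  have Us: "U \<subseteq> set (cols A)" "lin_indpt U" using U unfolding maximal_def by auto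
  have Uc: "U \<subseteq> carrier_vec n" "finite U" using Us sub fin finite_subset by auto
  have r: "rank A = card U" by (rule rank_card_indpt[OF A U])
  have "card U \<le> n" using r rank_le_nc[OF A] by simp
  have inspan: "c \<in> span U" if c: "c \<in> set (cols A)" for c
  proof (cases "c \<in> U")
    case True
    then show ?thesis using in_own_span[of U] Uc by auto
  next
    case False
    have "lin_dep (U \<union> {c})"
    proof (rule ccontr)
      assume "\<not> lin_dep (U \<union> {c})"
      then show False using U c Us False unfolding maximal_def by auto
    qed
    then show ?thesis using lin_dep_iff_in_span[of U c] Uc Us c sub False by auto
  qed
  obtain us where us: "set us = U" "distinct us" using finite_distinct_list[OF Uc(2)] by blast
  have len: "length us = card U" using us distinct_card by metis
  define P0 where "P0 = mat_of_cols n us"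
  have P0: "P0 \<in> carrier_mat n (card U)" and colsP0: "cols P0 = us"
    using us Uc len by (auto simp: P0_def)
  have "\<exists>v. v \<in> carrier_vec (card U) \<and> c = P0 *\<^sub>v v" if c: "c \<in> set (cols A)" for c
  proof -
    obtain a where a: "lincomb a U = c"
      using finite_in_span[OF Uc(2) _ inspan[OF c]] Uc by auto
    have "P0 *\<^sub>v (vec (card U) (\<lambda>i. a (col P0 i))) = lincomb a (set (cols P0))"
      by (rule mat_mult_eq_lincomb[OF P0]) (use us colsP0 in auto)
    then show ?thesis using a us colsP0 by (intro exI[of _ "vec (card U) (\<lambda>i. a (col P0 i))"]) auto
  qed
  then obtain w where w: "\<And>c. c \<in> set (cols A) \<Longrightarrow> w c \<in> carrier_vec (card U) \<and> c = P0 *\<^sub>v w c"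
    by metis
  define P where "P = mat n n (\<lambda>(i, l). if l < card U then P0 $$ (i, l) else 0)"
  define Q where "Q = mat n n (\<lambda>(l, j). if l < card U then w (col A j) $ l else 0)"
  have PQ: "P \<in> carrier_mat n n" "Q \<in> carrier_mat n n" by (auto simp: P_def Q_def)
  have S: "{..<card U} \<subseteq> {..<n}" using \<open>card U \<le> n\<close> by auto
  have "A = P * coord_proj n {..<card U} * Q"
  proof (rule eq_matI)
    fix i j assume "i < dim_row (P * coord_proj n {..<card U} * Q)" "j < dim_col (P * coord_proj n {..<card U} * Q)"
    then have ij: "i < n" "j < n" by (auto simp: P_def Q_def)
    have cj: "col A j \<in> set (cols A)" using ij A by (auto simp: cols_def)
    have "A $$ (i, j) = col A j $ i" using ij A by auto
    also have "\<dots> = (P0 *\<^sub>v w (col A j)) $ i" using w[OF cj] by auto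
    also have "\<dots> = (\<Sum>l<card U. P0 $$ (i, l) * w (col A j) $ l)"
    proof -
      have "(P0 *\<^sub>v v) $ i = (\<Sum>l<card U. P0 $$ (i, l) * v $ l)" if "v \<in> carrier_vec (card U)" for v
        using ij P0 that by (simp add: scalar_prod_def atLeast0LessThan)
      then show ?thesis using w[OF cj] by blast
    qed
    also have "\<dots> = (P * coord_proj n {..<card U} * Q) $$ (i, j)"
      unfolding sandwich_entry[OF PQ S ij] using ij S by (intro sum.cong) (auto simp: P_def Q_def)
    finally show "A $$ (i, j) = (P * coord_proj n {..<card U} * Q) $$ (i, j)" .
  qed (use A PQ in auto)
  then show ?thesis using PQ S r by (metis card_lessThan)
qed

lemma mat_assoc4:
  fixes A B C D :: "'a::semiring_0 mat"
  assumes "A \<in> carrier_mat n n" "B \<in> carrier_mat n n" "C \<in> carrier_mat n n" "D \<in> carrier_mat n n" "E \<in> carrier_mat n n"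
  shows "A * (B * C * D) * E = (A * B) * C * (D * E)"
  using assms by (simp add: assoc_mult_mat[of _ n n _ n _ n])

lemma rank_ge_compression:
  fixes A :: "'a::field mat"
  assumes A: "A \<in> carrier_mat n n" and X: "X \<in> carrier_mat n n" and Y: "Y \<in> carrier_mat n n"
    and S: "S \<subseteq> {..<n}" and eq: "X * A * Y = coord_proj n S"
  shows "card S \<le> vec_space.rank n A"
proof -
  obtain P Q T where PQ: "P \<in> carrier_mat n n" "Q \<in> carrier_mat n n" "T \<subseteq> {..<n}" "card T = vec_space.rank n A"
    and fact: "A = P * coord_proj n T * Q"
    using rank_factorization[OF A] by blast
  have "coord_proj n S = (X * P) * coord_proj n T * (Q * Y)"
    unfolding eq[symmetric] fact using X PQ Y by (intro mat_assoc4) auto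
  then have "vec_space.rank n (coord_proj n S :: 'a mat) \<le> card T"
    using rank_sandwich_le[of "X * P" n "Q * Y" T] X Y PQ by auto
  then show ?thesis using rank_coord_proj_ge[OF S, where 'a = 'a] PQ(4) by linarith
qed

text \<open>
  The factorization bounds the rank of matrices built from \<open>A\<close> from above, the compression bounds it
  from below. Both come from the reduced row echelon form \<open>E = X * A\<close>: \<open>S\<close> is the set of its nonzero
  rows, and \<open>Y\<close> selects its pivot columns, which are unit vectors.
\<close>

lemma rank_normal_form:
  fixes A :: "'a::field mat"
  assumes A: "A \<in> carrier_mat n n"
  shows "\<exists>S P Q X Y. S \<subseteq> {..<n} \<and> card S = vec_space.rank n A \<and>
    P \<in> carrier_mat n n \<and> Q \<in> carrier_mat n n \<and> X \<in> carrier_mat n n \<and> Y \<in> carrier_mat n n \<and>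
    A = P * coord_proj n S * Q \<and> X * A * Y = coord_proj n S"
proof -
  define E where "E = gauss_jordan_single A"
  note gj = gauss_jordan_single[OF A E_def[symmetric]]
  have E: "E \<in> carrier_mat n n" by (rule gj(2))
  obtain X Q where XQ: "E = X * A" "X \<in> carrier_mat n n" "Q \<in> carrier_mat n n" "Q * X = 1\<^sub>m n"
    using gj(4) by blast
  obtain f where f: "pivot_fun E f n" using gj(3) E unfolding row_echelon_form_def by auto
  have dE: "dim_row E = n" using E by auto
  note piv = pivot_funD[OF dE f]
  define S where "S = {i\<in>{..<n}. f i < n}"
  have S: "S \<subseteq> {..<n}" by (auto simp: S_def)
  define Y where "Y = mat n n (\<lambda>(j, i). if i \<in> S \<and> j = f i then 1 else 0 :: 'a)"
  have Y: "Y \<in> carrier_mat n n" by (simp add: Y_def)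
  have "Q * coord_proj n S * E = A"
  proof -
    have "coord_proj n S * E = E"
    proof (rule eq_matI)
      fix i j assume ij: "i < dim_row E" "j < dim_col E"
      then have ij: "i < n" "j < n" using E by auto
      have "(coord_proj n S * E) $$ (i, j) = (\<Sum>l<n. coord_proj n S $$ (i, l) * E $$ (l, j))"
        by (rule mat_mult_entry[OF coord_proj_carrier E ij])
      also have "\<dots> = (\<Sum>l<n. if l = i then (if i \<in> S then E $$ (i, j) else 0) else 0)"
        using ij by (intro sum.cong) (auto simp: coord_proj_entry)
      also have "\<dots> = (if i \<in> S then E $$ (i, j) else 0)" using ij by simp
      also have "\<dots> = E $$ (i, j)"
        using piv(1)[OF ij(1)] piv(2)[OF ij(1), of j] ij by (auto simp: S_def)
      finally show "(coord_proj n S * E) $$ (i, j) = E $$ (i, j)" .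
    qed (use E in \<open>auto simp: coord_proj_def\<close>)
    then have "Q * coord_proj n S * E = Q * E"
      using XQ E by (simp add: assoc_mult_mat[of _ n n _ n _ n])
    also have "\<dots> = A" using XQ A by (simp flip: assoc_mult_mat[of _ n n _ n _ n])
    finally show ?thesis .
  qed
  moreover have "X * A * Y = coord_proj n S"
  proof (rule eq_matI)
    fix i j assume "i < dim_row (coord_proj n S :: 'a mat)" "j < dim_col (coord_proj n S :: 'a mat)"
    then have ij: "i < n" "j < n" by (auto simp: coord_proj_def)
    have "(E * Y) $$ (i, j) = (\<Sum>l<n. E $$ (i, l) * Y $$ (l, j))"
      by (rule mat_mult_entry[OF E Y ij])
    also have "\<dots> = (\<Sum>l<n. if l = f j then (if j \<in> S then E $$ (i, f j) else 0) else 0)"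
      using ij by (intro sum.cong) (auto simp: Y_def)
    also have "\<dots> = (if j \<in> S then E $$ (i, f j) else 0)" by (auto simp: S_def)
    also have "\<dots> = coord_proj n S $$ (i, j)"
      using piv(4)[OF ij(2)] piv(5)[OF ij(2) _ ij(1)] ij by (auto simp: coord_proj_entry S_def)
    finally show "(X * A * Y) $$ (i, j) = coord_proj n S $$ (i, j)" using XQ by simp
  qed (use XQ Y in \<open>auto simp: coord_proj_def\<close>)
  moreover have "card S = vec_space.rank n A"
  proof (rule antisym)
    show "card S \<le> vec_space.rank n A" by (rule rank_ge_compression[OF A XQ(2) Y S]) fact
    show "vec_space.rank n A \<le> card S" using rank_sandwich_le[OF XQ(3) E S] \<open>Q * coord_proj n S * E = A\<close> by simp
  qed
  ultimately show ?thesis using S XQ E Y by metis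
qed

lemma rank_le_dim: "A \<in> carrier_mat n n \<Longrightarrow> vec_space.rank n A \<le> n"
  by (rule vec_space.rank_le_nc)

lemma rank_uminus_le:
  fixes A B :: "'a::field mat"
  assumes A: "A \<in> carrier_mat n n" and B: "B \<in> carrier_mat n n"
  shows "vec_space.rank n (B - A) \<le> vec_space.rank n (A - B)"
proof -
  have AB: "A - B \<in> carrier_mat n n" using A B by auto
  obtain P Q S where PQ: "P \<in> carrier_mat n n" "Q \<in> carrier_mat n n" "S \<subseteq> {..<n}" "card S = vec_space.rank n (A - B)"
    and fact: "A - B = P * coord_proj n S * Q"
    using rank_factorization[OF AB] by blast
  have "B - A = - (A - B)" using A B by (intro eq_matI) auto
  also have "\<dots> = (- P) * coord_proj n S * Q"
    unfolding fact
  proof (rule eq_matI)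
    have nP: "- P \<in> carrier_mat n n" using PQ by simp
    fix i j assume "i < dim_row (- P * coord_proj n S * Q)" "j < dim_col (- P * coord_proj n S * Q)"
    then have ij: "i < n" "j < n" using PQ by auto
    have "s < n" if "s \<in> S" for s using PQ(3) that by auto
    have "P * coord_proj n S * Q \<in> carrier_mat n n" using PQ by (meson coord_proj_carrier mult_carrier_mat)
    then have "(- (P * coord_proj n S * Q)) $$ (i, j) = - (P * coord_proj n S * Q) $$ (i, j)"
      using ij by (intro index_uminus_mat) auto
    also have "\<dots> = (\<Sum>s\<in>S. (- P) $$ (i, s) * Q $$ (s, j))"
      unfolding sandwich_entry[OF PQ(1-3) ij] sum_negf[symmetric]
      using ij PQ(1) \<open>\<And>s. s \<in> S \<Longrightarrow> s < n\<close> by (intro sum.cong) auto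
    also have "\<dots> = (- P * coord_proj n S * Q) $$ (i, j)"
      by (rule sandwich_entry[OF nP PQ(2,3) ij, symmetric])
    finally show "(- (P * coord_proj n S * Q)) $$ (i, j) = (- P * coord_proj n S * Q) $$ (i, j)" .
  qed (use PQ in auto)
  finally have "vec_space.rank n (B - A) \<le> card S"
    using rank_sandwich_le[of "- P" n Q S] PQ by auto
  then show ?thesis using PQ by simp
qed

lemma pseudometric_rank: "pseudometric_on (carrier_mat n n) (rank_dist n :: 'a::field mat \<Rightarrow> 'a mat \<Rightarrow> real)"
  unfolding pseudometric_on_def
proof (intro conjI ballI)
  interpret vec_space "TYPE('a)" n .
  fix A :: "'a mat" assume A: "A \<in> carrier_mat n n"
  have "A - A = 0\<^sub>m n n" using A by (intro eq_matI) auto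
  then show "rank_dist n A A = 0" by (simp add: rank_dist_def rank_0I)
  fix B :: "'a mat" assume B: "B \<in> carrier_mat n n"
  show "rank_dist n A B = rank_dist n B A"
    using rank_uminus_le[OF A B] rank_uminus_le[OF B A] by (simp add: rank_dist_def)
  fix C :: "'a mat" assume C: "C \<in> carrier_mat n n"
  have "A - C = (A - B) + (B - C)" using A B C by (intro eq_matI) auto
  then have "rank (A - C) \<le> rank (A - B) + rank (B - C)"
    using rank_subadditive[OF minus_carrier_mat[OF B, of A] minus_carrier_mat[OF C, of B]] by simp
  then show "rank_dist n A C \<le> rank_dist n A B + rank_dist n B C"
    unfolding rank_dist_def add_divide_distrib[symmetric] by (intro divide_right_mono) auto
qed

lemma card_div_mod:
  fixes m n :: nat
  assumes n: "0 < n"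
  shows "card {i\<in>{..<m * n}. R (i div n) (i mod n)} = (\<Sum>b<m. card {x\<in>{..<n}. R b x})"
proof -
  have "card {i\<in>{..<m * n}. R (i div n) (i mod n)} = (\<Sum>i<m * n. if R (i div n) (i mod n) then 1 else 0)"
    unfolding card_eq_sum by (rule sum.inter_filter) simp
  also have "\<dots> = (\<Sum>b<m. \<Sum>x<n. if R b x then 1 else 0)"
    by (rule sum_div_mod[OF n])
  also have "\<dots> = (\<Sum>b<m. card {x\<in>{..<n}. R b x})"
    unfolding card_eq_sum by (intro sum.cong refl sum.inter_filter[symmetric]) simp
  finally show ?thesis .
qed

lemma card_blocks:
  fixes m n :: nat
  assumes "0 < n" "\<And>b. b < m \<Longrightarrow> S b \<subseteq> {..<n}"
  shows "card {i\<in>{..<m * n}. i mod n \<in> S (i div n)} = (\<Sum>b<m. card (S b))"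
proof -
  have "card {i\<in>{..<m * n}. i mod n \<in> S (i div n)} = (\<Sum>b<m. card {x\<in>{..<n}. x \<in> S b})"
    by (rule card_div_mod[OF assms(1)])
  also have "\<dots> = (\<Sum>b<m. card (S b))"
  proof (rule sum.cong)
    fix b assume "b \<in> {..<m}"
    then have "{x\<in>{..<n}. x \<in> S b} = S b" using assms(2)[of b] by auto
    then show "card {x\<in>{..<n}. x \<in> S b} = card (S b)" by simp
  qed simp
  finally show ?thesis .
qed

lemma coord_proj_all: "coord_proj n {..<n} = 1\<^sub>m n"
  by (rule eq_matI) (auto simp: coord_proj_def)

lemma coord_proj_empty: "coord_proj n {} = 0\<^sub>m n n"
  by (rule eq_matI) (auto simp: coord_proj_def)

lemma block_monomial_coord_proj:
  "block_monomial m n (\<lambda>b. coord_proj n (S b)) (\<lambda>b. b) = (coord_proj (m * n) {i\<in>{..<m * n}. i mod n \<in> S (i div n)} :: 'a::field mat)"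
proof (rule eq_matI)
  fix i j assume "i < dim_row (coord_proj (m * n) {i\<in>{..<m * n}. i mod n \<in> S (i div n)} :: 'a mat)"
    "j < dim_col (coord_proj (m * n) {i\<in>{..<m * n}. i mod n \<in> S (i div n)} :: 'a mat)"
  then have ij: "i < m * n" "j < m * n" by (auto simp: coord_proj_def)
  then have n: "0 < n" by (cases n) auto
  have "i div n = j div n \<and> i mod n = j mod n \<longleftrightarrow> i = j" by (metis div_mult_mod_eq)
  then show "block_monomial m n (\<lambda>b. coord_proj n (S b)) (\<lambda>b. b) $$ (i, j)
      = (coord_proj (m * n) {i\<in>{..<m * n}. i mod n \<in> S (i div n)} :: 'a mat) $$ (i, j)"
    using ij n by (auto simp: block_monomial_def coord_proj_entry)
qed (auto simp: block_monomial_def coord_proj_def)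

text \<open>
  Factor each block; the factors form two block monomial matrices around one coordinate projection.
\<close>

lemma rank_block_monomial_le:
  fixes \<Delta> :: "nat \<Rightarrow> 'a::field mat"
  assumes n: "0 < n" and \<Delta>: "\<And>b. b < m \<Longrightarrow> \<Delta> b \<in> carrier_mat n n"
  shows "vec_space.rank (m * n) (block_monomial m n \<Delta> p) \<le> (\<Sum>b<m. vec_space.rank n (\<Delta> b))"
proof -
  have "\<forall>b. \<exists>P Q S. b < m \<longrightarrow> P \<in> carrier_mat n n \<and> Q \<in> carrier_mat n n \<and> S \<subseteq> {..<n} \<and>
      card S = vec_space.rank n (\<Delta> b) \<and> \<Delta> b = P * coord_proj n S * Q"
    using rank_factorization[OF \<Delta>] by blast
  then obtain P Q S where *: "\<And>b. b < m \<Longrightarrow> P b \<in> carrier_mat n n \<and> Q b \<in> carrier_mat n n \<and> S b \<subseteq> {..<n} \<and>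
      card (S b) = vec_space.rank n (\<Delta> b) \<and> \<Delta> b = P b * coord_proj n (S b) * Q b"
    by metis
  define T where "T = {i\<in>{..<m * n}. i mod n \<in> S (i div n)}"
  have "block_monomial m n P p * coord_proj (m * n) T * block_monomial m n Q (\<lambda>b. b)
      = block_monomial m n (\<lambda>b. P b * coord_proj n (S b) * Q b) p"
    unfolding T_def block_monomial_coord_proj[symmetric] using *
    by (subst block_monomial_mult, simp_all add: mult_carrier_mat[of _ n n _ n])+
  also have "\<dots> = block_monomial m n \<Delta> p" using * by (intro block_monomial_cong) auto
  finally have "vec_space.rank (m * n) (block_monomial m n \<Delta> p) \<le> card T"
    using rank_sandwich_le[of "block_monomial m n P p" "m * n" "block_monomial m n Q (\<lambda>b. b)" T]
    by (auto simp: T_def)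
  also have "card T = (\<Sum>b<m. vec_space.rank n (\<Delta> b))"
    unfolding T_def using * by (subst card_blocks[OF n]) simp_all
  finally show ?thesis .
qed

text \<open>
  Compress each block.
\<close>

lemma rank_block_diagonal_ge:
  fixes \<Delta> :: "nat \<Rightarrow> 'a::field mat"
  assumes n: "0 < n" and \<Delta>: "\<And>b. b < m \<Longrightarrow> \<Delta> b \<in> carrier_mat n n"
  shows "(\<Sum>b<m. vec_space.rank n (\<Delta> b)) \<le> vec_space.rank (m * n) (block_monomial m n \<Delta> (\<lambda>b. b))"
proof -
  have "\<forall>b. \<exists>X Y S. b < m \<longrightarrow> X \<in> carrier_mat n n \<and> Y \<in> carrier_mat n n \<and> S \<subseteq> {..<n} \<and>
      card S = vec_space.rank n (\<Delta> b) \<and> X * \<Delta> b * Y = coord_proj n S"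
    using rank_normal_form[OF \<Delta>] by blast
  then obtain X Y S where *: "\<And>b. b < m \<Longrightarrow> X b \<in> carrier_mat n n \<and> Y b \<in> carrier_mat n n \<and> S b \<subseteq> {..<n} \<and>
      card (S b) = vec_space.rank n (\<Delta> b) \<and> X b * \<Delta> b * Y b = coord_proj n (S b)"
    by metis
  define T where "T = {i\<in>{..<m * n}. i mod n \<in> S (i div n)}"
  have "block_monomial m n X (\<lambda>b. b) * block_monomial m n \<Delta> (\<lambda>b. b) * block_monomial m n Y (\<lambda>b. b)
      = block_monomial m n (\<lambda>b. X b * \<Delta> b * Y b) (\<lambda>b. b)"
    using * \<Delta> by (subst block_monomial_mult, simp_all add: mult_carrier_mat[of _ n n _ n])+
  also have "\<dots> = coord_proj (m * n) T"
    unfolding T_def block_monomial_coord_proj[symmetric] using * by (intro block_monomial_cong) auto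
  finally have "card T \<le> vec_space.rank (m * n) (block_monomial m n \<Delta> (\<lambda>b. b))"
    by (intro rank_ge_compression[of _ _ "block_monomial m n X (\<lambda>b. b)" "block_monomial m n Y (\<lambda>b. b)"])
      (auto simp: T_def)
  also have "card T = (\<Sum>b<m. vec_space.rank n (\<Delta> b))"
    unfolding T_def using * by (subst card_blocks[OF n]) simp_all
  finally show ?thesis .
qed

lemma kron_coord_proj:
  "kron (coord_proj m S) (1\<^sub>m n) = (coord_proj (m * n) {i\<in>{..<m * n}. i div n \<in> S} :: 'a::field mat)"
  "kron (1\<^sub>m m) (coord_proj n S) = (coord_proj (m * n) {i\<in>{..<m * n}. i mod n \<in> S} :: 'a mat)"
proof -
  have b: "i div n < m" "i mod n < n" if "i < m * n" for i
    using that by (cases "n = 0"; auto simp: less_mult_imp_div_less)+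
  have eq: "i div n = j div n \<and> i mod n = j mod n \<longleftrightarrow> i = j" for i j by (metis div_mult_mod_eq)
  show "kron (coord_proj m S) (1\<^sub>m n) = (coord_proj (m * n) {i\<in>{..<m * n}. i div n \<in> S} :: 'a mat)"
  proof (rule eq_matI)
    fix i j assume "i < dim_row (coord_proj (m * n) {i\<in>{..<m * n}. i div n \<in> S} :: 'a mat)"
      "j < dim_col (coord_proj (m * n) {i\<in>{..<m * n}. i div n \<in> S} :: 'a mat)"
    then have ij: "i < m * n" "j < m * n" by (auto simp: coord_proj_def)
    show "kron (coord_proj m S) (1\<^sub>m n) $$ (i, j) = (coord_proj (m * n) {i\<in>{..<m * n}. i div n \<in> S} :: 'a mat) $$ (i, j)"
      using ij b[OF ij(1)] b[OF ij(2)] eq[of i j]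
      by (auto simp: kron_entry[OF coord_proj_carrier one_carrier_mat ij] coord_proj_entry)
  qed (auto simp: kron_def coord_proj_def)
  show "kron (1\<^sub>m m) (coord_proj n S) = (coord_proj (m * n) {i\<in>{..<m * n}. i mod n \<in> S} :: 'a mat)"
  proof (rule eq_matI)
    fix i j assume "i < dim_row (coord_proj (m * n) {i\<in>{..<m * n}. i mod n \<in> S} :: 'a mat)"
      "j < dim_col (coord_proj (m * n) {i\<in>{..<m * n}. i mod n \<in> S} :: 'a mat)"
    then have ij: "i < m * n" "j < m * n" by (auto simp: coord_proj_def)
    show "kron (1\<^sub>m m) (coord_proj n S) $$ (i, j) = (coord_proj (m * n) {i\<in>{..<m * n}. i mod n \<in> S} :: 'a mat) $$ (i, j)"
      using ij b[OF ij(1)] b[OF ij(2)] eq[of i j]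
      by (auto simp: kron_entry[OF one_carrier_mat coord_proj_carrier ij] coord_proj_entry)
  qed (auto simp: kron_def coord_proj_def)
qed

text \<open>
  With \<open>Z = P D Q\<close> the Kronecker product factors as \<open>(P \<otimes> 1) (D \<otimes> 1) (Q \<otimes> B)\<close>, and with
  \<open>X Z Y = D\<close> it is compressed to \<open>D \<otimes> 1\<close> by \<open>X \<otimes> B'\<close> and \<open>Y \<otimes> 1\<close>.
\<close>

lemma rank_kron:
  fixes Z B B' :: "'a::field mat"
  assumes n: "0 < n" and Z: "Z \<in> carrier_mat m m"
    and B: "B \<in> carrier_mat n n" "B' \<in> carrier_mat n n" "B' * B = 1\<^sub>m n"
  shows "vec_space.rank (m * n) (kron Z B) = vec_space.rank m Z * n"
proof -
  obtain S P Q X Y where S: "S \<subseteq> {..<m}" "card S = vec_space.rank m Z"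
    and c: "P \<in> carrier_mat m m" "Q \<in> carrier_mat m m" "X \<in> carrier_mat m m" "Y \<in> carrier_mat m m"
    and PQ: "Z = P * coord_proj m S * Q" and XY: "X * Z * Y = coord_proj m S"
    using rank_normal_form[OF Z] by blast
  define T where "T = {i\<in>{..<m * n}. i div n \<in> S}"
  have "card T = (\<Sum>b<m. card {x\<in>{..<n}. b \<in> S})"
    unfolding T_def by (rule card_div_mod[OF n])
  also have "\<dots> = (\<Sum>b<m. if b \<in> S then n else 0)" by (intro sum.cong) auto
  also have "\<dots> = card S * n" using S by (simp add: sum.If_cases Int_absorb1)
  finally have T: "card T = card S * n" "T \<subseteq> {..<m * n}" by (auto simp: T_def)
  have o: "1\<^sub>m n \<in> carrier_mat n n" by simp
  have "kron P (1\<^sub>m n) * coord_proj (m * n) T * kron Q B = kron Z B"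
    unfolding T_def kron_coord_proj(1)[symmetric] PQ
    using c B by (simp add: kron_mult[of _ m _ _ n _] mult_carrier_mat[of _ m m _ m])
  then have "vec_space.rank (m * n) (kron Z B) \<le> card T"
    using rank_sandwich_le[OF kron_carrier[OF c(1) o] kron_carrier[OF c(2) B(1)] T(2)] by simp
  moreover have "kron X B' * kron Z B * kron Y (1\<^sub>m n) = coord_proj (m * n) T"
    unfolding T_def kron_coord_proj(1)[symmetric] XY[symmetric]
    using c B Z by (simp add: kron_mult[of _ m _ _ n _] mult_carrier_mat[of _ m m _ m])
  then have "card T \<le> vec_space.rank (m * n) (kron Z B)"
    by (intro rank_ge_compression[OF kron_carrier[OF Z B(1)] kron_carrier[OF c(3) B(2)] kron_carrier[OF c(4) o] T(2)])
  ultimately show ?thesis using T S by simp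
qed

lemma rank_kron_right:
  fixes Z B B' :: "'a::field mat"
  assumes n: "0 < n" and Z: "Z \<in> carrier_mat n n"
    and B: "B \<in> carrier_mat m m" "B' \<in> carrier_mat m m" "B' * B = 1\<^sub>m m"
  shows "vec_space.rank (m * n) (kron B Z) = m * vec_space.rank n Z"
proof -
  obtain S P Q X Y where S: "S \<subseteq> {..<n}" "card S = vec_space.rank n Z"
    and c: "P \<in> carrier_mat n n" "Q \<in> carrier_mat n n" "X \<in> carrier_mat n n" "Y \<in> carrier_mat n n"
    and PQ: "Z = P * coord_proj n S * Q" and XY: "X * Z * Y = coord_proj n S"
    using rank_normal_form[OF Z] by blast
  define T where "T = {i\<in>{..<m * n}. i mod n \<in> S}"
  have "card T = (\<Sum>b<m. card {x\<in>{..<n}. x \<in> S})"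
    unfolding T_def by (rule card_div_mod[OF n])
  also have "{x\<in>{..<n}. x \<in> S} = S" using S by blast
  finally have T: "card T = m * card S" "T \<subseteq> {..<m * n}" by (auto simp: T_def)
  have o: "1\<^sub>m m \<in> carrier_mat m m" by simp
  have "kron (1\<^sub>m m) P * coord_proj (m * n) T * kron B Q = kron B Z"
    unfolding T_def kron_coord_proj(2)[symmetric] PQ
    using c B by (simp add: kron_mult[of _ m _ _ n _] mult_carrier_mat[of _ n n _ n])
  then have "vec_space.rank (m * n) (kron B Z) \<le> card T"
    using rank_sandwich_le[OF kron_carrier[OF o c(1)] kron_carrier[OF B(1) c(2)] T(2)] by simp
  moreover have "kron B' X * kron B Z * kron (1\<^sub>m m) Y = coord_proj (m * n) T"
    unfolding T_def kron_coord_proj(2)[symmetric] XY[symmetric]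
    using c B Z by (simp add: kron_mult[of _ m _ _ n _] mult_carrier_mat[of _ n n _ n])
  then have "card T \<le> vec_space.rank (m * n) (kron B Z)"
    by (intro rank_ge_compression[OF kron_carrier[OF B(1) Z] kron_carrier[OF B(2) c(3)] kron_carrier[OF o c(4)] T(2)])
  ultimately show ?thesis using T S by simp
qed

section \<open>General linear groups\<close>

lemma gl_carrier: "A \<in> carrier (general_linear_group TYPE('f::field) n) \<longleftrightarrow>
    A \<in> carrier_mat n n \<and> (\<exists>B\<in>carrier_mat n n. B * A = 1\<^sub>m n \<and> A * B = 1\<^sub>m n)"
  by (auto simp: general_linear_group_def units_of_carrier Units_def ring_mat_simps)

lemma gl_mult: "A \<otimes>\<^bsub>general_linear_group TYPE('f::field) n\<^esub> B = A * B"
  and gl_one: "\<one>\<^bsub>general_linear_group TYPE('f::field) n\<^esub> = 1\<^sub>m n"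
  by (simp_all add: general_linear_group_def units_of_mult units_of_one ring_mat_simps)

lemma group_gl: "group (general_linear_group TYPE('f::field) n)"
proof -
  interpret ring "ring_mat TYPE('f) n ()" by (rule ring_mat)
  show ?thesis unfolding general_linear_group_def by (rule units_group)
qed

lemma gl_kron:
  assumes "A \<in> carrier (general_linear_group TYPE('f::field) m)" "B \<in> carrier (general_linear_group TYPE('f) n)"
  shows "kron A B \<in> carrier (general_linear_group TYPE('f) (m * n))"
proof -
  obtain A' B' where c: "A \<in> carrier_mat m m" "A' \<in> carrier_mat m m" "B \<in> carrier_mat n n" "B' \<in> carrier_mat n n"
    and i: "A' * A = 1\<^sub>m m" "A * A' = 1\<^sub>m m" "B' * B = 1\<^sub>m n" "B * B' = 1\<^sub>m n"
    using assms unfolding gl_carrier by blast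
  have "kron A' B' * kron A B = 1\<^sub>m (m * n)" "kron A B * kron A' B' = 1\<^sub>m (m * n)"
    using kron_mult[OF c(2,1,4,3)] kron_mult[OF c(1,2,3,4)] i by (simp_all add: kron_one)
  then show ?thesis
    unfolding gl_carrier using kron_carrier[OF c(1,3)] kron_carrier[OF c(2,4)] by blast
qed

lemma gl_block_monomial:
  assumes kp: "(k, p) \<in> carrier (perm_wreath (general_linear_group TYPE('f::field) n) {..<m})"
  shows "block_monomial m n k p \<in> carrier (general_linear_group TYPE('f) (m * n))"
proof -
  have p: "p \<in> Bij {..<m}" and k: "\<And>b. b < m \<Longrightarrow> k b \<in> carrier (general_linear_group TYPE('f) n)"
    using kp by (auto simp: carrier_perm_wreath)
  have "\<forall>b. \<exists>B. b < m \<longrightarrow> B \<in> carrier_mat n n \<and> B * k b = 1\<^sub>m n \<and> k b * B = 1\<^sub>m n"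
    using k unfolding gl_carrier by blast
  then obtain k' where k': "\<And>b. b < m \<Longrightarrow> k' b \<in> carrier_mat n n \<and> k' b * k b = 1\<^sub>m n \<and> k b * k' b = 1\<^sub>m n"
    by metis
  obtain q where q: "\<And>b. b < m \<Longrightarrow> q (p b) = b" "\<And>b. b < m \<Longrightarrow> p (q b) = b" "\<And>b. b < m \<Longrightarrow> q b < m"
    using Bij_inverse[OF p] by blast
  have "block_monomial m n (\<lambda>b. k' (q b)) q * block_monomial m n k p = 1\<^sub>m (m * n)"
    "block_monomial m n k p * block_monomial m n (\<lambda>b. k' (q b)) q = 1\<^sub>m (m * n)"
    using block_monomial_inverse[OF p q, of k n k'] k k' by (simp_all add: gl_carrier)
  then show ?thesis unfolding gl_carrier using block_monomial_carrier by blast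
qed

lemma block_monomial_minus:
  fixes k k' :: "nat \<Rightarrow> 'a::comm_ring_1 mat"
  assumes "\<And>b. b < m \<Longrightarrow> k b \<in> carrier_mat n n" "\<And>b. b < m \<Longrightarrow> k' b \<in> carrier_mat n n"
  shows "block_monomial m n k p - block_monomial m n k' p = block_monomial m n (\<lambda>b. k b - k' b) p"
proof (rule eq_matI)
  fix i j assume "i < dim_row (block_monomial m n (\<lambda>b. k b - k' b) p)" "j < dim_col (block_monomial m n (\<lambda>b. k b - k' b) p)"
  then have ij: "i < m * n" "j < m * n" by (auto simp: block_monomial_def)
  then have n: "0 < n" by (cases n) auto
  have b: "j div n < m" "i mod n < n" "j mod n < n"
    using ij n by (auto simp: less_mult_imp_div_less)
  show "(block_monomial m n k p - block_monomial m n k' p) $$ (i, j) = block_monomial m n (\<lambda>b. k b - k' b) p $$ (i, j)"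
    using ij b assms[OF b(1)] by (auto simp: block_monomial_def)
qed (auto simp: block_monomial_def)

text \<open>
  Block columns in which both matrices have their block in the same row contribute the rank of the
  difference of the blocks, by \<open>rank_block_monomial_le\<close>. The others are cut out of the difference by
  a coordinate projection, and contribute at most their width \<open>n\<close>.
\<close>

lemma rank_block_monomial_minus_le:
  fixes k k' :: "nat \<Rightarrow> 'a::field mat"
  assumes n: "0 < n" and k: "\<And>b. b < m \<Longrightarrow> k b \<in> carrier_mat n n" "\<And>b. b < m \<Longrightarrow> k' b \<in> carrier_mat n n"
  shows "vec_space.rank (m * n) (block_monomial m n k p - block_monomial m n k' p')
    \<le> (\<Sum>b<m. if p b = p' b then vec_space.rank n (k b - k' b) else n)"
proof -
  interpret vec_space "TYPE('a)" "m * n" .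
  define V where "V = {b\<in>{..<m}. p b \<noteq> p' b}"
  define N where "N = block_monomial m n k p - block_monomial m n k' p'"
  define \<Delta> where "\<Delta> b = (if b \<in> V then 0\<^sub>m n n else k b - k' b)" for b
  define T where "T = {i\<in>{..<m * n}. i div n \<in> V}"
  have N: "N \<in> carrier_mat (m * n) (m * n)" unfolding N_def by (rule minus_carrier_mat) simp
  have TN: "T \<subseteq> {..<m * n}" by (auto simp: T_def)
  have \<Delta>: "\<Delta> b \<in> carrier_mat n n" if "b < m" for b
    using k[OF that] by (auto simp: \<Delta>_def)
  let ?R = "N * coord_proj (m * n) T * 1\<^sub>m (m * n)"
  have R: "?R \<in> carrier_mat (m * n) (m * n)" using N by (meson coord_proj_carrier mult_carrier_mat one_carrier_mat)
  have split: "N = block_monomial m n \<Delta> p + ?R"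
  proof (rule eq_matI)
    fix i j assume "i < dim_row (block_monomial m n \<Delta> p + ?R)" "j < dim_col (block_monomial m n \<Delta> p + ?R)"
    then have ij: "i < m * n" "j < m * n" using R by auto
    then have n: "0 < n" by (cases n) auto
    have b: "j div n < m" "i mod n < n" "j mod n < n"
      using ij n by (auto simp: less_mult_imp_div_less)
    have "?R $$ (i, j) = (\<Sum>s\<in>T. N $$ (i, s) * (1\<^sub>m (m * n) :: 'a mat) $$ (s, j))"
      by (rule sandwich_entry[OF N one_carrier_mat TN ij])
    also have "\<dots> = (\<Sum>s\<in>T. if s = j then N $$ (i, j) else 0)"
      using ij TN by (intro sum.cong) auto
    also have "\<dots> = (if j div n \<in> V then N $$ (i, j) else 0)"
      using ij finite_subset[OF TN] by (simp add: T_def)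
    finally have Rij: "?R $$ (i, j) = (if j div n \<in> V then N $$ (i, j) else 0)" .
    have "block_monomial m n \<Delta> p $$ (i, j) = (if j div n \<in> V then 0 else N $$ (i, j))"
      using ij b k[OF b(1)] by (auto simp: block_monomial_def N_def \<Delta>_def V_def)
    then show "N $$ (i, j) = (block_monomial m n \<Delta> p + ?R) $$ (i, j)"
      using ij Rij carrier_matD[OF R] by (simp add: block_monomial_def)
  qed (use N R in auto)
  have "rank N \<le> rank (block_monomial m n \<Delta> p) + rank ?R"
    using rank_subadditive[OF block_monomial_carrier[of m n \<Delta> p] R] unfolding split[symmetric] .
  also have "rank ?R \<le> card T" by (rule rank_sandwich_le[OF N one_carrier_mat TN])
  also have "card T = (\<Sum>b<m. card {x\<in>{..<n}. b \<in> V})"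
    unfolding T_def by (rule card_div_mod[OF n])
  also have "rank (block_monomial m n \<Delta> p) \<le> (\<Sum>b<m. vec_space.rank n (\<Delta> b))"
    by (rule rank_block_monomial_le[OF n \<Delta>])
  also have "(\<Sum>b<m. vec_space.rank n (\<Delta> b)) + (\<Sum>b<m. card {x\<in>{..<n}. b \<in> V})
      = (\<Sum>b<m. if p b = p' b then vec_space.rank n (k b - k' b) else n)"
    unfolding sum.distrib[symmetric]
    by (intro sum.cong) (auto simp: \<Delta>_def V_def vec_space.rank_0I)
  finally show ?thesis by (simp add: N_def)
qed

text \<open>
  Let \<open>T\<close> be maximal among the sets that are disjoint from their image. A moved point outside \<open>T\<close> that
  is neither in the image nor in the preimage of \<open>T\<close> could be added to \<open>T\<close>.
\<close>

lemma independent_moved_set: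
  assumes p: "p \<in> Bij B" and B: "finite B"
  shows "\<exists>T\<subseteq>B. T \<inter> p ` T = {} \<and> card {b\<in>B. p b \<noteq> b} \<le> 3 * card T"
proof -
  define ok where "ok T \<longleftrightarrow> T \<subseteq> B \<and> T \<inter> p ` T = {}" for T
  have "finite {T. ok T}" by (rule finite_subset[of _ "Pow B"]) (use B in \<open>auto simp: ok_def\<close>)
  moreover have "ok {}" by (simp add: ok_def)
  ultimately obtain T where T: "ok T" and max: "\<And>T'. ok T' \<Longrightarrow> T \<subseteq> T' \<Longrightarrow> T = T'"
    using finite_has_maximal2[of "{T. ok T}" "{}"] by auto
  have Tf: "finite T" "T \<subseteq> B" using T B finite_subset unfolding ok_def by auto
  define pre where "pre = {b\<in>B. p b \<in> T}"
  have "card pre \<le> card T"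
    using Bij_inj[OF p] Tf by (intro card_inj_on_le[of p]) (auto simp: pre_def inj_on_def)
  have "{b\<in>B. p b \<noteq> b} \<subseteq> T \<union> (p ` T \<union> pre)"
  proof
    fix b assume b: "b \<in> {b\<in>B. p b \<noteq> b}"
    show "b \<in> T \<union> (p ` T \<union> pre)"
    proof (rule ccontr)
      assume n: "b \<notin> T \<union> (p ` T \<union> pre)"
      then have "ok (insert b T)" using b T Tf unfolding ok_def pre_def by auto
      then show False using max[of "insert b T"] n by auto
    qed
  qed
  then have "card {b\<in>B. p b \<noteq> b} \<le> card (T \<union> (p ` T \<union> pre))"
    using Tf B by (intro card_mono) (auto simp: pre_def)
  also have "\<dots> \<le> card T + (card (p ` T) + card pre)"
    using card_Un_le[of T "p ` T \<union> pre"] card_Un_le[of "p ` T" pre] by linarith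
  also have "\<dots> \<le> 3 * card T" using card_image_le[OF Tf(1), of p] \<open>card pre \<le> card T\<close> by linarith
  finally show ?thesis using T unfolding ok_def by blast
qed

text \<open>
  Choose \<open>T\<close> as in \<open>independent_moved_set\<close>, and look at the block columns in \<open>T\<close> and the block rows in
  \<open>p ` T\<close>. The identity matrix has no entry there, as \<open>T\<close> and \<open>p ` T\<close> are disjoint, so what is left
  is a diagonal of invertible blocks \<open>k b\<close>, which \<open>x\<close> normalises to identities.
\<close>

lemma rank_block_monomial_moved:
  fixes k :: "nat \<Rightarrow> 'f::field mat"
  assumes n: "0 < n" and kp: "(k, p) \<in> carrier (perm_wreath (general_linear_group TYPE('f) n) {..<m})"
  shows "n * card {b\<in>{..<m}. p b \<noteq> b} \<le> 3 * vec_space.rank (m * n) (block_monomial m n k p - 1\<^sub>m (m * n))"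
proof -
  have p: "p \<in> Bij {..<m}" and k: "\<And>b. b < m \<Longrightarrow> k b \<in> carrier (general_linear_group TYPE('f) n)"
    using kp by (auto simp: carrier_perm_wreath)
  have "\<forall>b. \<exists>B. b < m \<longrightarrow> B \<in> carrier_mat n n \<and> B * k b = 1\<^sub>m n"
    using k unfolding gl_carrier by blast
  then obtain k' where k': "\<And>b. b < m \<Longrightarrow> k' b \<in> carrier_mat n n \<and> k' b * k b = 1\<^sub>m n"
    by metis
  have kc: "k b \<in> carrier_mat n n" if "b < m" for b using k[OF that] by (simp add: gl_carrier)
  obtain q where q: "\<And>b. b < m \<Longrightarrow> q (p b) = b" "\<And>b. b < m \<Longrightarrow> p (q b) = b" "\<And>b. b < m \<Longrightarrow> q b < m"
    using Bij_inverse[OF p] by blast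
  have pm: "p b < m" if "b < m" for b using Bij_in[OF p, of b] that by auto
  obtain T where T: "T \<subseteq> {..<m}" "T \<inter> p ` T = {}" "card {b\<in>{..<m}. p b \<noteq> b} \<le> 3 * card T"
    using independent_moved_set[OF p] by auto
  define e :: "nat \<Rightarrow> 'f mat" where "e b = coord_proj n (if b \<in> T then {..<n} else {})" for b
  have e: "e b = (if b \<in> T then 1\<^sub>m n else 0\<^sub>m n n)" for b
    by (simp add: e_def coord_proj_all coord_proj_empty)
  have ec: "e b \<in> carrier_mat n n" for b by (simp add: e)
  define x where "x a = (if a \<in> p ` T then k' (q a) else 0\<^sub>m n n)" for a
  have xc: "x a \<in> carrier_mat n n" if "a < m" for a using k'[OF q(3)[OF that]] by (auto simp: x_def)
  let ?M = "block_monomial m n k p"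
  let ?X = "block_monomial m n x q" and ?E = "block_monomial m n e (\<lambda>b. b)"
  have XM: "?X * ?M = ?E"
  proof -
    have "?X * ?M = block_monomial m n (\<lambda>b. x (p b) * k b) (\<lambda>b. q (p b))"
      by (rule block_monomial_mult[OF pm xc kc])
    also have "\<dots> = ?E"
    proof (rule block_monomial_cong)
      fix b assume b: "b < m"
      show "q (p b) = b" by (rule q(1)[OF b])
      have "p b \<in> p ` T \<longleftrightarrow> b \<in> T" using q(1) b T(1) by (metis image_iff lessThan_iff subsetD)
      then show "x (p b) * k b = e b"
        using k'[OF b] kc[OF b] q(1)[OF b] by (simp add: x_def e)
    qed
    finally show ?thesis .
  qed
  have XE: "?X * ?E = 0\<^sub>m (m * n) (m * n)"
  proof -
    have "?X * ?E = block_monomial m n (\<lambda>b. x b * e b) q"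
      by (rule block_monomial_mult[OF _ xc ec])
    also have "\<dots> = block_monomial m n (\<lambda>_. 0\<^sub>m n n) q"
    proof (rule block_monomial_cong)
      fix b assume b: "b < m"
      show "x b * e b = 0\<^sub>m n n"
      proof (cases "b \<in> T")
        case True
        then have "b \<notin> p ` T" using T(2) by blast
        then show ?thesis by (simp add: x_def e)
      next
        case False
        then show ?thesis using right_mult_zero_mat[OF xc[OF b], of n] by (simp add: e)
      qed
    qed simp
    also have "\<dots> = 0\<^sub>m (m * n) (m * n)"
    proof (rule eq_matI)
      fix i j assume "i < dim_row (0\<^sub>m (m * n) (m * n) :: 'f mat)" "j < dim_col (0\<^sub>m (m * n) (m * n) :: 'f mat)"
      then show "block_monomial m n (\<lambda>_. 0\<^sub>m n n) q $$ (i, j) = (0\<^sub>m (m * n) (m * n) :: 'f mat) $$ (i, j)"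
        using n by (auto simp: block_monomial_def)
    qed (auto simp: block_monomial_def)
    finally show ?thesis .
  qed
  have EE: "?E * ?E = ?E"
  proof -
    have "?E * ?E = block_monomial m n (\<lambda>b. e b * e b) (\<lambda>b. b)"
      by (rule block_monomial_mult[OF _ ec ec])
    also have "\<dots> = ?E" by (intro block_monomial_cong) (auto simp: e)
    finally show ?thesis .
  qed
  define U where "U = {i\<in>{..<m * n}. i mod n \<in> (if i div n \<in> T then {..<n} else {})}"
  have EU: "?E = coord_proj (m * n) U"
    unfolding U_def e_def by (rule block_monomial_coord_proj)
  have XMX: "?X * (?M - 1\<^sub>m (m * n)) = ?E - ?X"
    using mult_minus_distrib_mat[OF block_monomial_carrier[of m n x q] block_monomial_carrier[of m n k p] one_carrier_mat]
    by (simp add: XM right_mult_one_mat[OF block_monomial_carrier])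
  have "(?E - ?X) * ?E = ?E * ?E - ?X * ?E"
    by (rule minus_mult_distrib_mat[OF block_monomial_carrier block_monomial_carrier block_monomial_carrier])
  also have "\<dots> = ?E" unfolding EE XE by (intro eq_matI) (auto simp: block_monomial_def)
  finally have "?X * (?M - 1\<^sub>m (m * n)) * ?E = coord_proj (m * n) U" unfolding XMX using EU by simp
  then have "card U \<le> vec_space.rank (m * n) (?M - 1\<^sub>m (m * n))"
    by (intro rank_ge_compression[OF minus_carrier_mat[OF one_carrier_mat] block_monomial_carrier block_monomial_carrier])
      (auto simp: U_def)
  moreover have "card U = n * card T"
  proof -
    have "card U = (\<Sum>b<m. card (if b \<in> T then {..<n} else {}))"
      unfolding U_def by (rule card_blocks[OF n]) auto
    also have "\<dots> = (\<Sum>b<m. if b \<in> T then n else 0)" by (intro sum.cong) auto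
    also have "\<dots> = n * card T" using T(1) by (simp add: sum.If_cases Int_absorb1)
    finally show ?thesis .
  qed
  ultimately have "n * card T \<le> vec_space.rank (m * n) (?M - 1\<^sub>m (m * n))" by simp
  moreover have "n * card {b\<in>{..<m}. p b \<noteq> b} \<le> n * (3 * card T)" using T(3) by (rule mult_le_mono2)
  ultimately show ?thesis by linarith
qed

definition linear_groups :: "('f::field mat monoid \<times> ('f mat \<Rightarrow> 'f mat \<Rightarrow> real)) set" where
  "linear_groups = {(general_linear_group TYPE('f) n, rank_dist n) | n. n \<ge> 1}"

lemma gl_monomial:
  assumes n: "0 < n" and m: "0 < m"
  shows "monomial_hom m (general_linear_group TYPE('f::field) n, rank_dist n)
    (general_linear_group TYPE('f) (m * n), rank_dist (m * n)) (\<lambda>(k, p). block_monomial m n k p)"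
proof (rule monomial_hom_of_average_bounds[OF m])
  let ?G = "general_linear_group TYPE('f) n"
  let ?PW = "perm_wreath ?G {..<m}"
  have kc: "k b \<in> carrier_mat n n" if "(k, p) \<in> carrier ?PW" "b < m" for k :: "nat \<Rightarrow> 'f mat" and p b
    using that PiE_mem[of k "{..<m}" "\<lambda>_. carrier ?G" b] by (simp add: carrier_perm_wreath gl_carrier)
  have le1: "rank_dist n A B \<le> 1" if "A \<in> carrier_mat n n" "B \<in> carrier_mat n n" for A B :: "'f mat"
    using rank_le_dim[OF minus_carrier_mat[OF that(2), of A]] n by (simp add: rank_dist_def)
  show "(\<lambda>(k, p). block_monomial m n k p) \<in> hom ?PW (general_linear_group TYPE('f) (m * n))"
    by (rule block_monomial_hom) (simp_all only: gl_carrier[of _ n] gl_mult gl_block_monomial)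
  show "0 \<le> rank_dist n x \<one>\<^bsub>?G\<^esub>" for x :: "'f mat" by (simp add: rank_dist_def)
  show "rank_dist (m * n) (case (k, p) of (k, p) \<Rightarrow> block_monomial m n k p) (case (k', p') of (k, p) \<Rightarrow> block_monomial m n k p)
      \<le> 2 * sqrt ((\<Sum>b<m. if p b = p' b then min 1 (rank_dist n (k b) (k' b)) else 1) / real m)"
    if kp: "(k, p) \<in> carrier ?PW" "(k', p') \<in> carrier ?PW" for k k' :: "nat \<Rightarrow> 'f mat" and p p'
  proof -
    have "real (vec_space.rank (m * n) (block_monomial m n k p - block_monomial m n k' p'))
        \<le> (\<Sum>b<m. real (if p b = p' b then vec_space.rank n (k b - k' b) else n))"
      using rank_block_monomial_minus_le[OF n kc[OF kp(1)] kc[OF kp(2)], where p = p and p' = p'] by (simp only: of_nat_le_iff flip: of_nat_sum)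
    then have "rank_dist (m * n) (block_monomial m n k p) (block_monomial m n k' p')
        \<le> (\<Sum>b<m. real (if p b = p' b then vec_space.rank n (k b - k' b) else n)) / real (m * n)"
      unfolding rank_dist_def by (intro divide_right_mono) auto
    also have "\<dots> = (\<Sum>b<m. real (if p b = p' b then vec_space.rank n (k b - k' b) else n) / n) / m"
      by (simp add: sum_divide_distrib mult.commute)
    also have "\<dots> = (\<Sum>b<m. if p b = p' b then min 1 (rank_dist n (k b) (k' b)) else 1) / real m"
      using n le1[OF kc[OF kp(1)] kc[OF kp(2)]]
      by (intro arg_cong[of _ _ "\<lambda>x. x / real m"] sum.cong) (auto simp: rank_dist_def)
    finally show ?thesis
      unfolding prod.case by (intro le_two_sqrt_average[OF m]) (auto simp: rank_dist_def)
  qed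
  show "real (card {b\<in>{..<m}. p b \<noteq> b}) / (3 * real m)
      \<le> rank_dist (m * n) (case (k, p) of (k, p) \<Rightarrow> block_monomial m n k p) \<one>\<^bsub>general_linear_group TYPE('f) (m * n)\<^esub>"
    if kp: "(k, p) \<in> carrier ?PW" for k p
  proof -
    have "real (n * card {b\<in>{..<m}. p b \<noteq> b}) \<le> real (3 * vec_space.rank (m * n) (block_monomial m n k p - 1\<^sub>m (m * n)))"
      using rank_block_monomial_moved[OF n kp] by (simp only: of_nat_le_iff)
    then show ?thesis using m n by (simp add: rank_dist_def gl_one field_simps)
  qed
  show "(\<Sum>b<m. min 1 (rank_dist n (k b) \<one>\<^bsub>?G\<^esub>)) / real m
      \<le> rank_dist (m * n) (case (k, \<lambda>b\<in>{..<m}. b) of (k, p) \<Rightarrow> block_monomial m n k p) \<one>\<^bsub>general_linear_group TYPE('f) (m * n)\<^esub>"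
    if k: "k \<in> {..<m} \<rightarrow>\<^sub>E carrier ?G" for k
  proof -
    have kc': "k b \<in> carrier_mat n n" if "b < m" for b
      using PiE_mem[OF k, of b] that by (simp add: gl_carrier)
    have "block_monomial m n k (\<lambda>b\<in>{..<m}. b) = block_monomial m n k (\<lambda>b. b)"
      by (intro block_monomial_cong) auto
    then have eq: "block_monomial m n k (\<lambda>b\<in>{..<m}. b) - 1\<^sub>m (m * n) = block_monomial m n (\<lambda>b. k b - 1\<^sub>m n) (\<lambda>b. b)"
      using block_monomial_minus[of m k n "\<lambda>_. 1\<^sub>m n" "\<lambda>b. b"] kc' by (simp add: block_monomial_one)
    have "(\<Sum>b<m. vec_space.rank n (k b - 1\<^sub>m n)) \<le> vec_space.rank (m * n) (block_monomial m n (\<lambda>b. k b - 1\<^sub>m n) (\<lambda>b. b))"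
      by (intro rank_block_diagonal_ge[OF n] minus_carrier_mat) simp
    then have "(\<Sum>b<m. real (vec_space.rank n (k b - 1\<^sub>m n))) \<le> real (vec_space.rank (m * n) (block_monomial m n (\<lambda>b. k b - 1\<^sub>m n) (\<lambda>b. b)))"
      by (simp only: of_nat_le_iff flip: of_nat_sum)
    then have "(\<Sum>b<m. real (vec_space.rank n (k b - 1\<^sub>m n))) / real (m * n)
        \<le> rank_dist (m * n) (block_monomial m n k (\<lambda>b\<in>{..<m}. b)) (1\<^sub>m (m * n))"
      unfolding rank_dist_def eq by (intro divide_right_mono) auto
    moreover have "(\<Sum>b<m. real (vec_space.rank n (k b - 1\<^sub>m n))) / real (m * n)
        = (\<Sum>b<m. real (vec_space.rank n (k b - 1\<^sub>m n)) / n) / m"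
      by (simp add: sum_divide_distrib mult.commute)
    moreover have "(\<Sum>b<m. min 1 (rank_dist n (k b) \<one>\<^bsub>?G\<^esub>)) \<le> (\<Sum>b<m. real (vec_space.rank n (k b - 1\<^sub>m n)) / n)"
      by (intro sum_mono) (simp add: rank_dist_def gl_one)
    then have "(\<Sum>b<m. min 1 (rank_dist n (k b) \<one>\<^bsub>?G\<^esub>)) / real m \<le> (\<Sum>b<m. real (vec_space.rank n (k b - 1\<^sub>m n)) / n) / m"
      by (intro divide_right_mono) auto
    ultimately show ?thesis by (simp add: gl_one)
  qed
qed

lemma rank_dist_kron:
  assumes A: "A \<in> carrier (general_linear_group TYPE('f::field) m)" "A' \<in> carrier (general_linear_group TYPE('f) m)"
    and B: "B \<in> carrier (general_linear_group TYPE('f) n)" "B' \<in> carrier (general_linear_group TYPE('f) n)"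
    and mn: "0 < m" "0 < n"
  shows "rank_dist (m * n) (kron A B) (kron A' B) = rank_dist m A A'"
    and "rank_dist (m * n) (kron A B) (kron A B') = rank_dist n B B'"
proof -
  obtain Ai Bi where c: "A \<in> carrier_mat m m" "A' \<in> carrier_mat m m" "B \<in> carrier_mat n n" "B' \<in> carrier_mat n n"
    and i: "Ai \<in> carrier_mat m m" "Ai * A = 1\<^sub>m m" "Bi \<in> carrier_mat n n" "Bi * B = 1\<^sub>m n"
    using A B unfolding gl_carrier by blast
  show "rank_dist (m * n) (kron A B) (kron A' B) = rank_dist m A A'"
    using mn unfolding rank_dist_def kron_minus(1)[OF c]
    by (simp add: rank_kron[OF mn(2) minus_carrier_mat[OF c(2)] c(3) i(3,4)])
  show "rank_dist (m * n) (kron A B) (kron A B') = rank_dist n B B'"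
    using mn unfolding rank_dist_def kron_minus(2)[OF c]
    by (simp add: rank_kron_right[OF mn(2) minus_carrier_mat[OF c(4)] c(1) i(1,2)])
qed

lemma wreath_closed_linear_groups: "wreath_closed (linear_groups :: ('f::field mat monoid \<times> _) set)"
proof (rule wreath_closed.intro)
  fix K :: "'f mat monoid" and d assume K: "(K, d) \<in> linear_groups"
  then obtain n where n: "0 < n" "K = general_linear_group TYPE('f) n" "d = rank_dist n"
    by (auto simp: linear_groups_def Suc_le_eq)
  show "group K" unfolding n by (rule group_gl)
  show "pseudometric_on (carrier K) d"
    using pseudometric_rank[of n, where 'a = 'f] unfolding n pseudometric_on_def by (auto simp: gl_carrier)
  show "\<exists>M D \<Psi>. (M, D) \<in> linear_groups \<and> monomial_hom m (K, d) (M, D) \<Psi>" if m: "0 < m" for m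
  proof -
    have "(general_linear_group TYPE('f) (m * n), rank_dist (m * n)) \<in> linear_groups"
      unfolding linear_groups_def using n m by (auto simp: Suc_le_eq)
    then show ?thesis using gl_monomial[OF n(1) m] unfolding n by blast
  qed
next
  fix K1 K2 :: "'f mat monoid" and d1 d2 assume "(K1, d1) \<in> linear_groups" "(K2, d2) \<in> linear_groups"
  then obtain m n where m: "0 < m" "K1 = general_linear_group TYPE('f) m" "d1 = rank_dist m"
    and n: "0 < n" "K2 = general_linear_group TYPE('f) n" "d2 = rank_dist n"
    by (auto simp: linear_groups_def Suc_le_eq)
  let ?G = "\<lambda>n. general_linear_group TYPE('f) n"
  have "(\<lambda>(A, B). kron A B) \<in> hom (?G m \<times>\<times> ?G n) (?G (m * n))"
  proof (rule homI)
    fix x y assume xy: "x \<in> carrier (?G m \<times>\<times> ?G n)" "y \<in> carrier (?G m \<times>\<times> ?G n)"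
    show "(case x of (A, B) \<Rightarrow> kron A B) \<in> carrier (?G (m * n))"
      using xy by (cases x) (auto intro: gl_kron)
    show "(case x \<otimes>\<^bsub>?G m \<times>\<times> ?G n\<^esub> y of (A, B) \<Rightarrow> kron A B)
        = (case x of (A, B) \<Rightarrow> kron A B) \<otimes>\<^bsub>?G (m * n)\<^esub> (case y of (A, B) \<Rightarrow> kron A B)"
      using xy by (cases x; cases y) (auto simp: gl_mult gl_carrier kron_mult)
  qed
  then have "tensor_hom (K1, d1) (K2, d2) (?G (m * n), rank_dist (m * n)) (\<lambda>(A, B). kron A B)"
    using m n unfolding tensor_hom_def by (auto intro: rank_dist_kron)
  moreover have "(?G (m * n), rank_dist (m * n)) \<in> linear_groups"
    unfolding linear_groups_def using n m by (auto simp: Suc_le_eq)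
  ultimately show "\<exists>L d T. (L, d) \<in> linear_groups \<and> tensor_hom (K1, d1) (K2, d2) (L, d) T"
    by blast
qed

section \<open>Finite groups\<close>

definition finite_metric_groups :: "(nat monoid \<times> (nat \<Rightarrow> nat \<Rightarrow> real)) set" where
  "finite_metric_groups = {(K, d). group K \<and> finite (carrier K) \<and> bi_invariant_metric K d}"

lemma finite_metric_group_on_nat:
  assumes K: "group K" and fin: "finite (carrier K)" and d: "bi_invariant_metric K d"
  shows "\<exists>L D e. (L, D) \<in> finite_metric_groups \<and> e \<in> hom K L \<and> (\<forall>x\<in>carrier K. \<forall>y\<in>carrier K. D (e x) (e y) = d x y)"
proof -
  interpret K: group K by fact
  interpret M: Metric_space "carrier K" d using d by (simp add: bi_invariant_metric_def)
  obtain e where e: "bij_betw e (carrier K) {..<card (carrier K)}"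
    using ex_bij_betw_finite_nat[OF fin] by (auto simp: atLeast0LessThan)
  define B where "B = {..<card (carrier K)}"
  define i where "i = inv_into (carrier K) e"
  have ie: "i (e x) = x" "e x \<in> B" if "x \<in> carrier K" for x
    using that e by (auto simp: i_def B_def bij_betw_inv_into_left dest: bij_betwE)
  have ei: "e (i n) = n" "i n \<in> carrier K" if "n \<in> B" for n
    using that e bij_betwE[OF bij_betw_inv_into[OF e]]
    by (auto simp: i_def B_def bij_betw_inv_into_right)
  define L where "L = \<lparr>carrier = B, monoid.mult = (\<lambda>x y. e (i x \<otimes>\<^bsub>K\<^esub> i y)), one = e \<one>\<^bsub>K\<^esub>\<rparr>"
  have L: "carrier L = B" "x \<otimes>\<^bsub>L\<^esub> y = e (i x \<otimes>\<^bsub>K\<^esub> i y)" "\<one>\<^bsub>L\<^esub> = e \<one>\<^bsub>K\<^esub>" for x y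
    by (simp_all add: L_def)
  define D where "D x y = d (i x) (i y)" for x y
  have "group L"
  proof (rule groupI)
    fix x assume x: "x \<in> carrier L"
    show "\<exists>y\<in>carrier L. y \<otimes>\<^bsub>L\<^esub> x = \<one>\<^bsub>L\<^esub>"
      using x ie ei by (intro bexI[of _ "e (inv\<^bsub>K\<^esub> (i x))"]) (simp_all add: L)
  qed (use ie ei in \<open>auto simp: L K.m_assoc\<close>)
  moreover have "Metric_space (carrier L) D"
  proof
    fix x y z
    show "0 \<le> D x y" "D x y = D y x" by (simp_all add: D_def M.commute)
    assume x: "x \<in> carrier L" and y: "y \<in> carrier L"
    show "D x y = 0 \<longleftrightarrow> x = y"
      using x y ei M.zero[of "i x" "i y"] by (metis D_def L(1))
    assume "z \<in> carrier L"
    then show "D x z \<le> D x y + D y z" using x y ei M.triangle by (simp add: D_def L)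
  qed
  then have "bi_invariant_metric L D"
    using d ie ei unfolding bi_invariant_metric_def by (auto simp: L D_def)
  moreover have "finite (carrier L)" by (simp add: L B_def)
  moreover have "e \<in> hom K L" using ie by (intro homI) (auto simp: L)
  moreover have "\<forall>x\<in>carrier K. \<forall>y\<in>carrier K. D (e x) (e y) = d x y" using ie by (simp add: D_def)
  ultimately show ?thesis unfolding finite_metric_groups_def by blast
qed

lemma bi_invariantD:
  assumes "group K" "bi_invariant_metric K d" "a \<in> carrier K" "x \<in> carrier K" "y \<in> carrier K"
  shows "d (a \<otimes>\<^bsub>K\<^esub> x) (a \<otimes>\<^bsub>K\<^esub> y) = d x y" "d (x \<otimes>\<^bsub>K\<^esub> a) (y \<otimes>\<^bsub>K\<^esub> a) = d x y"
proof -
  interpret group K by fact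
  have *: "d (a \<otimes>\<^bsub>K\<^esub> x \<otimes>\<^bsub>K\<^esub> b) (a \<otimes>\<^bsub>K\<^esub> y \<otimes>\<^bsub>K\<^esub> b) = d x y" if "a \<in> carrier K" "b \<in> carrier K" for a b
    using assms that unfolding bi_invariant_metric_def by blast
  show "d (a \<otimes>\<^bsub>K\<^esub> x) (a \<otimes>\<^bsub>K\<^esub> y) = d x y" using *[of a "\<one>\<^bsub>K\<^esub>"] assms by simp
  show "d (x \<otimes>\<^bsub>K\<^esub> a) (y \<otimes>\<^bsub>K\<^esub> a) = d x y" using *[of "\<one>\<^bsub>K\<^esub>" a] assms by simp
qed

lemma bi_invariantI:
  assumes "group K" "Metric_space (carrier K) d"
    and "\<And>a x y. a \<in> carrier K \<Longrightarrow> x \<in> carrier K \<Longrightarrow> y \<in> carrier K \<Longrightarrow> d (a \<otimes>\<^bsub>K\<^esub> x) (a \<otimes>\<^bsub>K\<^esub> y) = d x y"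
    and "\<And>a x y. a \<in> carrier K \<Longrightarrow> x \<in> carrier K \<Longrightarrow> y \<in> carrier K \<Longrightarrow> d (x \<otimes>\<^bsub>K\<^esub> a) (y \<otimes>\<^bsub>K\<^esub> a) = d x y"
  shows "bi_invariant_metric K d"
proof -
  interpret group K by fact
  show ?thesis unfolding bi_invariant_metric_def using assms by simp
qed

text \<open>
  The direct product with the maximum metric.
\<close>

lemma finite_groups_product:
  assumes K1: "(K1, d1) \<in> finite_metric_groups" and K2: "(K2, d2) \<in> finite_metric_groups"
  shows "\<exists>L D T. (L, D) \<in> finite_metric_groups \<and> tensor_hom (K1, d1) (K2, d2) (L, D) T"
proof -
  have 1: "group K1" "finite (carrier K1)" "bi_invariant_metric K1 d1"
    and 2: "group K2" "finite (carrier K2)" "bi_invariant_metric K2 d2"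
    using K1 K2 by (auto simp: finite_metric_groups_def)
  interpret M1: Metric_space "carrier K1" d1 using 1 by (simp add: bi_invariant_metric_def)
  interpret M2: Metric_space "carrier K2" d2 using 2 by (simp add: bi_invariant_metric_def)
  define d where "d x y = max (d1 (fst x) (fst y)) (d2 (snd x) (snd y))" for x y
  have K: "group (K1 \<times>\<times> K2)" using 1 2 by (simp add: DirProd_group)
  have fin: "finite (carrier (K1 \<times>\<times> K2))" using 1 2 by simp
  have "Metric_space (carrier (K1 \<times>\<times> K2)) d"
  proof
    fix x y z
    show "0 \<le> d x y" "d x y = d y x" by (simp_all add: d_def M1.commute M2.commute le_max_iff_disj)
    assume x: "x \<in> carrier (K1 \<times>\<times> K2)" and y: "y \<in> carrier (K1 \<times>\<times> K2)"
    have "d x y = 0 \<longleftrightarrow> d1 (fst x) (fst y) = 0 \<and> d2 (snd x) (snd y) = 0"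
      using M1.nonneg[of "fst x" "fst y"] M2.nonneg[of "snd x" "snd y"] unfolding d_def by linarith
    then show "d x y = 0 \<longleftrightarrow> x = y" using x y by auto
    assume z: "z \<in> carrier (K1 \<times>\<times> K2)"
    have "d1 (fst x) (fst z) \<le> d1 (fst x) (fst y) + d1 (fst y) (fst z)"
      "d2 (snd x) (snd z) \<le> d2 (snd x) (snd y) + d2 (snd y) (snd z)"
      using x y z by (auto intro!: M1.triangle M2.triangle)
    then show "d x z \<le> d x y + d y z" unfolding d_def by linarith
  qed
  then have bi: "bi_invariant_metric (K1 \<times>\<times> K2) d"
    by (rule bi_invariantI[OF K])
      (auto simp: d_def bi_invariantD[OF 1(1,3)] bi_invariantD[OF 2(1,3)])
  obtain L D e where L: "(L, D) \<in> finite_metric_groups" and e: "e \<in> hom (K1 \<times>\<times> K2) L"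
    and iso: "\<forall>x\<in>carrier (K1 \<times>\<times> K2). \<forall>y\<in>carrier (K1 \<times>\<times> K2). D (e x) (e y) = d x y"
    using finite_metric_group_on_nat[OF K fin bi] by (elim exE conjE)
  have "tensor_hom (K1, d1) (K2, d2) (L, D) e"
    using e iso by (simp add: tensor_hom_def d_def)
  with L show ?thesis by blast
qed

lemma finite_Bij:
  assumes "finite B"
  shows "finite (Bij B)"
proof (rule finite_subset)
  show "Bij B \<subseteq> B \<rightarrow>\<^sub>E B"
  proof
    fix p assume p: "p \<in> Bij B"
    show "p \<in> B \<rightarrow>\<^sub>E B"
      using Bij_in[OF p] Bij_imp_extensional[OF p] by (simp add: PiE_iff)
  qed
  show "finite (B \<rightarrow>\<^sub>E B)" using assms by (intro finite_PiE) auto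
qed

text \<open>
  The permutational wreath product itself, with the average over \<open>b\<close> of \<open>min 1 (d (k b) (k' b))\<close> where
  the permutations agree, and \<open>1\<close> where they do not. Left multiplication preserves each summand, and
  right multiplication permutes the summands.
\<close>

lemma finite_groups_monomial:
  assumes K: "(K, d) \<in> finite_metric_groups" and m: "0 < m"
  shows "\<exists>M D \<Psi>. (M, D) \<in> finite_metric_groups \<and> monomial_hom m (K, d) (M, D) \<Psi>"
proof -
  have K: "group K" "finite (carrier K)" "bi_invariant_metric K d"
    using K by (auto simp: finite_metric_groups_def)
  interpret M: Metric_space "carrier K" d using K by (simp add: bi_invariant_metric_def)
  interpret K: group K by (rule K)
  let ?PW = "perm_wreath K {..<m}"
  interpret PW: group ?PW by (rule group_perm_wreath) (rule K)
  define s where "s x y b = (if snd x b = snd y b then min 1 (d (fst x b) (fst y b)) else 1)"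
    for x y :: "(nat \<Rightarrow> nat) \<times> (nat \<Rightarrow> nat)" and b
  define D where "D x y = (\<Sum>b<m. s x y b) / m" for x y
  have s: "0 \<le> s x y b" "s x y b \<le> 1" for x y b
    using M.nonneg[of "fst x b" "fst y b"] by (auto simp: s_def)
  have s_sym: "s x y b = s y x b" for x y b
    unfolding s_def M.commute[of "fst x b" "fst y b"] by (intro if_cong) auto
  have car: "x \<in> carrier ?PW \<Longrightarrow> b < m \<Longrightarrow> fst x b \<in> carrier K" for x b
    using PiE_mem[of "fst x" "{..<m}" "\<lambda>_. carrier K" b] by (simp add: carrier_perm_wreath mem_Times_iff)
  have carp: "x \<in> carrier ?PW \<Longrightarrow> snd x \<in> Bij {..<m}" for x
    by (simp add: carrier_perm_wreath mem_Times_iff)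
  have mul: "fst (x \<otimes>\<^bsub>?PW\<^esub> y) b = fst x (snd y b) \<otimes>\<^bsub>K\<^esub> fst y b"
    "snd (x \<otimes>\<^bsub>?PW\<^esub> y) b = snd x (snd y b)" if "b < m" for x y b
    using that by (simp_all add: perm_wreath_def split_beta compose_eq)
  have "Metric_space (carrier ?PW) D"
  proof
    fix x y z
    show "0 \<le> D x y" unfolding D_def using s by (intro divide_nonneg_nonneg sum_nonneg) auto
    show "D x y = D y x" unfolding D_def s_sym[of x y] by simp
    assume x: "x \<in> carrier ?PW" and y: "y \<in> carrier ?PW"
    have "D x y = 0 \<longleftrightarrow> (\<forall>b<m. s x y b = 0)"
      using m s by (auto simp: D_def sum_nonneg_eq_0_iff)
    also have "\<dots> \<longleftrightarrow> (\<forall>b<m. snd x b = snd y b \<and> fst x b = fst y b)"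
      using car[OF x] car[OF y] M.zero by (auto simp: s_def min_def split: if_splits)
    also have "\<dots> \<longleftrightarrow> x = y"
    proof
      assume *: "\<forall>b<m. snd x b = snd y b \<and> fst x b = fst y b"
      have "snd x = snd y" using * carp[OF x] carp[OF y] by (intro Bij_ext[of _ "{..<m}"]) auto
      moreover have "fst x = fst y"
        using * x y by (intro extensionalityI[of _ "{..<m}"]) (auto simp: carrier_perm_wreath PiE_iff)
      ultimately show "x = y" by (simp add: prod_eq_iff)
    qed simp
    finally show "D x y = 0 \<longleftrightarrow> x = y" .
    assume z: "z \<in> carrier ?PW"
    have "s x z b \<le> s x y b + s y z b" if b: "b < m" for b
    proof (cases "snd x b = snd y b \<and> snd y b = snd z b")
      case True
      have "0 \<le> d (fst x b) (fst y b)" "0 \<le> d (fst y b) (fst z b)" by simp_all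
      then have "min 1 (d (fst x b) (fst z b)) \<le> min 1 (d (fst x b) (fst y b)) + min 1 (d (fst y b) (fst z b))"
        using M.triangle[OF car[OF x b] car[OF y b] car[OF z b]] by linarith
      then show ?thesis using True by (simp add: s_def)
    next
      case False
      then have "s x y b = 1 \<or> s y z b = 1" by (auto simp: s_def)
      then show ?thesis using s(1)[of x y b] s(1)[of y z b] s(2)[of x z b] by linarith
    qed
    then show "D x z \<le> D x y + D y z"
      unfolding D_def add_divide_distrib[symmetric] sum.distrib[symmetric]
      by (intro divide_right_mono sum_mono) auto
  qed
  then have bi: "bi_invariant_metric ?PW D"
  proof (rule bi_invariantI[OF PW.group_axioms])
    fix a x y assume a: "a \<in> carrier ?PW" and x: "x \<in> carrier ?PW" and y: "y \<in> carrier ?PW"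
    have "s (a \<otimes>\<^bsub>?PW\<^esub> x) (a \<otimes>\<^bsub>?PW\<^esub> y) b = s x y b" if b: "b < m" for b
    proof -
      have "snd x b < m" "snd y b < m" using Bij_in[OF carp[OF x], of b] Bij_in[OF carp[OF y], of b] b by auto
      then have "snd a (snd x b) = snd a (snd y b) \<longleftrightarrow> snd x b = snd y b"
        using Bij_inj[OF carp[OF a], of "snd x b" "snd y b"] by auto
      then show ?thesis
        using b \<open>snd y b < m\<close> car[OF a, of "snd y b"] car[OF x b] car[OF y b]
        by (auto simp: s_def mul bi_invariantD[OF K(1,3)])
    qed
    then show "D (a \<otimes>\<^bsub>?PW\<^esub> x) (a \<otimes>\<^bsub>?PW\<^esub> y) = D x y" by (simp add: D_def)
    have "s (x \<otimes>\<^bsub>?PW\<^esub> a) (y \<otimes>\<^bsub>?PW\<^esub> a) b = s x y (snd a b)" if b: "b < m" for b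
    proof -
      have "snd a b < m" using Bij_in[OF carp[OF a], of b] b by auto
      then show ?thesis
        using b car[OF a b] car[OF x, of "snd a b"] car[OF y, of "snd a b"]
        by (auto simp: s_def mul bi_invariantD[OF K(1,3)])
    qed
    moreover have "(\<Sum>b<m. s x y (snd a b)) = (\<Sum>b<m. s x y b)"
      using carp[OF a] by (intro sum.reindex_bij_betw) (auto simp: Bij_def)
    ultimately show "D (x \<otimes>\<^bsub>?PW\<^esub> a) (y \<otimes>\<^bsub>?PW\<^esub> a) = D x y" by (simp add: D_def)
  qed
  have fin: "finite (carrier ?PW)"
    unfolding carrier_perm_wreath using K(2) by (simp add: finite_PiE finite_Bij)
  obtain L E e where L: "(L, E) \<in> finite_metric_groups" and e: "e \<in> hom ?PW L"
    and iso: "\<forall>x\<in>carrier ?PW. \<forall>y\<in>carrier ?PW. E (e x) (e y) = D x y"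
    using finite_metric_group_on_nat[OF PW.group_axioms fin bi] by (elim exE conjE)
  have gL: "group L" using L by (simp add: finite_metric_groups_def)
  have "monomial_hom m (K, d) (L, E) e"
  proof (rule monomial_hom_average[OF K(1) gL m e])
    fix k p k' p' assume kp: "(k, p) \<in> carrier ?PW" "(k', p') \<in> carrier ?PW"
    show "E (e (k, p)) (e (k', p')) = (\<Sum>b<m. if p b = p' b then min 1 (d (k b) (k' b)) else 1) / real m"
      unfolding iso[rule_format, OF kp] D_def s_def fst_conv snd_conv by (rule refl)
  qed simp
  with L show ?thesis by blast
qed

lemma wreath_closed_finite_groups: "wreath_closed finite_metric_groups"
proof (rule wreath_closed.intro)
  fix K :: "nat monoid" and d assume K: "(K, d) \<in> finite_metric_groups"
  then show "group K" by (simp add: finite_metric_groups_def)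
  interpret Metric_space "carrier K" d
    using K by (simp add: finite_metric_groups_def bi_invariant_metric_def)
  show "pseudometric_on (carrier K) d"
    using triangle commute by (auto simp: pseudometric_on_def)
qed (use finite_groups_product finite_groups_monomial in blast)+

section \<open>Wreath products with sofic groups\<close>

text \<open>
  A finitely supported function is determined by its graph over the support, a finite subset of a
  countable set.
\<close>

lemma countable_wreath_product:
  assumes G: "group G" and "countable (carrier G)" and "countable (carrier H)"
  shows "countable (carrier (wreath_product G H))"
proof -
  define B where "B = {f \<in> carrier H \<rightarrow>\<^sub>E carrier G. finite {x \<in> carrier H. f x \<noteq> \<one>\<^bsub>G\<^esub>}}"
  define graph where "graph f = (\<lambda>x. (x, f x)) ` {x \<in> carrier H. f x \<noteq> \<one>\<^bsub>G\<^esub>}" for f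
  have "inj_on graph B"
  proof (rule inj_onI)
    fix f g assume fg: "f \<in> B" "g \<in> B" "graph f = graph g"
    have mem: "(x, y) \<in> graph f \<longleftrightarrow> x \<in> carrier H \<and> f x \<noteq> \<one>\<^bsub>G\<^esub> \<and> y = f x" for f x y
      by (auto simp: graph_def)
    have "f x = g x" if x: "x \<in> carrier H" for x
      using mem[of x "f x" f] mem[of x "f x" g] mem[of x "g x" f] mem[of x "g x" g] fg(3) x by metis
    then show "f = g"
      using fg(1,2) by (intro extensionalityI[of _ "carrier H"]) (auto simp: B_def PiE_iff)
  qed
  moreover have "graph ` B \<subseteq> {A. A \<subseteq> carrier H \<times> carrier G \<and> finite A}"
    by (auto simp: graph_def B_def)
  then have "countable (graph ` B)"
    by (rule countable_subset)
      (use countable_Collect_finite_subset[OF countable_SIGMA[OF assms(3) assms(2)]] in \<open>simp add: conj_commute\<close>)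
  ultimately have "countable B" using countable_image_inj_on by blast
  then show ?thesis
    using assms(3) unfolding carrier_wreath_product[OF G] B_def by (rule countable_SIGMA)
qed

theorem theorem3:
  fixes G :: "('a, 'm) monoid_scheme" and H :: "('b, 'n) monoid_scheme"
  assumes "group G" and "countable (carrier G)"
    and "group H" and "countable (carrier H)"
    and "sofic H"
  shows "(sofic G \<longrightarrow> sofic (wreath_product G H)) \<and>
         (hyperlinear G \<longrightarrow> hyperlinear (wreath_product G H)) \<and>
         (linear_sofic TYPE('f::field) G \<longrightarrow> linear_sofic TYPE('f) (wreath_product G H)) \<and>
         (weakly_sofic G \<longrightarrow> weakly_sofic (wreath_product G H))"
proof (intro conjI impI)
  note W = wreath_closed.approximable_wreath_product[OF _ assms(5)]
  show "sofic (wreath_product G H)" if "sofic G"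
    using that countable_wreath_product[OF assms(1,2,4)] unfolding sofic_iff_approximable
    by (blast intro: W[OF wreath_closed_symmetric_groups])
  show "hyperlinear (wreath_product G H)" if "hyperlinear G"
    using that unfolding hyperlinear_def unitary_groups_def[symmetric]
    by (rule W[OF wreath_closed_unitary_groups])
  show "linear_sofic TYPE('f) (wreath_product G H)" if "linear_sofic TYPE('f) G"
    using that unfolding linear_sofic_def linear_groups_def[symmetric]
    by (rule W[OF wreath_closed_linear_groups])
  show "weakly_sofic (wreath_product G H)" if "weakly_sofic G"
    using that unfolding weakly_sofic_def finite_metric_groups_def[symmetric]
    by (rule W[OF wreath_closed_finite_groups])
qed

end
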